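(* Let $x>0$, $\sigma>0$, $\beta\in\mathbb{R}$, let $X_t=x+\sigma W_t+\beta\sigma^2 t$ with $W$ a standard Brownian motion, let $G$ be a time change independent of $W$, and let $L_t=X_{G_t}$ be the corresponding time-changed Brownian motion. Let $\psi(u,t):=-\log E[e^{-uG_t}]$ be the Laplace exponent of $G_t$, and let $t^{(2)}$ be the first passage time of the second kind of $L$. 1. For any $t>0$ and $\epsilon\in\mathbb{R}$, the function $E_x[\mathbf{1}_{\{t<t^{(2)}\}}\delta(L_t-\ell)]$ of $\ell\in\mathbb{R}$ is given by $$\mathbf{1}_{\{\ell>0\}}\frac{e^{\beta(\ell-x)}}{2\pi}\int_{\mathbb{R}+i\epsilon}\left[e^{iz(\ell-x)}-e^{iz(\ell+x)}\right]e^{-\psi(\sigma^2(z^2+\beta^2)/2,\,t)}\,dz,$$ while $E_x[\mathbf{1}_{\{t\ge t^{(2)}\}}\delta(L_t-\ell)]$ is given by $$\frac{e^{\beta(\ell-x)}}{2\pi}\int_{\mathbb{R}+i\epsilon}e^{iz(x+|\ell|)}e^{-\psi(\sigma^2(z^2+\beta^2)/2,\,t)}\,dz.$$ 2. For any $t>0$, the cumulative distribution function $P^{(2)}(t,x):=E_x[\mathbf{1}_{\{t^{(2)}\le t\}}]$ is given by $$P^{(2)}(t,x)=e^{-2\beta x}\mathbf{1}_{\{\beta>0\}}+\mathbf{1}_{\{\beta\le 0\}}-\frac{e^{-\beta x}}{\pi}\int_{-\infty}^{\infty}\frac{z\sin(zx)}{z^2+\beta^2}\,e^{-\psi(\sigma^2(z^2+\beta^2)/2,\,t)}\,dz,$$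 while for any $k$ in the (open) upper half plane of $\mathbb{C}$, $$E_x\left[\mathbf{1}_{\{t<t^{(2)}\}}e^{-\beta L_t+ikL_t}\right]=\frac{e^{-\beta x}}{2\pi}\int_{\mathbb{R}}\left[\frac{i}{k-z}-\frac{i}{k+z}\right]e^{izx}\,e^{-\psi(\sigma^2(z^2+\beta^2)/2,\,t)}\,dz.$$
   Context: Setting: a probability space supports a standard Brownian motion $W$ and an independent strictly increasing càdlàg process $G=(G_t)_{t\ge0}$ with $G_0=0$, called the time change, normalized by $\lim_{T\to\infty}T^{-1}E[G_T]=1$. The time-changed Brownian motion (TCBM) generated by $X$ and $G$ is $L_t=X_{G_t}$, $t\ge 0$. The subscript $x$ in $E_x$ indicates the starting point $X_0=L_0=x$. First passage time of the second kind: let $t^*=\inf\{t: X_t\le 0\}$ be the first passage time of the drifting Brownian motion $X$; then $t^{(2)}:=\inf\{t: G_t\ge t^*\}$. Laplace exponent: $e^{-\psi(u,t)}=E[e^{-uG_t}]$, also for complex arguments $u$. Delta notation: for an event $A$, $E_x[\mathbf{1}_A\,\delta(L_t-\ell)]$ denotes the density in $\ell$ of the sub-probability measure $B\mapsto P_x(A\cap\{L_t\in B\})$ on $\mathbb{R}$. Contours: $\mathbb{R}+i\epsilon$ denotes the horizontal line $\{y+i\epsilon: y\in\mathbb{R}\}$ in $\mathbb{C}$, oriented from left to right.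
   Formalization: In part 1, "any ε" is restricted to those ε for which E[exp(-uG_t)] exists for all u = σ²(z²+β²)/2 with z on the line R+iε (automatic if |ε| ≤ |β|); otherwise ψ is undefined on the contour. Contour integrals are read as improper integrals. *)

theory Defs
  imports "HOL-Probability.Probability" "HOL-Complex_Analysis.Complex_Analysis"
begin

text \<open>
  Stochastic processes on a probability space \<open>M\<close> are functions \<open>real \<Rightarrow> 'a \<Rightarrow> real\<close>, of which only
  the values at times \<open>t \<ge> 0\<close> matter. Path properties are required for every sample point.
\<close>

definition standard_brownian_motion :: "'a measure \<Rightarrow> (real \<Rightarrow> 'a \<Rightarrow> real) \<Rightarrow> bool" where
  "standard_brownian_motion M W \<longleftrightarrow>
     (\<forall>t\<ge>0. W t \<in> borel_measurable M) \<and>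
     (\<forall>\<omega>\<in>space M. W 0 \<omega> = 0) \<and>
     (\<forall>\<omega>\<in>space M. continuous_on {0..} (\<lambda>t. W t \<omega>)) \<and>
     (\<forall>s t. 0 \<le> s \<longrightarrow> s < t \<longrightarrow>
        distributed M lborel (\<lambda>\<omega>. W t \<omega> - W s \<omega>) (normal_density 0 (sqrt (t - s)))) \<and>
     (\<forall>(\<tau> :: nat \<Rightarrow> real) n. 0 \<le> \<tau> 0 \<longrightarrow> mono \<tau> \<longrightarrow>
        prob_space.indep_vars M (\<lambda>_. borel) (\<lambda>i \<omega>. W (\<tau> (Suc i)) \<omega> - W (\<tau> i) \<omega>) {..<n})"

definition cadlag :: "(real \<Rightarrow> real) \<Rightarrow> bool" where
  "cadlag g \<longleftrightarrow> (\<forall>t\<ge>0. continuous (at_right t) g) \<and> (\<forall>t>0. \<exists>l. (g \<longlongrightarrow> l) (at_left t))"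

text \<open>
  The limit in the last clause forces \<open>G T\<close> to be integrable for all \<open>T \<ge> 0\<close>: a non-integrable
  function has Bochner integral \<open>0\<close>, and the paths of \<open>G\<close> are nonnegative and increasing.
\<close>

definition time_change :: "'a measure \<Rightarrow> (real \<Rightarrow> 'a \<Rightarrow> real) \<Rightarrow> bool" where
  "time_change M G \<longleftrightarrow>
     (\<forall>t\<ge>0. G t \<in> borel_measurable M) \<and>
     (\<forall>\<omega>\<in>space M. G 0 \<omega> = 0 \<and> strict_mono_on {0..} (\<lambda>t. G t \<omega>) \<and> cadlag (\<lambda>t. G t \<omega>)) \<and>
     ((\<lambda>T. (\<integral>\<omega>. G T \<omega> \<partial>M) / T) \<longlongrightarrow> 1) at_top"

text \<open>Independence of the whole processes, that is, of their path-valued random variables.\<close>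

definition independent_processes ::
  "'a measure \<Rightarrow> (real \<Rightarrow> 'a \<Rightarrow> real) \<Rightarrow> (real \<Rightarrow> 'a \<Rightarrow> real) \<Rightarrow> bool" where
  "independent_processes M W G \<longleftrightarrow>
     prob_space.indep_var M
       (PiM {0..} (\<lambda>_. borel)) (\<lambda>\<omega>. restrict (\<lambda>t. W t \<omega>) {0..})
       (PiM {0..} (\<lambda>_. borel)) (\<lambda>\<omega>. restrict (\<lambda>t. G t \<omega>) {0..})"

definition drifted_bm ::
  "real \<Rightarrow> real \<Rightarrow> real \<Rightarrow> (real \<Rightarrow> 'a \<Rightarrow> real) \<Rightarrow> real \<Rightarrow> 'a \<Rightarrow> real" where
  "drifted_bm x \<sigma> \<beta> W t \<omega> = x + \<sigma> * W t \<omega> + \<beta> * \<sigma>\<^sup>2 * t"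

definition tcbm ::
  "(real \<Rightarrow> 'a \<Rightarrow> real) \<Rightarrow> (real \<Rightarrow> 'a \<Rightarrow> real) \<Rightarrow> real \<Rightarrow> 'a \<Rightarrow> real" where
  "tcbm X G t \<omega> = X (G t \<omega>) \<omega>"

text \<open>Passage times are extended reals; the infimum of the empty set is \<open>\<infinity>\<close>.\<close>

definition first_passage :: "(real \<Rightarrow> 'a \<Rightarrow> real) \<Rightarrow> 'a \<Rightarrow> ereal" where
  "first_passage X \<omega> = Inf (ereal ` {t. 0 \<le> t \<and> X t \<omega> \<le> 0})"

definition first_passage2 ::
  "(real \<Rightarrow> 'a \<Rightarrow> real) \<Rightarrow> (real \<Rightarrow> 'a \<Rightarrow> real) \<Rightarrow> 'a \<Rightarrow> ereal" where
  "first_passage2 X G \<omega> = Inf (ereal ` {t. 0 \<le> t \<and> first_passage X \<omega> \<le> ereal (G t \<omega>)})"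

text \<open>
  The domain of \<open>\<psi>(\<cdot>, t)\<close> consists of the complex \<open>u\<close> for which \<open>E[exp (-u G\<^sub>t)]\<close> exists. It contains
  the closed right half plane.
\<close>

definition laplace_domain :: "'a measure \<Rightarrow> (real \<Rightarrow> 'a \<Rightarrow> real) \<Rightarrow> real \<Rightarrow> complex set" where
  "laplace_domain M G t = {u. integrable M (\<lambda>\<omega>. exp (- u * complex_of_real (G t \<omega>)))}"

definition laplace_transform ::
  "'a measure \<Rightarrow> (real \<Rightarrow> 'a \<Rightarrow> real) \<Rightarrow> complex \<Rightarrow> real \<Rightarrow> complex" where
  "laplace_transform M G u t = (\<integral>\<omega>. exp (- u * complex_of_real (G t \<omega>)) \<partial>M)"

definition laplace_exponent ::
  "'a measure \<Rightarrow> (real \<Rightarrow> 'a \<Rightarrow> real) \<Rightarrow> complex \<Rightarrow> real \<Rightarrow> complex" (\<open>\<psi>\<close>) where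
  "\<psi> M G u t = - Ln (laplace_transform M G u t)"

text \<open>
  For non-real \<open>u\<close> the transform may vanish. There \<open>\<psi>\<close> is infinite and \<open>exp (- \<psi>)\<close> is \<open>0\<close>, whereas
  in HOL \<open>Ln 0 = 0\<close>.
\<close>

definition exp_minus_psi ::
  "'a measure \<Rightarrow> (real \<Rightarrow> 'a \<Rightarrow> real) \<Rightarrow> complex \<Rightarrow> real \<Rightarrow> complex" where
  "exp_minus_psi M G u t = (if laplace_transform M G u t = 0 then 0 else exp (- \<psi> M G u t))"

lemma exp_minus_psi_eq: "exp_minus_psi M G u t = laplace_transform M G u t"
  by (simp add: exp_minus_psi_def laplace_exponent_def)

text \<open>
  \<open>f\<close> is a version of the density \<open>l \<mapsto> E[1\<^sub>A \<delta>(Y - l)]\<close> of the measure \<open>B \<mapsto> P(A \<inter> {Y \<in> B})\<close>. The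
  density is complex-valued because it is going to be given by a complex contour integral.
\<close>

definition is_delta_density ::
  "'a measure \<Rightarrow> ('a \<Rightarrow> bool) \<Rightarrow> ('a \<Rightarrow> real) \<Rightarrow> (real \<Rightarrow> complex) \<Rightarrow> bool" where
  "is_delta_density M A Y f \<longleftrightarrow>
     integrable lborel f \<and>
     (\<forall>B\<in>sets borel. {\<omega>\<in>space M. A \<omega> \<and> Y \<omega> \<in> B} \<in> sets M \<and>
        complex_of_real (measure M {\<omega>\<in>space M. A \<omega> \<and> Y \<omega> \<in> B}) = (LINT l:B|lborel. f l))"

text \<open>
  The integral over the line \<open>\<real> + i\<epsilon>\<close>, oriented from left to right, as an improper integral whose
  two endpoints tend to infinity independently. Absolute convergence is not available in general:
  on the real line it amounts to conditions such as \<open>E[G\<^sub>t powr (-1/2)] < \<infinity>\<close>.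
\<close>

definition has_line_integral :: "real \<Rightarrow> (complex \<Rightarrow> complex) \<Rightarrow> complex \<Rightarrow> bool" where
  "has_line_integral \<epsilon> f I \<longleftrightarrow>
     (\<forall>a b. a \<le> b \<longrightarrow> f contour_integrable_on linepath (Complex a \<epsilon>) (Complex b \<epsilon>)) \<and>
     ((\<lambda>(a, b). contour_integral (linepath (Complex a \<epsilon>) (Complex b \<epsilon>)) f) \<longlongrightarrow> I)
       (at_bot \<times>\<^sub>F at_top)"

definition line_integrable :: "real \<Rightarrow> (complex \<Rightarrow> complex) \<Rightarrow> bool" where
  "line_integrable \<epsilon> f \<longleftrightarrow> (\<exists>I. has_line_integral \<epsilon> f I)"

definition line_integral :: "real \<Rightarrow> (complex \<Rightarrow> complex) \<Rightarrow> complex" where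
  "line_integral \<epsilon> f = (THE I. has_line_integral \<epsilon> f I)"

end

theory Submission
  imports Defs
begin

text \<open>
  For odd \<open>\<theta>\<close> put \<open>\<phi> l = exp (- \<beta> * l) * \<theta> l\<close>. Started from \<open>0\<close>, the drifted Brownian motion has
  \<open>E[\<phi> (X\<^sub>s)] = 0\<close> for every \<open>s\<close>, so the paths that have hit \<open>0\<close> before \<open>g\<close> do not contribute to
  \<open>E[\<phi> (X\<^sub>g)]\<close>. This yields the law of \<open>X\<^sub>g\<close> on the survival event by the method of images, with
  neither the strong Markov property nor Girsanov's theorem: it suffices to stop at the first point
  of a fine time grid where \<open>X\<close> is below a small barrier. Since \<open>G\<close> is strictly increasing and
  right-continuous, \<open>t < t\<^sup>(\<^sup>2\<^sup>)\<close> means survival up to \<open>G\<^sub>t\<close>, and by independence all densities are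
  mixtures over the law of \<open>s = \<sigma>\<^sup>2 G\<^sub>t\<close>.

  For fixed \<open>s\<close> the formulas are Gaussian Fourier integrals. They are mixed over \<open>s\<close> by dominated
  convergence, which applies to the conditionally convergent line integrals because the truncated
  integrals are bounded by a constant times \<open>exp ((\<epsilon>\<^sup>2 - \<beta>\<^sup>2) * s / 2)\<close>, uniformly in the
  truncation.
\<close>

section \<open>Line integrals of Gaussian mixtures\<close>

text \<open>The weight \<open>exp (- \<beta> * l)\<close> is the Cameron-Martin factor: it turns a
  drifted Gaussian average into a centred one, up to a constant. A survivor is positive, so it sees
  only the positive half of an odd test function, while the expectation over all paths produces the
  heat density minus its mirror image; equating the two is the image formula. Lipschitz test
  functions are used because at the first grid point below the barrier the path is only close to 0,
  so the odd average there must be small rather than zero.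

  On the Fourier side the joint integral over the line and over \<open>s\<close> need not converge
  absolutely. Oscillation replaces absolute convergence: at nonzero frequency the truncated
  integrals are bounded by integration by parts. Only the frequency \<open>l - x\<close> can vanish,
  so convergence may fail at the single point \<open>l = x\<close>, which a density ignores. The
  factor \<open>exp ((\<epsilon>\<^sup>2 - \<beta>\<^sup>2) * s / 2)\<close> is the modulus of
  \<open>exp (- u * G\<^sub>t)\<close> at z = i \<epsilon>, and its integrability comes from the
  domain hypothesis.\<close>

abbreviation heat :: "real \<Rightarrow> real \<Rightarrow> real" where
  "heat s \<equiv> normal_density 0 (sqrt s)"

text \<open>It plays two roles: \<open>gauss s y\<close> is the Gaussian weight on the Fourier side,
  and \<open>gauss s \<beta>\<close> is the constant that removing the drift leaves behind.\<close>

abbreviation gauss :: "real \<Rightarrow> real \<Rightarrow> real" where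
  "gauss s y \<equiv> exp (- y\<^sup>2 * s / 2)"

lemma has_line_integral_unique:
  assumes "has_line_integral \<epsilon> f I" "has_line_integral \<epsilon> f J"
  shows "I = J"
proof -
  have "(at_bot :: real filter) \<times>\<^sub>F (at_top :: real filter) \<noteq> bot"
    by (simp add: prod_filter_eq_bot)
  then show ?thesis
    using assms unfolding has_line_integral_def by (meson tendsto_unique)
qed

lemma line_integral_eq:
  assumes "has_line_integral \<epsilon> f I"
  shows "line_integrable \<epsilon> f" "line_integral \<epsilon> f = I"
  using assms has_line_integral_unique[OF _ assms]
  unfolding line_integrable_def line_integral_def by (blast, blast)

lemma has_line_integral_diff:
  assumes "has_line_integral \<epsilon> f I" "has_line_integral \<epsilon> g J"
  shows "has_line_integral \<epsilon> (\<lambda>z. f z - g z) (I - J)"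
proof -
  have i: "f contour_integrable_on linepath (Complex a \<epsilon>) (Complex b \<epsilon>)"
    "g contour_integrable_on linepath (Complex a \<epsilon>) (Complex b \<epsilon>)" if "a \<le> b" for a b
    using assms that by (auto simp: has_line_integral_def)
  have "((\<lambda>p. (case p of (a, b) \<Rightarrow> contour_integral (linepath (Complex a \<epsilon>) (Complex b \<epsilon>)) f)
     - (case p of (a, b) \<Rightarrow> contour_integral (linepath (Complex a \<epsilon>) (Complex b \<epsilon>)) g)) \<longlongrightarrow> I - J) (at_bot \<times>\<^sub>F at_top)"
    using assms unfolding has_line_integral_def by (intro tendsto_diff) auto
  \<comment> \<open>The truncated integrals are known to subtract only for \<open>a \<le> b\<close>,
    which holds eventually since the filter forces \<open>a \<le> 0 \<le> b\<close>.\<close>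
  moreover have "eventually (\<lambda>p. (case p of (a, b) \<Rightarrow> contour_integral (linepath (Complex a \<epsilon>) (Complex b \<epsilon>)) f)
     - (case p of (a, b) \<Rightarrow> contour_integral (linepath (Complex a \<epsilon>) (Complex b \<epsilon>)) g)
     = (case p of (a, b) \<Rightarrow> contour_integral (linepath (Complex a \<epsilon>) (Complex b \<epsilon>)) (\<lambda>z. f z - g z))) (at_bot \<times>\<^sub>F at_top)"
    unfolding eventually_prod_filter
    by (intro exI[of _ "\<lambda>a. a \<le> 0"] exI[of _ "\<lambda>b. b \<ge> 0"])
      (auto simp: eventually_le_at_bot eventually_ge_at_top intro!: contour_integral_diff[symmetric] i)
  ultimately have "((\<lambda>(a, b). contour_integral (linepath (Complex a \<epsilon>) (Complex b \<epsilon>)) (\<lambda>z. f z - g z)) \<longlongrightarrow> I - J) (at_bot \<times>\<^sub>F at_top)"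
    by (rule Lim_transform_eventually)
  then show ?thesis
    unfolding has_line_integral_def using i by (auto intro: contour_integrable_diff)
qed

text \<open>Translation by \<open>c\<close> moves the segment to the real axis, where a contour
  integral is an ordinary one. A degenerate segment is treated apart because that comparison is for
  endpoints in strict order.\<close>

lemma has_contour_integral_horizontal:
  assumes "a \<le> b" and "((\<lambda>y. f (Complex y \<epsilon>)) has_integral I) {a..b}"
  shows "(f has_contour_integral I) (linepath (Complex a \<epsilon>) (Complex b \<epsilon>))"
proof (cases "a = b")
  case True
  then have "I = 0" using assms(2) by (metis content_real_eq_0 has_integral_null_eq order_refl interval_cbox)
  then show ?thesis using True by (simp add: has_contour_integral_linepath)
next
  case False
  define c where "c = Complex 0 \<epsilon>"
  have eq: "Complex r \<epsilon> = of_real r + c" for r by (simp add: complex_eq_iff c_def)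
  have "((\<lambda>z. f (z + c)) has_contour_integral I) (linepath (of_real a) (of_real b))"
    using assms False by (subst has_contour_integral_linepath_Reals_iff) (auto simp: eq)
  then show ?thesis
    unfolding has_contour_integral_linepath eq
    by (simp add: linepath_def scaleR_conv_of_real algebra_simps)
qed

text \<open>Dominated convergence speaks about sequences, while the improper integral lets both
  endpoints move independently. If the limit failed, one bad pair beyond \<open>- n\<close> and
  \<open>n\<close> for each \<open>n\<close> would form a sequence contradicting the
  hypothesis.\<close>

lemma tendsto_at_bot_at_topI:
  fixes f :: "real \<times> real \<Rightarrow> 'b::metric_space"
  assumes "\<And>a b. filterlim a at_bot sequentially \<Longrightarrow> filterlim b at_top sequentially \<Longrightarrow>
    (\<lambda>n. f (a n, b n)) \<longlonglongrightarrow> l"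
  shows "(f \<longlongrightarrow> l) (at_bot \<times>\<^sub>F at_top)"
proof (rule ccontr)
  assume "\<not> ?thesis"
  then obtain e where e: "e > 0" "\<not> eventually (\<lambda>p. dist (f p) l < e) (at_bot \<times>\<^sub>F at_top)"
    unfolding tendsto_iff by blast
  have "\<exists>a b. a \<le> - real n \<and> b \<ge> real n \<and> \<not> dist (f (a, b)) l < e" for n
  proof (rule ccontr)
    assume *: "\<not> ?thesis"
    have "eventually (\<lambda>p. dist (f p) l < e) (at_bot \<times>\<^sub>F at_top)"
      unfolding eventually_prod_filter
      using * by (intro exI[of _ "\<lambda>a. a \<le> - real n"] exI[of _ "\<lambda>b. b \<ge> real n"])
        (auto simp: eventually_le_at_bot eventually_ge_at_top)
    with e(2) show False by blast
  qed
  then obtain a b where ab: "\<And>n. a n \<le> - real n" "\<And>n. b n \<ge> real n"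
    "\<And>n. \<not> dist (f (a n, b n)) l < e" by metis
  have "filterlim a at_bot sequentially"
    unfolding filterlim_uminus_at_bot
    by (rule filterlim_at_top_mono[OF filterlim_real_sequentially]) (use ab in \<open>auto simp: le_minus_iff\<close>)
  moreover have "filterlim b at_top sequentially"
    by (rule filterlim_at_top_mono[OF filterlim_real_sequentially]) (auto simp: ab)
  ultimately have "(\<lambda>n. f (a n, b n)) \<longlonglongrightarrow> l" by (rule assms)
  then have "eventually (\<lambda>n. dist (f (a n, b n)) l < e) sequentially"
    using e(1) by (rule tendstoD)
  then show False using ab(3) by (auto simp: eventually_sequentially)
qed

text \<open>On the line at height \<epsilon> this is the random variable whose mean is
  \<open>exp_minus_psi\<close>: with \<open>s = \<sigma>\<^sup>2 * G\<^sub>t\<close> it equals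
  \<open>exp (- u * G\<^sub>t)\<close> at
  \<open>u = \<sigma>\<^sup>2 * (z\<^sup>2 + \<beta>\<^sup>2) / 2\<close>.\<close>

definition gauss_kernel :: "real \<Rightarrow> real \<Rightarrow> real \<Rightarrow> real \<Rightarrow> complex" where
  "gauss_kernel \<beta> \<epsilon> y s = exp (- ((Complex y \<epsilon>)\<^sup>2 + complex_of_real (\<beta>\<^sup>2)) * complex_of_real s / 2)"

lemma norm_gauss_kernel:
  "norm (gauss_kernel \<beta> \<epsilon> y s) = exp ((\<epsilon>\<^sup>2 - \<beta>\<^sup>2) * s / 2) * gauss s y"
  unfolding gauss_kernel_def norm_exp_eq_Re
  by (simp add: power2_eq_square field_simps flip: exp_add)

lemma gauss_kernel_measurable [measurable (raw)]:
  assumes [measurable]: "f \<in> borel_measurable M" "g \<in> borel_measurable M"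
  shows "(\<lambda>x. gauss_kernel \<beta> \<epsilon> (f x) (g x)) \<in> borel_measurable M"
  unfolding gauss_kernel_def Complex_eq by measurable

lemma integrable_exp_square:
  fixes s :: real
  assumes "s > 0"
  shows "integrable lborel (\<lambda>y. gauss s y)"
proof -
  have "integrable lborel (\<lambda>y. sqrt (2 * pi / s) * normal_density 0 (1 / sqrt s) y)"
    using assms by (intro integrable_mult_right integrable_normal_density) auto
  also have "(\<lambda>y. sqrt (2 * pi / s) * normal_density 0 (1 / sqrt s) y) = (\<lambda>y. gauss s y)"
    using assms by (auto simp: normal_density_def fun_eq_iff real_sqrt_divide field_simps)
  finally show ?thesis .
qed

lemma integrable_bounded_gauss_kernel:
  assumes [measurable]: "f \<in> borel_measurable borel" and "\<And>y. norm (f y) \<le> D" "s > 0"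
  shows "integrable lborel (\<lambda>y. f y * gauss_kernel \<beta> \<epsilon> y s)"
proof (rule Bochner_Integration.integrable_bound)
  show "integrable lborel (\<lambda>y. D * (exp ((\<epsilon>\<^sup>2 - \<beta>\<^sup>2) * s / 2) * gauss s y))"
    using integrable_exp_square[OF assms(3)] by simp
  show "AE y in lborel. norm (f y * gauss_kernel \<beta> \<epsilon> y s)
    \<le> norm (D * (exp ((\<epsilon>\<^sup>2 - \<beta>\<^sup>2) * s / 2) * gauss s y))"
    using assms(2) order.trans[OF norm_ge_zero assms(2)]
    by (intro AE_I2) (simp add: norm_mult norm_gauss_kernel mult_right_mono abs_mult)
  show "(\<lambda>y. f y * gauss_kernel \<beta> \<epsilon> y s) \<in> borel_measurable lborel"
    by measurable
qed

text \<open>Two bounds with different tasks: \<open>D\<close> allows Fubini on a bounded segment,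
  and \<open>C\<close>, uniform in the segment, dominates the truncated integrals when the endpoints
  move off. The mixed integrand itself need not be absolutely integrable on the line.\<close>

lemma has_line_integral_mixture:
  fixes N :: "real measure" and f :: "real \<Rightarrow> complex"
  assumes "prob_space N" and N [measurable_cong]: "sets N = sets borel"
    and pos: "AE s in N. s > 0"
    and int: "integrable N (\<lambda>s. exp ((\<epsilon>\<^sup>2 - \<beta>\<^sup>2) * s / 2))"
    and f [measurable]: "f \<in> borel_measurable borel" and D: "\<And>y. norm (f y) \<le> D"
    and C: "\<And>s a b. s > 0 \<Longrightarrow> a \<le> b \<Longrightarrow>
      norm (integral {a..b} (\<lambda>y. f y * gauss_kernel \<beta> \<epsilon> y s)) \<le> C * exp ((\<epsilon>\<^sup>2 - \<beta>\<^sup>2) * s / 2)"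
    and F: "\<And>y. F (Complex y \<epsilon>) = f y * (\<integral>s. gauss_kernel \<beta> \<epsilon> y s \<partial>N)"
  shows "has_line_integral \<epsilon> F (\<integral>s. (LBINT y. f y * gauss_kernel \<beta> \<epsilon> y s) \<partial>N)"
proof -
  interpret N: prob_space N by fact
  interpret P: pair_sigma_finite lborel N ..
  have D0: "D \<ge> 0" using order.trans[OF norm_ge_zero D] .
  let ?w = "\<lambda>s. exp ((\<epsilon>\<^sup>2 - \<beta>\<^sup>2) * s / 2)"
  let ?K = "\<lambda>y s. f y * gauss_kernel \<beta> \<epsilon> y s"
  have kle: "AE s in N. norm (?K y s) \<le> D * ?w s" for y
    using pos
  proof eventually_elim
    case (elim s)
    have "norm (f y) * (?w s * gauss s y) \<le> D * (?w s * 1)"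
      using D elim D0 by (intro mult_mono) auto
    then show ?case by (simp add: norm_mult norm_gauss_kernel)
  qed
  have Kint: "integrable N (?K y)" for y
    using kle D0 by (intro Bochner_Integration.integrable_bound[OF integrable_mult_right[OF int, of D]])
      (auto simp: abs_mult)
  have nK: "(\<integral>s. norm (?K y s) \<partial>N) \<le> D * (\<integral>s. ?w s \<partial>N)" for y
  proof -
    have "(\<integral>s. norm (?K y s) \<partial>N) \<le> (\<integral>s. D * ?w s \<partial>N)"
      using kle Kint int by (intro integral_mono_AE) auto
    then show ?thesis by simp
  qed
  have w0: "(\<integral>s. ?w s \<partial>N) \<ge> 0" by (intro integral_nonneg_AE) auto
  \<comment> \<open>On a bounded segment \<open>D\<close> times the weight in \<open>s\<close> is a
    joint majorant.\<close>
  have fub: "integrable (lborel \<Otimes>\<^sub>M N) (\<lambda>(y, s). indicator {a..b} y *\<^sub>R ?K y s)" for a b :: real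
  proof (rule P.Fubini_integrable)
    show "(\<lambda>(y, s). indicator {a..b} y *\<^sub>R ?K y s) \<in> borel_measurable (lborel \<Otimes>\<^sub>M N)"
      by measurable
    show "AE y in lborel. integrable N (\<lambda>s. case (y, s) of (y, s) \<Rightarrow> indicator {a..b} y *\<^sub>R ?K y s)"
      using Kint by simp
    have "integrable lborel (\<lambda>y. indicator {a..b} y * (D * (\<integral>s. ?w s \<partial>N)))"
      by (intro integrable_mult_left integrable_real_indicator) (auto simp: emeasure_lborel_Icc_eq)
    then show "integrable lborel (\<lambda>y. \<integral>s. norm (case (y, s) of (y, s) \<Rightarrow> indicator {a..b} y *\<^sub>R ?K y s) \<partial>N)"
    proof (rule Bochner_Integration.integrable_bound)
      show "AE y in lborel. norm (\<integral>s. norm (case (y, s) of (y, s) \<Rightarrow> indicator {a..b} y *\<^sub>R ?K y s) \<partial>N)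
        \<le> norm (indicator {a..b} y * (D * (\<integral>s. ?w s \<partial>N)))"
        using nK D0 w0
        by (intro AE_I2) (auto simp: abs_mult indicator_def intro!: mult_nonneg_nonneg integral_nonneg)
    qed measurable
  qed
  define T where "T a b s = (LBINT y. indicator {a..b} y *\<^sub>R ?K y s)" for a b s
  have T_meas [measurable]: "T a b \<in> borel_measurable N" for a b
    unfolding T_def by measurable
  have T_eq: "T a b s = integral {a..b} (\<lambda>y. ?K y s)" if "s > 0" for a b s
  proof -
    have "set_integrable lborel {a..b} (\<lambda>y. ?K y s)"
      unfolding set_integrable_def
      by (rule integrable_mult_indicator) (use that integrable_bounded_gauss_kernel[OF f D] in auto)
    from set_borel_integral_eq_integral(2)[OF this] show ?thesis
      by (simp add: T_def set_lebesgue_integral_def)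
  qed
  have trunc: "((\<lambda>y. F (Complex y \<epsilon>)) has_integral (\<integral>s. T a b s \<partial>N)) {a..b}" for a b
  proof -
    have 1: "set_integrable lborel {a..b} (\<lambda>y. F (Complex y \<epsilon>))"
      using P.integrable_fst[OF fub[of a b]] unfolding set_integrable_def F by simp
    have "(LINT y:{a..b}|lborel. F (Complex y \<epsilon>)) = (\<integral>s. T a b s \<partial>N)"
      using P.Fubini_integral[OF fub[of a b]] unfolding set_lebesgue_integral_def F T_def by simp
    then show ?thesis using set_borel_integral_eq_integral[OF 1]
      by (metis integrable_integral)
  qed
  have contour: "(F has_contour_integral (\<integral>s. T a b s \<partial>N)) (linepath (Complex a \<epsilon>) (Complex b \<epsilon>))"
    if "a \<le> b" for a b
    using that trunc by (rule has_contour_integral_horizontal)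
  show ?thesis
    unfolding has_line_integral_def
  proof (intro conjI allI impI)
    show "F contour_integrable_on linepath (Complex a \<epsilon>) (Complex b \<epsilon>)" if "a \<le> b" for a b
      using contour[OF that] by (auto simp: contour_integrable_on_def)
  next
    show "((\<lambda>(a, b). contour_integral (linepath (Complex a \<epsilon>) (Complex b \<epsilon>)) F) \<longlongrightarrow>
      (\<integral>s. (LBINT y. ?K y s) \<partial>N)) (at_bot \<times>\<^sub>F at_top)"
    proof (rule tendsto_at_bot_at_topI, simp only: prod.case)
      fix a b :: "nat \<Rightarrow> real"
      assume ab: "filterlim a at_bot sequentially" "filterlim b at_top sequentially"
      have ev0: "eventually (\<lambda>n. a n \<le> 0 \<and> 0 \<le> b n) sequentially"
        using filterlim_at_bot[THEN iffD1, OF ab(1), rule_format, of 0]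
          filterlim_at_top[THEN iffD1, OF ab(2), rule_format, of 0]
        by eventually_elim simp
      then obtain n0 where n0: "\<And>n. n \<ge> n0 \<Longrightarrow> a n \<le> 0 \<and> 0 \<le> b n"
        by (auto simp: eventually_sequentially)
      \<comment> \<open>Shifting the sequences by \<open>n0\<close> ensures \<open>a \<le> b\<close>
        for every index, as \<open>C\<close> and the contour formula require.\<close>
      have "(\<lambda>n. \<integral>s. T (a (n + n0)) (b (n + n0)) s \<partial>N) \<longlonglongrightarrow> (\<integral>s. (LBINT y. ?K y s) \<partial>N)"
      proof (rule integral_dominated_convergence[where w="\<lambda>s. C * ?w s"])
        show "(\<lambda>s. \<integral>y. ?K y s \<partial>lborel) \<in> borel_measurable N"
          by measurable
        show "AE s in N. norm (T (a (n + n0)) (b (n + n0)) s) \<le> C * ?w s" for n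
          using pos
        proof eventually_elim
          case (elim s)
          then show ?case using n0[of "n + n0"] by (subst T_eq) (auto intro!: C)
        qed
        \<comment> \<open>For fixed \<open>s > 0\<close> the Gaussian decay makes the integral over
          the whole line absolutely convergent.\<close>
        show "AE s in N. (\<lambda>n. T (a (n + n0)) (b (n + n0)) s) \<longlonglongrightarrow> (LBINT y. ?K y s)"
          using pos
        proof eventually_elim
          case (elim s)
          note ik = integrable_bounded_gauss_kernel[OF f D elim, of \<beta> \<epsilon>]
          show ?case
            unfolding T_def
          proof (rule integral_dominated_convergence[where w="\<lambda>y. norm (?K y s)"])
            show "AE y in lborel. (\<lambda>n. indicator {a (n + n0)..b (n + n0)} y *\<^sub>R ?K y s) \<longlonglongrightarrow> ?K y s"
            proof (rule AE_I2, rule tendsto_eventually)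
              fix y
              have "eventually (\<lambda>n. a n \<le> y \<and> y \<le> b n) sequentially"
                using filterlim_at_bot[THEN iffD1, OF ab(1), rule_format, of y]
                  filterlim_at_top[THEN iffD1, OF ab(2), rule_format, of y]
                by eventually_elim simp
              from sequentially_offset[OF this, of n0] show "eventually (\<lambda>n. indicator {a (n + n0)..b (n + n0)} y *\<^sub>R ?K y s = ?K y s) sequentially"
                by eventually_elim simp
            qed
            show "AE y in lborel. norm (indicator {a (n + n0)..b (n + n0)} y *\<^sub>R ?K y s) \<le> norm (?K y s)" for n
              by (rule AE_I2) (simp add: indicator_def)
            show "integrable lborel (\<lambda>y. norm (?K y s))" using ik by (rule integrable_norm)
          qed measurable
        qed
      qed (use int in auto)
      moreover have "contour_integral (linepath (Complex (a (n + n0)) \<epsilon>) (Complex (b (n + n0)) \<epsilon>)) F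
        = (\<integral>s. T (a (n + n0)) (b (n + n0)) s \<partial>N)" for n
        using n0[of "n + n0"] by (intro contour_integral_unique contour) auto
      ultimately have "(\<lambda>n. contour_integral (linepath (Complex (a (n + n0)) \<epsilon>) (Complex (b (n + n0)) \<epsilon>)) F)
        \<longlonglongrightarrow> (\<integral>s. (LBINT y. ?K y s) \<partial>N)" by simp
      then show "(\<lambda>n. contour_integral (linepath (Complex (a n) \<epsilon>) (Complex (b n) \<epsilon>)) F)
        \<longlonglongrightarrow> (\<integral>s. (LBINT y. ?K y s) \<partial>N)"
        by (rule LIMSEQ_offset)
    qed
  qed
qed

section \<open>Truncated Fourier integrals\<close>

text \<open>Second mean value argument: integrate by parts against the primitive of
  \<open>f\<close>. As the weight decreases from 1, the boundary term is at most
  \<open>C * gauss s b\<close> and the remaining integral at most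
  \<open>C * (1 - gauss s b)\<close>, so no constant is lost.\<close>

lemma norm_integral_gauss_weight_half:
  fixes f :: "real \<Rightarrow> complex"
  assumes f: "continuous_on UNIV f" and s: "s \<ge> 0" and b: "b \<ge> 0"
    and C: "\<And>b. b \<ge> 0 \<Longrightarrow> norm (integral {0..b} f) \<le> C"
  shows "norm (integral {0..b} (\<lambda>y. f y * complex_of_real (gauss s y))) \<le> C"
proof -
  let ?e = "\<lambda>y. gauss s y"
  define F where "F u = integral {0..u} f" for u
  have fc: "continuous_on {0..b} f" using f continuous_on_subset by blast
  have F: "(F has_vector_derivative f u) (at u within {0..b})" if "u \<in> {0..b}" for u
    unfolding F_def using fc that by (rule integral_has_vector_derivative)
  have Fc: "continuous_on {0..b} F"
    using F by (meson continuous_on_eq_continuous_within has_vector_derivative_continuous)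
  have e: "(?e has_real_derivative (- u * s * ?e u)) (at u within {0..b})" for u
    by (auto intro!: derivative_eq_intros)
  then have e': "((\<lambda>y. complex_of_real (?e y)) has_vector_derivative complex_of_real (- u * s * ?e u)) (at u within {0..b})" for u
    by (rule has_vector_derivative_of_real)
  have "((\<lambda>u. F u * complex_of_real (- u * s * ?e u) + f u * complex_of_real (?e u)) has_integral
    (F b * complex_of_real (?e b) - F 0 * complex_of_real (?e 0))) {0..b}"
    using b by (intro fundamental_theorem_of_calculus has_vector_derivative_mult F e') auto
  moreover have g: "(\<lambda>u. F u * complex_of_real (u * s * ?e u)) integrable_on {0..b}"
    by (intro integrable_continuous_interval continuous_intros Fc) simp
  ultimately have "((\<lambda>u. F u * complex_of_real (- u * s * ?e u) + f u * complex_of_real (?e u) + F u * complex_of_real (u * s * ?e u)) has_integral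
    (F b * complex_of_real (?e b) - F 0 * complex_of_real (?e 0) + integral {0..b} (\<lambda>u. F u * complex_of_real (u * s * ?e u)))) {0..b}"
    by (intro has_integral_add integrable_integral)
  then have eq: "integral {0..b} (\<lambda>y. f y * complex_of_real (?e y)) =
    F b * complex_of_real (?e b) + integral {0..b} (\<lambda>u. F u * complex_of_real (u * s * ?e u))"
    by (intro integral_unique) (simp add: F_def)
  have "((\<lambda>u. C * (u * s * ?e u)) has_integral ((- C * ?e b) - (- C * ?e 0))) {0..b}"
    using b by (intro fundamental_theorem_of_calculus)
      (auto intro!: derivative_eq_intros simp flip: has_real_derivative_iff_has_vector_derivative)
  then have i: "((\<lambda>u. C * (u * s * ?e u)) has_integral (C - C * ?e b)) {0..b}" by simp
  have "norm (integral {0..b} (\<lambda>u. F u * complex_of_real (u * s * ?e u))) \<le> integral {0..b} (\<lambda>u. C * (u * s * ?e u))"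
  proof (rule integral_norm_bound_integral[OF g has_integral_integrable[OF i]])
    fix u assume "u \<in> {0..b}"
    then show "norm (F u * complex_of_real (u * s * ?e u)) \<le> C * (u * s * ?e u)"
      unfolding norm_mult norm_of_real using C[of u] C[of 0] s by (intro mult_mono) (auto simp: F_def)
  qed
  also have "\<dots> = C - C * ?e b" using i by (rule integral_unique)
  finally have 1: "norm (integral {0..b} (\<lambda>u. F u * complex_of_real (u * s * ?e u))) \<le> C - C * ?e b" .
  have 2: "norm (F b * complex_of_real (?e b)) \<le> C * ?e b"
    unfolding norm_mult norm_of_real using C[OF b] C[of 0] by (intro mult_mono) (auto simp: F_def)
  show ?thesis unfolding eq
    by (rule order.trans[OF norm_triangle_ineq]) (use 1 2 in linarith)
qed

text \<open>The weight is monotone only on each half-line. A segment is therefore a sum or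
  difference of two segments with an endpoint at 0, which costs the factor 2.\<close>

lemma norm_integral_gauss_weight:
  fixes f :: "real \<Rightarrow> complex"
  assumes f: "continuous_on UNIV f" and s: "s \<ge> 0" and ab: "a \<le> b"
    and C: "\<And>a b. a \<le> b \<Longrightarrow> norm (integral {a..b} f) \<le> C"
  shows "norm (integral {a..b} (\<lambda>y. f y * complex_of_real (gauss s y))) \<le> 2 * C"
proof -
  define g where "g y = f y * complex_of_real (gauss s y)" for y
  have gc: "continuous_on S g" for S
    unfolding g_def by (intro continuous_intros continuous_on_subset[OF f]) auto
  have gi: "g integrable_on {u..v}" for u v
    by (intro integrable_continuous_interval gc)
  have pos: "norm (integral {0..b} g) \<le> C" if "b \<ge> 0" for b
    unfolding g_def using f s that C by (intro norm_integral_gauss_weight_half) auto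
  have neg: "norm (integral {a..0} g) \<le> C" if "a \<le> 0" for a
  proof -
    have "integral {a..0} g = integral {0..-a} (\<lambda>y. g (- y))"
      using Henstock_Kurzweil_Integration.integral_reflect_real[of 0 a g] by simp
    also have "\<dots> = integral {0..-a} (\<lambda>y. f (- y) * complex_of_real (gauss s y))"
      by (simp add: g_def)
    also have "norm \<dots> \<le> C"
    proof (rule norm_integral_gauss_weight_half)
      show "continuous_on UNIV (\<lambda>y. f (- y))"
        by (intro continuous_on_compose2[OF f] continuous_intros) auto
      show "norm (integral {0..b} (\<lambda>y. f (- y))) \<le> C" if "b \<ge> 0" for b
        using C[of "-b" 0] Henstock_Kurzweil_Integration.integral_reflect_real[of 0 "-b" f] that by simp
    qed (use s that in auto)
    finally show ?thesis .
  qed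
  have C0: "C \<ge> 0" using C[of 0 0] by simp
  consider "a \<le> 0" "0 \<le> b" | "0 < a" | "b < 0" by linarith
  then have "norm (integral {a..b} g) \<le> 2 * C"
  proof cases
    case 1
    then have "integral {a..b} g = integral {a..0} g + integral {0..b} g"
      using gi by (simp add: Henstock_Kurzweil_Integration.integral_combine)
    then show ?thesis using norm_triangle_ineq[of "integral {a..0} g" "integral {0..b} g"] pos[of b] neg[of a] 1
      by simp
  next
    case 2
    then have "integral {a..b} g = integral {0..b} g - integral {0..a} g"
      using Henstock_Kurzweil_Integration.integral_combine[of 0 a b g] gi ab by (simp add: algebra_simps)
    then show ?thesis using norm_triangle_ineq4[of "integral {0..b} g" "integral {0..a} g"] pos[of b] pos[of a] 2 ab
      by simp
  next
    case 3
    then have "integral {a..b} g = integral {a..0} g - integral {b..0} g"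
      using Henstock_Kurzweil_Integration.integral_combine[of a b 0 g] gi ab by (simp add: algebra_simps)
    then show ?thesis using norm_triangle_ineq4[of "integral {a..0} g" "integral {b..0} g"] neg[of b] neg[of a] 3 ab
      by simp
  qed
  then show ?thesis unfolding g_def .
qed

text \<open>Rescaling \<open>y\<close> by \<open>1 / sqrt s\<close> turns this into the
  characteristic function of the standard normal law.\<close>

lemma fourier_gauss:
  assumes "s > 0"
  shows "(LBINT y. iexp (y * c) * complex_of_real (gauss s y))
    = complex_of_real (2 * pi * heat s c)"
proof -
  let ?t = "c / sqrt s"
  have "char std_normal_distribution ?t = (LBINT y. std_normal_density y *\<^sub>R iexp (?t * y))"
    unfolding char_def by (subst integral_density) auto
  then have 1: "(LBINT y. std_normal_density y *\<^sub>R iexp (?t * y)) = complex_of_real (exp (- ?t\<^sup>2 / 2))"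
    by (simp add: char_std_normal_distribution)
  have "(LBINT y. iexp (y * c) * complex_of_real (gauss s y))
    = \<bar>1 / sqrt s\<bar> *\<^sub>R (LBINT y. iexp ((0 + 1 / sqrt s * y) * c) * complex_of_real (exp (- (0 + 1 / sqrt s * y)\<^sup>2 * s / 2)))"
    using assms by (intro lborel_integral_real_affine) simp
  also have "(\<lambda>y. iexp ((0 + 1 / sqrt s * y) * c) * complex_of_real (exp (- (0 + 1 / sqrt s * y)\<^sup>2 * s / 2)))
    = (\<lambda>y. complex_of_real (sqrt (2 * pi)) * (std_normal_density y *\<^sub>R iexp (?t * y)))"
    using assms by (simp add: fun_eq_iff std_normal_density_def power_mult_distrib power_divide
        scaleR_conv_of_real mult_ac)
  also have "(LBINT y. complex_of_real (sqrt (2 * pi)) * (std_normal_density y *\<^sub>R iexp (?t * y)))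
    = complex_of_real (sqrt (2 * pi)) * complex_of_real (exp (- ?t\<^sup>2 / 2))"
    by (subst integral_mult_right_zero) (simp only: 1)
  also have "\<bar>1 / sqrt s\<bar> *\<^sub>R \<dots> = complex_of_real (1 / sqrt s * sqrt (2 * pi) * exp (- ?t\<^sup>2 / 2))"
    using assms by (simp add: scaleR_conv_of_real)
  also have "1 / sqrt s * sqrt (2 * pi) * exp (- ?t\<^sup>2 / 2) = 2 * pi * heat s c"
  proof -
    have "sqrt (2 * pi) = 2 * pi / sqrt (2 * pi)" by (simp add: real_div_sqrt)
    then show ?thesis
      using assms by (simp add: normal_density_def power_divide real_sqrt_mult field_simps)
  qed
  finally show ?thesis .
qed

section \<open>Plane waves on a horizontal line and their truncated integrals\<close>

definition wave :: "real \<Rightarrow> real \<Rightarrow> real \<Rightarrow> complex" where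
  "wave \<epsilon> c y = exp (\<i> * Complex y \<epsilon> * complex_of_real c)"

lemma wave_measurable [measurable]: "wave \<epsilon> c \<in> borel_measurable borel"
  unfolding wave_def Complex_eq by measurable

lemma norm_wave: "norm (wave \<epsilon> c y) = exp (- \<epsilon> * c)"
  by (simp add: wave_def norm_exp_eq_Re)

lemma wave_kernel:
  "wave \<epsilon> c y * gauss_kernel \<beta> \<epsilon> y s = complex_of_real (exp ((\<epsilon>\<^sup>2 - \<beta>\<^sup>2) * s / 2 - \<epsilon> * c)) *
    (iexp (y * (c - \<epsilon> * s)) * complex_of_real (gauss s y))"
  unfolding wave_def gauss_kernel_def Complex_eq exp_of_real exp_add[symmetric]
  by (simp add: power2_eq_square algebra_simps diff_divide_distrib add_divide_distrib
      flip: exp_add exp_of_real)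

text \<open>The height \<epsilon> disappears: the factors created by moving the frequency to
  \<open>c - \<epsilon> * s\<close> are those relating \<open>heat s (c - \<epsilon> * s)\<close> to
  \<open>heat s c\<close>. For fixed \<open>s\<close> this is the shift of the contour.\<close>

lemma integral_wave_kernel:
  assumes "s > 0"
  shows "(LBINT y. wave \<epsilon> c y * gauss_kernel \<beta> \<epsilon> y s)
    = complex_of_real (2 * pi * gauss s \<beta> * heat s c)"
proof -
  have "(LBINT y. wave \<epsilon> c y * gauss_kernel \<beta> \<epsilon> y s) =
    complex_of_real (exp ((\<epsilon>\<^sup>2 - \<beta>\<^sup>2) * s / 2 - \<epsilon> * c) * (2 * pi * heat s (c - \<epsilon> * s)))"
    unfolding wave_kernel integral_mult_right_zero fourier_gauss[OF assms] by simp
  also have "exp ((\<epsilon>\<^sup>2 - \<beta>\<^sup>2) * s / 2 - \<epsilon> * c) * (2 * pi * heat s (c - \<epsilon> * s)) =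
    2 * pi * gauss s \<beta> * heat s c"
  proof -
    have "exp ((\<epsilon>\<^sup>2 - \<beta>\<^sup>2) * s / 2 - \<epsilon> * c) * exp (- (c - \<epsilon> * s)\<^sup>2 / (2 * s)) = gauss s \<beta> * exp (- c\<^sup>2 / (2 * s))"
      using assms by (simp add: power2_eq_square field_simps flip: exp_add)
    then show ?thesis using assms by (simp add: normal_density_def field_simps)
  qed
  finally show ?thesis .
qed

text \<open>Pure oscillation: the primitive of the wave has modulus
  \<open>1 / \<bar>c\<bar>\<close>, so every segment contributes at most
  \<open>2 / \<bar>c\<bar>\<close>, and the Gaussian weight doubles this.\<close>

lemma norm_integral_iexp_gauss:
  assumes "c \<noteq> 0" "s \<ge> 0" "a \<le> b"
  shows "norm (integral {a..b} (\<lambda>y. iexp (y * c) * complex_of_real (gauss s y))) \<le> 4 / \<bar>c\<bar>"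
proof -
  have bound: "norm (integral {a..b} (\<lambda>y. iexp (y * c))) \<le> 2 / \<bar>c\<bar>" if "a \<le> b" for a b
  proof -
    let ?F = "\<lambda>y. iexp (y * c) / (\<i> * complex_of_real c)"
    have "((\<lambda>y. iexp (y * c)) has_integral (?F b - ?F a)) {a..b}"
      using assms(1) that
      by (intro fundamental_theorem_of_calculus)
        (auto intro!: derivative_eq_intros has_vector_derivative_real_field simp: mult_ac)
    then have "integral {a..b} (\<lambda>y. iexp (y * c)) = ?F b - ?F a"
      by (rule integral_unique)
    also have "norm \<dots> \<le> norm (?F b) + norm (?F a)" by (rule norm_triangle_ineq4)
    also have "\<dots> = 2 / \<bar>c\<bar>" by (simp add: norm_divide norm_mult norm_exp_eq_Re)
    finally show ?thesis .
  qed
  have "norm (integral {a..b} (\<lambda>y. iexp (y * c) * complex_of_real (gauss s y))) \<le> 2 * (2 / \<bar>c\<bar>)"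
    using assms(2,3) by (intro norm_integral_gauss_weight bound continuous_intros)
  then show ?thesis by simp
qed

lemma norm_integral_iexp_gauss_mass:
  assumes "s > 0"
  shows "norm (integral {a..b} (\<lambda>y. iexp (y * c) * complex_of_real (gauss s y))) \<le> sqrt (2 * pi / s)"
proof -
  have 1: "(\<lambda>y. gauss s y) integrable_on UNIV" "integral UNIV (\<lambda>y. gauss s y) = (LBINT y. gauss s y)"
    using integrable_exp_square[OF assms] has_integral_integral_lborel by (blast, blast intro: integral_unique)
  have "norm (integral {a..b} (\<lambda>y. iexp (y * c) * complex_of_real (gauss s y)))
    \<le> integral {a..b} (\<lambda>y. gauss s y)"
    by (intro integral_norm_bound_integral integrable_continuous_interval continuous_intros)
      (auto simp: norm_mult norm_exp_eq_Re)
  also have "\<dots> \<le> integral UNIV (\<lambda>y. gauss s y)"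
    using 1 by (intro integral_subset_le integrable_continuous_interval continuous_intros) auto
  also have "\<dots> = (LBINT y. gauss s y)" by (rule 1)
  \<comment> \<open>The total mass is the Fourier integral at frequency 0.\<close>
  also have "\<dots> = Re (LBINT y. complex_of_real (gauss s y))" by (simp del: of_real_exp)
  also have "\<dots> = 2 * pi * heat s 0"
    using fourier_gauss[OF assms, of 0] by simp
  also have "\<dots> = sqrt (2 * pi / s)"
  proof -
    have "sqrt (2 * pi) = 2 * pi / sqrt (2 * pi)" by (simp add: real_div_sqrt)
    then show ?thesis using assms by (simp add: normal_density_def real_sqrt_mult real_sqrt_divide field_simps)
  qed
  finally show ?thesis .
qed

text \<open>
  Completing the square shifts the frequency from \<open>c\<close> to \<open>c - \<epsilon> * s\<close>. When the shifted frequency is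
  small, \<open>s\<close> is bounded away from \<open>0\<close> and the Gaussian weight alone gives the bound.
\<close>

lemma norm_integral_wave_kernel:
  assumes c: "c \<noteq> 0" and s: "s > 0" and ab: "a \<le> b"
  shows "norm (integral {a..b} (\<lambda>y. wave \<epsilon> c y * gauss_kernel \<beta> \<epsilon> y s))
    \<le> exp (- \<epsilon> * c) * (8 / \<bar>c\<bar> + sqrt (4 * pi * \<bar>\<epsilon>\<bar> / \<bar>c\<bar>)) * exp ((\<epsilon>\<^sup>2 - \<beta>\<^sup>2) * s / 2)"
proof -
  let ?I = "integral {a..b} (\<lambda>y. iexp (y * (c - \<epsilon> * s)) * complex_of_real (gauss s y))"
  have "norm ?I \<le> 8 / \<bar>c\<bar> + sqrt (4 * pi * \<bar>\<epsilon>\<bar> / \<bar>c\<bar>)"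
  proof (cases "\<bar>c - \<epsilon> * s\<bar> \<ge> \<bar>c\<bar> / 2")
    case True
    then have "c - \<epsilon> * s \<noteq> 0" using c by auto
    then have "norm ?I \<le> 4 / \<bar>c - \<epsilon> * s\<bar>" using s ab by (intro norm_integral_iexp_gauss) auto
    also have "\<dots> \<le> 4 / (\<bar>c\<bar> / 2)" using True c by (intro divide_left_mono mult_pos_pos) auto
    finally show ?thesis by (simp add: add_increasing2)
  next
    case False
    then have "\<bar>c\<bar> / 2 \<le> \<bar>\<epsilon> * s\<bar>" by linarith
    then have *: "\<bar>c\<bar> \<le> 2 * \<bar>\<epsilon>\<bar> * s" using s by (simp add: abs_mult)
    have "norm ?I \<le> sqrt (2 * pi / s)" using s by (rule norm_integral_iexp_gauss_mass)
    also have "2 * pi / s \<le> 4 * pi * \<bar>\<epsilon>\<bar> / \<bar>c\<bar>"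
      using * s c by (simp add: field_simps)
    finally show ?thesis by (simp add: add_increasing)
  qed
  then have "exp ((\<epsilon>\<^sup>2 - \<beta>\<^sup>2) * s / 2 - \<epsilon> * c) * norm ?I \<le> exp ((\<epsilon>\<^sup>2 - \<beta>\<^sup>2) * s / 2 - \<epsilon> * c) * (8 / \<bar>c\<bar> + sqrt (4 * pi * \<bar>\<epsilon>\<bar> / \<bar>c\<bar>))"
    by (intro mult_left_mono) auto
  also have "\<dots> = exp (- \<epsilon> * c) * (8 / \<bar>c\<bar> + sqrt (4 * pi * \<bar>\<epsilon>\<bar> / \<bar>c\<bar>)) * exp ((\<epsilon>\<^sup>2 - \<beta>\<^sup>2) * s / 2)"
  proof -
    have "exp ((\<epsilon>\<^sup>2 - \<beta>\<^sup>2) * s / 2 - \<epsilon> * c) = exp (- \<epsilon> * c) * exp ((\<epsilon>\<^sup>2 - \<beta>\<^sup>2) * s / 2)"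
      by (simp flip: exp_add)
    then show ?thesis by (simp only: mult_ac)
  qed
  finally show ?thesis
    unfolding wave_kernel Henstock_Kurzweil_Integration.integral_mult_right norm_mult norm_of_real abs_exp_cancel .
qed

section \<open>The resolvent kernel of the half-line transform\<close>

text \<open>For \<open>Im k > 0\<close> each term is a half-line integral:
  \<open>\<i> / (k - y)\<close> is that of exp (i (k - y) l) over l > 0. The difference belongs to
  the incoming wave and its mirror image.\<close>

definition resolvent :: "complex \<Rightarrow> real \<Rightarrow> complex" where
  "resolvent k y = \<i> / (k - complex_of_real y) - \<i> / (k + complex_of_real y)"

lemma resolvent_measurable [measurable]: "resolvent k \<in> borel_measurable borel"
  unfolding resolvent_def by measurable

lemma norm_resolvent_le:
  assumes "Im k > 0"
  shows "norm (resolvent k y) \<le> 2 / Im k"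
proof -
  have "norm (\<i> / (k - complex_of_real y)) \<le> 1 / Im k" "norm (\<i> / (k + complex_of_real y)) \<le> 1 / Im k"
    using abs_Im_le_cmod[of "k - complex_of_real y"] abs_Im_le_cmod[of "k + complex_of_real y"] assms
    by (auto simp: norm_divide intro!: divide_left_mono mult_pos_pos)
  then show ?thesis
    unfolding resolvent_def
    by (intro order.trans[OF norm_triangle_ineq4]) (simp add: field_simps)
qed

text \<open>The kernel decays only like 1 / y, so the oscillation of the wave is needed. After
  integration by parts each of the two boundary terms is at most \<open>2 / (Im k * x)\<close>; the
  derivative of the kernel has integrable modulus and contributes at most
  \<open>2 * pi / (Im k * x)\<close>.\<close>

lemma norm_integral_resolvent:
  assumes k: "Im k > 0" and x: "x > 0" and ab: "a \<le> b"
  shows "norm (integral {a..b} (\<lambda>y. resolvent k y * wave 0 x y)) \<le> (4 + 2 * pi) / (Im k * x)"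
proof -
  have nz: "k - complex_of_real y \<noteq> 0" "k + complex_of_real y \<noteq> 0" for y
    using k by (auto simp: complex_eq_iff)
  let ?E = "\<lambda>y. wave 0 x y / (\<i> * complex_of_real x)"
  let ?h' = "\<lambda>y. \<i> / (k - complex_of_real y)\<^sup>2 + \<i> / (k + complex_of_real y)\<^sup>2"
  \<comment> \<open>Primitive of the modulus bound for the derivative term, one arctangent for each
    pole.\<close>
  define D where "D y = (arctan ((y - Re k) / Im k) + arctan ((y + Re k) / Im k)) / (Im k * x)" for y
  let ?D' = "\<lambda>y. (1 / ((y - Re k)\<^sup>2 + (Im k)\<^sup>2) + 1 / ((y + Re k)\<^sup>2 + (Im k)\<^sup>2)) / x"
  have wave0: "wave 0 x = (\<lambda>y. exp (\<i> * complex_of_real y * complex_of_real x))"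
    by (simp add: wave_def Complex_eq fun_eq_iff)
  have nE: "norm (?E y) = 1 / x" for y using x by (simp add: norm_divide norm_mult norm_wave)
  have E: "(?E has_vector_derivative (wave 0 x y)) (at y within S)" for y S
    unfolding wave0 using x by (auto intro!: derivative_eq_intros has_vector_derivative_real_field simp: mult_ac)
  have h: "(resolvent k has_vector_derivative ?h' y) (at y within S)" for y S
    unfolding resolvent_def[abs_def] using nz[of y]
    by (auto intro!: derivative_eq_intros has_vector_derivative_real_field simp: power2_eq_square field_simps)
  have hc: "continuous_on S ?h'" for S
    using nz by (intro continuous_intros) auto
  have Ec: "continuous_on S (wave 0 x)" for S unfolding wave0 by (intro continuous_intros)
  have "((\<lambda>y. ?E y * ?h' y + wave 0 x y * resolvent k y) has_integral (?E b * resolvent k b - ?E a * resolvent k a)) {a..b}"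
    using ab by (intro fundamental_theorem_of_calculus has_vector_derivative_mult E h)
  moreover have i: "(\<lambda>y. ?E y * ?h' y) integrable_on {a..b}"
    using x by (intro integrable_continuous_interval continuous_intros hc Ec) auto
  ultimately have "((\<lambda>y. (?E y * ?h' y + wave 0 x y * resolvent k y) - ?E y * ?h' y) has_integral
    (?E b * resolvent k b - ?E a * resolvent k a - integral {a..b} (\<lambda>y. ?E y * ?h' y))) {a..b}"
    by (intro has_integral_diff integrable_integral)
  then have eq: "integral {a..b} (\<lambda>y. resolvent k y * wave 0 x y) =
    ?E b * resolvent k b - ?E a * resolvent k a - integral {a..b} (\<lambda>y. ?E y * ?h' y)"
    by (intro integral_unique) (simp add: mult.commute)
  have bd: "norm (?E y * resolvent k y) \<le> 2 / (Im k * x)" for y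
  proof -
    have "norm (?E y) * norm (resolvent k y) \<le> 1 / x * (2 / Im k)"
      unfolding nE using x by (intro mult_left_mono norm_resolvent_le k) auto
    then show ?thesis by (simp only: norm_mult) (simp add: mult.commute)
  qed
  have nsq: "norm (\<i> / (k - complex_of_real y)\<^sup>2) = 1 / ((y - Re k)\<^sup>2 + (Im k)\<^sup>2)"
    "norm (\<i> / (k + complex_of_real y)\<^sup>2) = 1 / ((y + Re k)\<^sup>2 + (Im k)\<^sup>2)" for y
    by (simp_all add: norm_divide norm_power cmod_power2 power2_commute add.commute)
  have "(D has_real_derivative ?D' y) (at y within S)" for y S
    unfolding D_def using k x
    by (auto intro!: derivative_eq_intros simp: power_divide field_simps power2_eq_square add_nonneg_eq_0_iff)
  then have D: "(?D' has_integral (D b - D a)) {a..b}"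
    using ab unfolding has_real_derivative_iff_has_vector_derivative
    by (intro fundamental_theorem_of_calculus)
  have "norm (integral {a..b} (\<lambda>y. ?E y * ?h' y)) \<le> integral {a..b} ?D'"
  proof (rule integral_norm_bound_integral[OF i has_integral_integrable[OF D]])
    fix y
    have "norm (?h' y) \<le> 1 / ((y - Re k)\<^sup>2 + (Im k)\<^sup>2) + 1 / ((y + Re k)\<^sup>2 + (Im k)\<^sup>2)"
      by (rule order.trans[OF norm_triangle_ineq]) (simp only: nsq order_refl)
    then have "1 / x * norm (?h' y) \<le> 1 / x * (1 / ((y - Re k)\<^sup>2 + (Im k)\<^sup>2) + 1 / ((y + Re k)\<^sup>2 + (Im k)\<^sup>2))"
      using x by (intro mult_left_mono) auto
    then show "norm (?E y * ?h' y) \<le> ?D' y"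
      unfolding norm_mult[of "?E y"] nE by (simp add: field_simps)
  qed
  also have "\<dots> = D b - D a" using D by (rule integral_unique)
  also have "\<dots> \<le> 2 * pi / (Im k * x)"
  proof -
    have "\<bar>D y\<bar> \<le> pi / (Im k * x)" for y
    proof -
      have "\<bar>arctan ((y - Re k) / Im k) + arctan ((y + Re k) / Im k)\<bar> \<le> pi"
        using arctan_bounded[of "(y - Re k) / Im k"] arctan_bounded[of "(y + Re k) / Im k"] by linarith
      then show ?thesis using k x by (simp add: D_def abs_divide abs_mult divide_right_mono)
    qed
    from this[of a] this[of b] show ?thesis by linarith
  qed
  finally have 3: "norm (integral {a..b} (\<lambda>y. ?E y * ?h' y)) \<le> 2 * pi / (Im k * x)" .
  have "norm (integral {a..b} (\<lambda>y. resolvent k y * wave 0 x y)) \<le> 2 / (Im k * x) + 2 / (Im k * x) + 2 * pi / (Im k * x)"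
    unfolding eq by (intro order.trans[OF norm_triangle_ineq4] add_mono bd 3)
  also have "\<dots> = (4 + 2 * pi) / (Im k * x)" by (simp add: add_divide_distrib)
  finally show ?thesis .
qed

lemma gauss_kernel_real:
  "gauss_kernel \<beta> 0 y s = complex_of_real (gauss s \<beta>) * complex_of_real (gauss s y)"
  by (simp add: gauss_kernel_def Complex_eq field_simps flip: exp_of_real exp_add)

text \<open>The unevaluated \<open>0\<^sup>2\<close> keeps the bound in the shape of the mixture
  lemma at \<open>\<epsilon> = 0\<close>.\<close>

lemma norm_integral_gauss_kernel_real:
  assumes "norm (integral {a..b} (\<lambda>y. f y * complex_of_real (gauss s y))) \<le> C"
  shows "norm (integral {a..b} (\<lambda>y. f y * gauss_kernel \<beta> 0 y s)) \<le> C * exp ((0\<^sup>2 - \<beta>\<^sup>2) * s / 2)"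
proof -
  have "(\<lambda>y. f y * gauss_kernel \<beta> 0 y s) =
    (\<lambda>y. complex_of_real (gauss s \<beta>) * (f y * complex_of_real (gauss s y)))"
    by (simp only: gauss_kernel_real mult_ac)
  then have "norm (integral {a..b} (\<lambda>y. f y * gauss_kernel \<beta> 0 y s)) =
    gauss s \<beta> * norm (integral {a..b} (\<lambda>y. f y * complex_of_real (gauss s y)))"
    by (simp only: Henstock_Kurzweil_Integration.integral_mult_right norm_mult norm_of_real abs_exp_cancel)
  also have "\<dots> \<le> gauss s \<beta> * C" using assms by (intro mult_left_mono) auto
  finally show ?thesis by (simp add: mult.commute)
qed

lemma norm_integral_resolvent_kernel:
  assumes "Im k > 0" "x > 0" "a \<le> b" "s > 0"
  shows "norm (integral {a..b} (\<lambda>y. resolvent k y * wave 0 x y * gauss_kernel \<beta> 0 y s))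
    \<le> 2 * ((4 + 2 * pi) / (Im k * x)) * exp ((0\<^sup>2 - \<beta>\<^sup>2) * s / 2)"
proof (rule norm_integral_gauss_kernel_real, rule norm_integral_gauss_weight)
  have "k - complex_of_real y \<noteq> 0" "k + complex_of_real y \<noteq> 0" for y
    using assms(1) by (auto simp: complex_eq_iff)
  then show "continuous_on UNIV (\<lambda>y. resolvent k y * wave 0 x y)"
    unfolding resolvent_def wave_def Complex_eq by (intro continuous_intros) auto
qed (use assms norm_integral_resolvent in auto)

section \<open>The sine integrand of the hitting probability\<close>

text \<open>For \<open>\<beta> = 0\<close> division by zero gives the value 0 at
  \<open>y = 0\<close> instead of the limit \<open>x\<close>; one point does not affect the
  integrals.\<close>

definition sine_ratio :: "real \<Rightarrow> real \<Rightarrow> real \<Rightarrow> real" where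
  "sine_ratio x \<beta> y = y * sin (y * x) / (y\<^sup>2 + \<beta>\<^sup>2)"

lemma sine_ratio_measurable [measurable]: "sine_ratio x \<beta> \<in> borel_measurable borel"
  unfolding sine_ratio_def by measurable

text \<open>The bound is uniform in \<beta>, which later lets this parameter tend to 0 under the
  integral.\<close>

lemma abs_sine_ratio_le:
  assumes "x > 0"
  shows "\<bar>sine_ratio x \<beta> y\<bar> \<le> x"
proof (cases "y = 0")
  case False
  have "\<bar>y\<bar> * \<bar>sin (y * x)\<bar> \<le> \<bar>y\<bar> * \<bar>y * x\<bar>" by (intro mult_left_mono abs_sin_x_le_abs_x) auto
  also have "\<dots> = x * y\<^sup>2" using assms by (simp add: abs_mult power2_eq_square)
  also have "\<dots> \<le> x * (y\<^sup>2 + \<beta>\<^sup>2)" using assms by (intro mult_left_mono) auto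
  finally show ?thesis using False assms
    by (simp add: sine_ratio_def abs_mult divide_le_eq add_pos_nonneg)
qed (use assms in \<open>simp add: sine_ratio_def\<close>)

text \<open>At \<open>k = \<i> * \<bar>\<beta>\<bar>\<close> the resolvent equals -2 i y / (y^2 +
  \<beta>^2), so the sine integrand inherits the resolvent bounds.\<close>

lemma sine_ratio_resolvent:
  assumes "\<beta> \<noteq> 0"
  shows "Re (resolvent (\<i> * complex_of_real \<bar>\<beta>\<bar>) y * wave 0 x y) = 2 * sine_ratio x \<beta> y"
proof -
  have "resolvent (\<i> * complex_of_real \<bar>\<beta>\<bar>) y = - 2 * \<i> * complex_of_real (y / (y\<^sup>2 + \<beta>\<^sup>2))"
  proof -
    have "\<i> * complex_of_real \<bar>\<beta>\<bar> - complex_of_real y \<noteq> 0" "\<i> * complex_of_real \<bar>\<beta>\<bar> + complex_of_real y \<noteq> 0"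
      "y\<^sup>2 + \<beta>\<^sup>2 \<noteq> 0"
      using assms by (auto simp: complex_eq_iff add_nonneg_eq_0_iff)
    then show ?thesis unfolding resolvent_def
      by (simp add: divide_simps) (simp add: complex_eq_iff power2_eq_square algebra_simps)
  qed
  then show ?thesis
    by (simp add: wave_def Complex_eq Re_exp Im_exp sine_ratio_def)
qed

lemma norm_integral_sine_ratio_kernel:
  assumes x: "x > 0"
  shows "\<exists>C. \<forall>s a b. s > 0 \<longrightarrow> a \<le> b \<longrightarrow>
    norm (integral {a..b} (\<lambda>y. complex_of_real (sine_ratio x \<beta> y) * gauss_kernel \<beta> 0 y s)) \<le> C * exp ((0\<^sup>2 - \<beta>\<^sup>2) * s / 2)"
proof (cases "\<beta> = 0")
  case False
  let ?k = "\<i> * complex_of_real \<bar>\<beta>\<bar>"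
  have nz: "?k - complex_of_real y \<noteq> 0" "?k + complex_of_real y \<noteq> 0" "y\<^sup>2 + \<beta>\<^sup>2 \<noteq> 0" for y
    using False by (auto simp: complex_eq_iff add_nonneg_eq_0_iff)
  have rc: "continuous_on S (\<lambda>y. resolvent ?k y * wave 0 x y)" for S
    using nz unfolding resolvent_def wave_def Complex_eq by (intro continuous_intros) auto
  have bound: "norm (integral {a..b} (\<lambda>y. complex_of_real (sine_ratio x \<beta> y))) \<le> (4 + 2 * pi) / (\<bar>\<beta>\<bar> * x)"
    if "a \<le> b" for a b
  proof -
    have i: "(\<lambda>y. resolvent ?k y * wave 0 x y) integrable_on {a..b}"
      by (intro integrable_continuous_interval rc)
    have i2: "sine_ratio x \<beta> integrable_on {a..b}"
      unfolding sine_ratio_def using nz(3) by (intro integrable_continuous_interval continuous_intros) auto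
    have "\<bar>2 * integral {a..b} (sine_ratio x \<beta>)\<bar> = \<bar>Re (integral {a..b} (\<lambda>y. resolvent ?k y * wave 0 x y))\<bar>"
      using integral_linear[OF i bounded_linear_Re]
      unfolding o_def sine_ratio_resolvent[OF False] by simp
    also have "\<dots> \<le> norm (integral {a..b} (\<lambda>y. resolvent ?k y * wave 0 x y))" by (rule abs_Re_le_cmod)
    also have "\<dots> \<le> (4 + 2 * pi) / (\<bar>\<beta>\<bar> * x)"
      using norm_integral_resolvent[of ?k x a b] False x that by simp
    finally have "\<bar>integral {a..b} (sine_ratio x \<beta>)\<bar> \<le> (4 + 2 * pi) / (\<bar>\<beta>\<bar> * x)" by linarith
    moreover have "integral {a..b} (\<lambda>y. complex_of_real (sine_ratio x \<beta> y)) = complex_of_real (integral {a..b} (sine_ratio x \<beta>))"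
      using integral_linear[OF i2 bounded_linear_of_real[where ?'a=complex]] by (simp add: o_def)
    ultimately show ?thesis by simp
  qed
  have "continuous_on UNIV (\<lambda>y. complex_of_real (sine_ratio x \<beta> y))"
    unfolding sine_ratio_def using nz(3) by (intro continuous_intros) auto
  then show ?thesis
    by (intro exI[of _ "2 * ((4 + 2 * pi) / (\<bar>\<beta>\<bar> * x))"] allI impI norm_integral_gauss_kernel_real
        norm_integral_gauss_weight bound) auto
next
  \<comment> \<open>The resolvent bound blows up as \<beta> tends to 0. Here the integrand is
    \<open>x * sinc (x * y)\<close> off 0, whose primitive is the bounded sine integral.\<close>
  case True
  obtain B where B: "\<And>T. \<bar>Si T\<bar> \<le> B" using bounded_Si by blast
  let ?g = "\<lambda>y. x * sinc (x * y)"
  have g: "integral {a..b} (\<lambda>y. complex_of_real (?g y)) = complex_of_real (Si (x * b) - Si (x * a))"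
    if "a \<le> b" for a b
  proof -
    have "((\<lambda>y. Si (x * y)) has_real_derivative ?g y) (at y within S)" for y S
    proof (rule DERIV_subset[of _ _ _ UNIV])
      show "((\<lambda>y. Si (x * y)) has_real_derivative ?g y) (at y)"
        using DERIV_chain2[OF DERIV_Si DERIV_cmult_Id[of x y UNIV]] by (simp only: mult.commute)
    qed simp
    then have "(?g has_integral (Si (x * b) - Si (x * a))) {a..b}"
      using that by (intro fundamental_theorem_of_calculus) (auto simp flip: has_real_derivative_iff_has_vector_derivative)
    then have "((\<lambda>y. complex_of_real (?g y)) has_integral complex_of_real (Si (x * b) - Si (x * a))) {a..b}"
      using has_integral_linear[OF _ bounded_linear_of_real[where ?'a=complex]] by (force simp: o_def)
    then show ?thesis by (rule integral_unique)
  qed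
  have bound: "norm (integral {a..b} (\<lambda>y. complex_of_real (?g y))) \<le> 2 * B" if "a \<le> b" for a b
    unfolding g[OF that] norm_of_real using B[of "x * b"] B[of "x * a"] by linarith
  have gc: "continuous_on UNIV (\<lambda>y. complex_of_real (?g y))"
  proof -
    have "isCont (\<lambda>y. sinc (x * y)) y" for y
      by (rule isCont_o2[OF _ isCont_sinc]) (intro continuous_intros)
    then have "continuous_on UNIV (\<lambda>y. sinc (x * y))"
      by (intro continuous_at_imp_continuous_on) blast
    then show ?thesis by (intro continuous_on_of_real continuous_on_mult continuous_on_const)
  qed
  have eq: "complex_of_real (sine_ratio x \<beta> y) = complex_of_real (?g y)" if "y \<noteq> 0" for y
    using that x True by (simp add: sine_ratio_def power2_eq_square mult.commute)
  have "norm (integral {a..b} (\<lambda>y. complex_of_real (sine_ratio x \<beta> y) * gauss_kernel \<beta> 0 y s)) \<le> 2 * (2 * B) * exp ((0\<^sup>2 - \<beta>\<^sup>2) * s / 2)"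
    if "s > 0" "a \<le> b" for s a b
  proof -
    \<comment> \<open>The two integrands differ only at 0, where \<open>sine_ratio\<close> takes its
      default value.\<close>
    have "integral {a..b} (\<lambda>y. complex_of_real (sine_ratio x \<beta> y) * gauss_kernel \<beta> 0 y s) =
      integral {a..b} (\<lambda>y. complex_of_real (?g y) * gauss_kernel \<beta> 0 y s)"
      by (rule integral_spike[of "{0}"]) (auto simp: eq)
    also have "norm \<dots> \<le> 2 * (2 * B) * exp ((0\<^sup>2 - \<beta>\<^sup>2) * s / 2)"
      using that by (intro norm_integral_gauss_kernel_real norm_integral_gauss_weight bound gc) auto
    finally show ?thesis .
  qed
  then show ?thesis by blast
qed

section \<open>The method of images\<close>

lemma integral_exp_half_line:
  assumes "Im w > 0"
  shows "integrable lborel (\<lambda>l. indicator {0<..} l *\<^sub>R exp (\<i> * w * complex_of_real l))" (is ?I)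
    and "(LBINT l. indicator {0<..} l *\<^sub>R exp (\<i> * w * complex_of_real l)) = \<i> / w"
proof -
  have w: "w \<noteq> 0" using assms by auto
  show int: ?I
    by (rule Bochner_Integration.integrable_bound[OF integrable_I0i_exp_mscale[OF assms, unfolded set_integrable_def]])
      (auto simp: norm_exp_eq_Re mult.commute)
  let ?F = "\<lambda>l. exp (\<i> * w * complex_of_real l) / (\<i> * w)"
  have "(LBINT l=0..\<infinity>. exp (\<i> * w * complex_of_real l)) = 0 - 1 / (\<i> * w)"
  proof (rule interval_integral_FTC_integrable[where F="?F"])
    show "(?F has_vector_derivative exp (\<i> * w * complex_of_real l)) (at l)" for l
      using w by (auto intro!: derivative_eq_intros has_vector_derivative_real_field simp: mult_ac)
    show "set_integrable lborel (einterval 0 \<infinity>) (\<lambda>l. exp (\<i> * w * complex_of_real l))"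
      using int by (simp add: set_integrable_def einterval_def greaterThan_def)
    have "continuous (at_right 0) ?F"
      using w by (intro continuous_intros) auto
    then have "(?F \<longlongrightarrow> 1 / (\<i> * w)) (at_right 0)" by (simp add: continuous_within)
    then show "((?F \<circ> real_of_ereal) \<longlongrightarrow> 1 / (\<i> * w)) (at_right 0)"
      unfolding zero_ereal_def ereal_tendsto_simps .
    have "((\<lambda>l. exp (- v * l)) \<longlongrightarrow> 0) at_top" if "v > 0" for v :: real
      using that by real_asymp
    from tendsto_mult_left_zero[OF this[OF assms], of "1 / norm w"]
    have "((\<lambda>l. norm (?F l)) \<longlongrightarrow> 0) at_top"
      by (simp add: norm_divide norm_mult norm_exp_eq_Re)
    then have "(?F \<longlongrightarrow> 0) at_top" by (rule tendsto_norm_zero_cancel)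
    then show "((?F \<circ> real_of_ereal) \<longlongrightarrow> 0) (at_left \<infinity>)" by (simp add: ereal_tendsto_simps)
  qed (auto intro!: continuous_intros)
  also have "0 - 1 / (\<i> * w) = \<i> / w" using w by (simp add: field_simps)
  finally show "(LBINT l. indicator {0<..} l *\<^sub>R exp (\<i> * w * complex_of_real l)) = \<i> / w"
    by (simp only: interval_lebesgue_integral_0_infty set_lebesgue_integral_def)
qed

text \<open>Transition density of driftless Brownian motion killed at 0, at variance
  \<open>s\<close>. It is left unrestricted in \<open>l\<close>, where it is odd, so that reflection
  arguments apply.\<close>

definition image_kernel :: "real \<Rightarrow> real \<Rightarrow> real \<Rightarrow> real" where
  "image_kernel s x l = heat s (l - x) - heat s (l + x)"

lemma normal_density_borel_measurable [measurable (raw)]: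
  assumes [measurable]: "\<mu> \<in> borel_measurable M" "\<sigma> \<in> borel_measurable M" "f \<in> borel_measurable M"
  shows "(\<lambda>x. normal_density (\<mu> x) (\<sigma> x) (f x)) \<in> borel_measurable M"
  unfolding normal_density_def by measurable

lemma image_kernel_measurable [measurable (raw)]:
  assumes [measurable]: "s \<in> borel_measurable M" "x \<in> borel_measurable M" "l \<in> borel_measurable M"
  shows "(\<lambda>\<omega>. image_kernel (s \<omega>) (x \<omega>) (l \<omega>)) \<in> borel_measurable M"
  unfolding image_kernel_def by measurable

lemma image_kernel_uminus: "image_kernel s x (- l) = - image_kernel s x l"
proof -
  have "(- l - x)\<^sup>2 = (l + x)\<^sup>2" "(- l + x)\<^sup>2 = (l - x)\<^sup>2" by (simp_all add: power2_eq_square algebra_simps)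
  then show ?thesis by (simp add: image_kernel_def normal_density_def)
qed

lemma image_kernel_nonneg:
  assumes "s > 0" "x > 0" "l \<ge> 0"
  shows "image_kernel s x l \<ge> 0"
proof -
  have "(l - x)\<^sup>2 \<le> (l + x)\<^sup>2" using assms by (simp add: power2_eq_square algebra_simps)
  then show ?thesis using assms by (simp add: image_kernel_def normal_density_def divide_right_mono)
qed

lemma image_kernel_fourier:
  assumes "s > 0"
  shows "(LBINT y. (iexp (y * (x - l)) - iexp (y * (x + l))) * complex_of_real (gauss s y))
    = complex_of_real (2 * pi * image_kernel s x l)"
proof -
  have int: "integrable lborel (\<lambda>y. iexp (y * c) * complex_of_real (gauss s y))" for c
    by (rule Bochner_Integration.integrable_bound[OF integrable_exp_square[OF assms]])
      (auto simp: norm_mult norm_exp_eq_Re)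
  have "heat s (x - l) = heat s (l - x)"
    "heat s (x + l) = heat s (l + x)"
    by (simp_all add: normal_density_def power2_commute add.commute)
  then show ?thesis
    unfolding left_diff_distrib Bochner_Integration.integral_diff[OF int int] fourier_gauss[OF assms] image_kernel_def
    by (simp add: algebra_simps)
qed

text \<open>The Fourier form of the image kernel turns the integral over \<open>l\<close> into two
  half-line exponentials, which are the terms of \<open>resolvent\<close>. Fubini is absolute here:
  \<open>Im k > 0\<close> gives decay in \<open>l\<close>, the Gaussian gives it in
  \<open>y\<close>.\<close>

lemma image_kernel_transform:
  assumes s: "s > 0" and k: "Im k > 0"
  shows "(LBINT l. indicator {0<..} l *\<^sub>R (exp (\<i> * k * complex_of_real l) * complex_of_real (image_kernel s x l)))
    = (LBINT y. resolvent k y * wave 0 x y * complex_of_real (gauss s y)) / complex_of_real (2 * pi)"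
proof -
  let ?e = "\<lambda>y. gauss s y"
  let ?w = "\<lambda>l y. (iexp (y * (x - l)) - iexp (y * (x + l))) * complex_of_real (?e y)"
  define Q where "Q l y = indicator {0<..} l *\<^sub>R exp (\<i> * k * complex_of_real l) * ?w l y" for l y :: real
  have Qm [measurable]: "(\<lambda>(l, y). Q l y) \<in> borel_measurable (lborel \<Otimes>\<^sub>M lborel)"
    unfolding Q_def by measurable
  let ?G = "LBINT y. ?e y"
  have G0: "?G \<ge> 0" by (rule integral_nonneg_AE) auto
  have wn: "norm (?w l y) \<le> 2 * ?e y" for l y
  proof -
    have "norm (iexp (y * (x - l)) - iexp (y * (x + l))) \<le> 2"
      by (rule order.trans[OF norm_triangle_ineq4]) (simp add: norm_exp_eq_Re)
    then show ?thesis by (simp only: norm_mult norm_of_real abs_exp_cancel) (rule mult_right_mono, auto)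
  qed
  let ?d = "\<lambda>l. indicator {0<..} l *\<^sub>R exp (- (l * Im k))"
  have Qn: "norm (Q l y) \<le> ?d l * (2 * ?e y)" for l y
    unfolding Q_def norm_mult[of _ "?w l y"]
    by (rule mult_mono[OF _ wn]) (auto simp: norm_exp_eq_Re indicator_def mult.commute)
  have Qi: "integrable lborel (Q l)" for l
    by (rule Bochner_Integration.integrable_bound[OF integrable_mult_right[OF integrable_mult_right[OF integrable_exp_square[OF s]], of "?d l" 2]])
      (use Qn in \<open>auto simp: Q_def[abs_def] intro: order.trans[OF _ abs_ge_self]\<close>)
  have Qint: "integrable (lborel \<Otimes>\<^sub>M lborel) (case_prod Q)"
  proof (rule lborel_pair.Fubini_integrable)
    have "integrable lborel (\<lambda>l. ?d l * (2 * ?G))"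
      using integrable_I0i_exp_mscale[OF k] unfolding set_integrable_def by (rule integrable_mult_left)
    then show "integrable lborel (\<lambda>l. \<integral>y. norm (case (l, y) of (l, y) \<Rightarrow> Q l y) \<partial>lborel)"
    proof (rule Bochner_Integration.integrable_bound)
      show "AE l in lborel. norm (LBINT y. norm (case (l, y) of (l, y) \<Rightarrow> Q l y)) \<le> norm (?d l * (2 * ?G))"
      proof (rule AE_I2)
        fix l
        have "(LBINT y. norm (Q l y)) \<le> (LBINT y. ?d l * (2 * ?e y))"
          using Qn by (intro integral_mono integrable_norm Qi integrable_mult_right integrable_exp_square s)
        also have "\<dots> = ?d l * (2 * ?G)" by simp
        finally show "norm (LBINT y. norm (case (l, y) of (l, y) \<Rightarrow> Q l y)) \<le> norm (?d l * (2 * ?G))"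
          by (simp add: integral_nonneg_AE)
      qed
    qed measurable
  qed (use Qi in auto)
  have "complex_of_real (2 * pi) * (LBINT l. indicator {0<..} l *\<^sub>R (exp (\<i> * k * complex_of_real l) * complex_of_real (image_kernel s x l)))
    = (LBINT l. indicator {0<..} l *\<^sub>R exp (\<i> * k * complex_of_real l) * complex_of_real (2 * pi * image_kernel s x l))"
    by (simp add: scaleR_conv_of_real mult_ac flip: integral_mult_right_zero)
  also have "\<dots> = (LBINT l. (LBINT y. Q l y))"
    unfolding image_kernel_fourier[OF s, symmetric] Q_def integral_mult_right_zero ..
  also have "\<dots> = (LBINT y. (LBINT l. Q l y))"
    by (rule lborel_pair.Fubini_integral[OF Qint, symmetric])
  also have "\<dots> = (LBINT y. resolvent k y * wave 0 x y * complex_of_real (?e y))"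
  proof (rule Bochner_Integration.integral_cong[OF refl])
    fix y
    have 1: "Im (k - complex_of_real y) > 0" "Im (k + complex_of_real y) > 0" using k by auto
    have "Q l y = (indicator {0<..} l *\<^sub>R exp (\<i> * (k - complex_of_real y) * complex_of_real l)
        - indicator {0<..} l *\<^sub>R exp (\<i> * (k + complex_of_real y) * complex_of_real l)) * (wave 0 x y * complex_of_real (?e y))" for l
    proof -
      have "exp (\<i> * k * complex_of_real l) * iexp (y * (x - l)) = exp (\<i> * (k - complex_of_real y) * complex_of_real l) * wave 0 x y"
        "exp (\<i> * k * complex_of_real l) * iexp (y * (x + l)) = exp (\<i> * (k + complex_of_real y) * complex_of_real l) * wave 0 x y"
        unfolding wave_def Complex_eq by (simp_all add: algebra_simps flip: exp_add)
      moreover have "Q l y = indicator {0<..} l *\<^sub>R (exp (\<i> * k * complex_of_real l) * iexp (y * (x - l))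
        - exp (\<i> * k * complex_of_real l) * iexp (y * (x + l))) * complex_of_real (?e y)"
        unfolding Q_def by (simp only: right_diff_distrib left_diff_distrib scaleR_diff_right mult_scaleR_left mult.assoc)
      ultimately show ?thesis
        by (simp only: right_diff_distrib left_diff_distrib scaleR_diff_right mult_scaleR_left mult.assoc)
    qed
    then show "(LBINT l. Q l y) = resolvent k y * wave 0 x y * complex_of_real (?e y)"
      using integral_exp_half_line[OF 1(1)] integral_exp_half_line[OF 1(2)]
      by (simp only: integral_mult_left_zero Bochner_Integration.integral_diff) (simp add: resolvent_def mult_ac)
  qed
  finally show ?thesis by (simp add: field_simps)
qed

section \<open>Exponential moments of the image kernel\<close>

lemma exp_mult_normal_density:
  assumes "s > 0"
  shows "exp (b * l) * heat s (l - x) = exp (b * x + b\<^sup>2 * s / 2) * normal_density (x + b * s) (sqrt s) l"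
proof -
  have "exp (b * l) * exp (- (l - x)\<^sup>2 / (2 * s)) = exp (b * x + b\<^sup>2 * s / 2) * exp (- (l - (x + b * s))\<^sup>2 / (2 * s))"
    using assms by (simp add: power2_eq_square field_simps flip: exp_add)
  then show ?thesis using assms by (simp add: normal_density_def)
qed

lemma integral_exp_mult_normal_density:
  assumes "s > 0"
  shows "integrable lborel (\<lambda>l. exp (b * l) * heat s (l - x))"
    and "(LBINT l. exp (b * l) * heat s (l - x)) = exp (b * x + b\<^sup>2 * s / 2)"
  unfolding exp_mult_normal_density[OF assms] using assms by auto

lemma integral_exp_mult_image_kernel:
  assumes "s > 0"
  shows "integrable lborel (\<lambda>l. exp (b * l) * image_kernel s x l)"
    and "(LBINT l. exp (b * l) * image_kernel s x l) = exp (b\<^sup>2 * s / 2) * (exp (b * x) - exp (- b * x))"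
proof -
  note n = integral_exp_mult_normal_density[OF assms, of b]
  have eq: "exp (b * l) * image_kernel s x l = exp (b * l) * heat s (l - x) - exp (b * l) * heat s (l - (- x))" for l
    by (simp add: image_kernel_def algebra_simps)
  show "integrable lborel (\<lambda>l. exp (b * l) * image_kernel s x l)"
    unfolding eq by (intro Bochner_Integration.integrable_diff n)
  show "(LBINT l. exp (b * l) * image_kernel s x l) = exp (b\<^sup>2 * s / 2) * (exp (b * x) - exp (- b * x))"
    unfolding eq Bochner_Integration.integral_diff[OF n(1) n(1)] n(2) by (simp add: algebra_simps flip: exp_add)
qed

text \<open>Up to the factor \<open>exp (- b * x - b\<^sup>2 * s / 2)\<close> this is the
  probability that the motion with drift parameter \<open>b\<close> survives up to variance
  \<open>s\<close>.\<close>

definition image_mass :: "real \<Rightarrow> real \<Rightarrow> real \<Rightarrow> real" where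
  "image_mass b s x = (LBINT l. indicator {0<..} l * (exp (b * l) * image_kernel s x l))"

lemma integrable_image_mass:
  assumes "s > 0"
  shows "integrable lborel (\<lambda>l. indicator {0<..} l * (exp (b * l) * image_kernel s x l))"
  using integrable_mult_indicator[OF _ integral_exp_mult_image_kernel(1)[OF assms], of "{0<..}"] by simp

text \<open>The image kernel is odd, so the negative half of the integral over the whole line is
  minus the positive half with \<open>b\<close> reversed.\<close>

lemma image_mass_diff:
  assumes s: "s > 0"
  shows "image_mass b s x - image_mass (- b) s x = exp (b\<^sup>2 * s / 2) * (exp (b * x) - exp (- b * x))"
proof -
  let ?f = "\<lambda>l. exp (b * l) * image_kernel s x l"
  let ?p = "\<lambda>l. indicator {0<..} l * ?f l" and ?q = "\<lambda>l. indicator {..<0} l * ?f l"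
  have int: "integrable lborel ?p" "integrable lborel ?q"
    using integrable_mult_indicator[OF _ integral_exp_mult_image_kernel(1)[OF s]] by auto
  have "(LBINT l. ?f l) = (LBINT l. ?p l + ?q l)"
    using AE_lborel_singleton[of "0::real"] by (intro integral_cong_AE) (auto simp: indicator_def)
  also have "\<dots> = image_mass b s x + (LBINT l. ?q l)"
    using int by (simp add: image_mass_def)
  also have "(LBINT l. ?q l) = (LBINT l. ?q (0 + (-1) * l))"
    using lborel_integral_real_affine[of "-1" ?q 0] by simp
  also have "\<dots> = (LBINT l. - (indicator {0<..} l * (exp (- b * l) * image_kernel s x l)))"
    by (intro Bochner_Integration.integral_cong) (auto simp: indicator_def image_kernel_uminus)
  also have "\<dots> = - image_mass (- b) s x" by (simp add: image_mass_def)
  finally show ?thesis using integral_exp_mult_image_kernel(2)[OF s, of b x] by simp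
qed

text \<open>This is the transform of the image kernel at \<open>k = \<i> * \<eta>\<close>; its real
  part turns the resolvent into the sine ratio.\<close>

lemma image_mass_neg_drift:
  assumes s: "s > 0" and x: "x > 0" and \<eta>: "\<eta> \<ge> 0"
  shows "image_mass (- \<eta>) s x = (LBINT y. sine_ratio x \<eta> y * gauss s y) / pi"
proof -
  let ?e = "\<lambda>y. gauss s y"
  have pos: "image_mass (- \<eta>) s x = (LBINT y. sine_ratio x \<eta> y * ?e y) / pi" if \<eta>: "\<eta> > 0" for \<eta>
  proof -
    let ?k = "\<i> * complex_of_real \<eta>"
    let ?f = "\<lambda>y. resolvent ?k y * wave 0 x y * complex_of_real (?e y)"
    have "integrable lborel ?f"
    proof (rule Bochner_Integration.integrable_bound[OF integrable_mult_right[OF integrable_exp_square[OF s], of "2 / \<eta>"]])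
      have "norm (?f y) \<le> 2 / \<eta> * ?e y" for y
        using mult_right_mono[OF norm_resolvent_le[of ?k y], of "?e y"] \<eta>
        by (simp only: norm_mult norm_wave norm_of_real abs_exp_cancel) simp
      then show "AE y in lborel. norm (?f y) \<le> norm (2 / \<eta> * ?e y)" using \<eta> by (intro AE_I2) simp
    qed measurable
    then have "Re (LBINT y. ?f y) = (LBINT y. Re (?f y))" by (rule integral_Re[symmetric])
    also have "\<dots> = (LBINT y. 2 * (sine_ratio x \<eta> y * ?e y))"
    proof (rule Bochner_Integration.integral_cong[OF refl])
      fix y
      have "Re (z * complex_of_real r) = Re z * r" for z r by simp
      then show "Re (?f y) = 2 * (sine_ratio x \<eta> y * ?e y)"
        using sine_ratio_resolvent[of \<eta> y x] \<eta> by simp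
    qed
    also have "\<dots> = 2 * (LBINT y. sine_ratio x \<eta> y * ?e y)" by simp
    finally have R: "Re (LBINT y. ?f y) = 2 * (LBINT y. sine_ratio x \<eta> y * ?e y)" .
    have "(LBINT l. indicator {0<..} l *\<^sub>R (exp (\<i> * ?k * complex_of_real l) * complex_of_real (image_kernel s x l)))
      = (LBINT l. complex_of_real (indicator {0<..} l * (exp (- \<eta> * l) * image_kernel s x l)))"
      by (intro Bochner_Integration.integral_cong) (auto simp: scaleR_conv_of_real simp flip: exp_of_real)
    also have "\<dots> = complex_of_real (image_mass (- \<eta>) s x)"
      unfolding image_mass_def by (rule integral_of_real[OF integrable_image_mass[OF s]])
    finally have "complex_of_real (image_mass (- \<eta>) s x) = (LBINT y. ?f y) / complex_of_real (2 * pi)"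
      using image_kernel_transform[OF s, of ?k x] \<eta> by simp
    from arg_cong[OF this, of Re] show ?thesis using R by simp
  qed
  show ?thesis
  proof (cases "\<eta> > 0")
    \<comment> \<open>At \<open>\<eta> = 0\<close> the point \<open>k\<close> lies on the real axis,
      outside the range of the transform, so \<eta> decreases to 0 along
      \<open>1 / (n + 1)\<close>.\<close>
    case False
    then have [simp]: "\<eta> = 0" using \<eta> by simp
    let ?\<eta> = "\<lambda>n. inverse (real (Suc n))"
    have lim: "?\<eta> \<longlonglongrightarrow> 0" by (rule LIMSEQ_inverse_real_of_nat)
    have "(\<lambda>n. image_mass (- ?\<eta> n) s x) \<longlonglongrightarrow> image_mass 0 s x"
      unfolding image_mass_def
    \<comment> \<open>The image kernel is nonnegative for \<open>l > 0\<close>, so the integrand at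
      \<open>\<eta> = 0\<close> dominates.\<close>
    proof (rule integral_dominated_convergence[where w="\<lambda>l. indicator {0<..} l * (exp (0 * l) * image_kernel s x l)"])
      show "AE l in lborel. norm (indicator {0<..} l * (exp (- ?\<eta> n * l) * image_kernel s x l))
        \<le> indicator {0<..} l * (exp (0 * l) * image_kernel s x l)" for n
      proof (rule AE_I2)
        fix l
        show "norm (indicator {0<..} l * (exp (- ?\<eta> n * l) * image_kernel s x l))
          \<le> indicator {0<..} l * (exp (0 * l) * image_kernel s x l)"
        proof (cases "l > 0")
          case True
          then have "exp (- ?\<eta> n * l) * image_kernel s x l \<le> 1 * image_kernel s x l"
            using image_kernel_nonneg[OF s x, of l] by (intro mult_right_mono) auto
          then show ?thesis using True image_kernel_nonneg[OF s x, of l] by (simp add: abs_mult)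
        qed simp
      qed
      show "AE l in lborel. (\<lambda>n. indicator {0<..} l * (exp (- ?\<eta> n * l) * image_kernel s x l))
        \<longlonglongrightarrow> indicator {0<..} l * (exp (0 * l) * image_kernel s x l)"
        using tendsto_minus[OF lim]
        by (intro AE_I2 tendsto_mult tendsto_const tendsto_exp) (simp only: minus_zero)
      show "integrable lborel (\<lambda>l. indicator {0<..} l * (exp (0 * l) * image_kernel s x l))"
        by (rule integrable_image_mass[OF s])
    qed measurable
    moreover have "(\<lambda>n. (LBINT y. sine_ratio x (?\<eta> n) y * ?e y) / pi) \<longlonglongrightarrow> (LBINT y. sine_ratio x 0 y * ?e y) / pi"
    proof (rule tendsto_divide[OF integral_dominated_convergence[where w="\<lambda>y. x * ?e y"] tendsto_const])
      show "AE y in lborel. norm (sine_ratio x (?\<eta> n) y * ?e y) \<le> x * ?e y" for n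
        using abs_sine_ratio_le[OF x] by (intro AE_I2) (simp add: abs_mult mult_right_mono)
      show "AE y in lborel. (\<lambda>n. sine_ratio x (?\<eta> n) y * ?e y) \<longlonglongrightarrow> sine_ratio x 0 y * ?e y"
      proof (rule AE_I2)
        fix y
        show "(\<lambda>n. sine_ratio x (?\<eta> n) y * ?e y) \<longlonglongrightarrow> sine_ratio x 0 y * ?e y"
        proof (cases "y = 0")
          case False
          then show ?thesis unfolding sine_ratio_def by (intro tendsto_intros lim) auto
        qed (simp add: sine_ratio_def)
      qed
      show "integrable lborel (\<lambda>y. x * ?e y)" using integrable_exp_square[OF s] by simp
    qed auto
    ultimately show ?thesis
      using pos[of "?\<eta> _"] by (simp del: of_nat_Suc) (rule LIMSEQ_unique)
  qed (rule pos)
qed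

text \<open>For \<open>b > 0\<close> the weight exp (b l) corresponds to \<open>k\<close> in the
  lower half-plane, so the reflection identity passes to \<open>- b\<close>. It contributes
  \<open>1 - exp (- 2 * b * x)\<close>, the probability of never reaching 0, and this is the source
  of the case distinction.\<close>

lemma image_mass_eq:
  assumes s: "s > 0" and x: "x > 0"
  shows "exp (- b * x - b\<^sup>2 * s / 2) * image_mass b s x =
    1 - (exp (- 2 * b * x) * (if b > 0 then 1 else 0) + (if b \<le> 0 then 1 else 0))
    + exp (- b * x) / pi * (LBINT y. sine_ratio x b y * gauss s b * gauss s y)"
proof -
  let ?I = "LBINT y. sine_ratio x b y * gauss s y"
  have "(LBINT y. sine_ratio x b y * gauss s b * gauss s y) = gauss s b * ?I"
    by (simp add: mult_ac flip: integral_mult_right_zero)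
  moreover have "exp (- b * x - b\<^sup>2 * s / 2) = exp (- b * x) * gauss s b" by (simp flip: exp_add)
  moreover have n: "image_mass b s x = ?I / pi" if "b \<le> 0"
    using image_mass_neg_drift[OF s x, of "- b"] that by (simp add: sine_ratio_def)
  moreover have "image_mass b s x = ?I / pi + exp (b\<^sup>2 * s / 2) * (exp (b * x) - exp (- b * x))" if "b > 0"
    using image_mass_neg_drift[OF s x, of b] image_mass_diff[OF s, of b x] that by simp
  moreover have "exp (- b * x) * gauss s b * (exp (b\<^sup>2 * s / 2) * (exp (b * x) - exp (- b * x))) = 1 - exp (- 2 * b * x)"
    by (simp add: algebra_simps flip: exp_add)
  ultimately show ?thesis
    by (cases "b > 0") (simp_all only: distrib_left, simp_all)
qed

section \<open>Drifted Brownian motion killed at zero\<close>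

text \<open>Cameron-Martin for a single Gaussian: translate \<open>z\<close> by
  \<open>\<beta> * \<sigma> * s\<close>.\<close>

lemma normal_expectation_drift:
  fixes \<theta> :: "real \<Rightarrow> real"
  assumes s: "s > 0"
  shows "(LBINT z. exp (- \<beta> * (y + \<sigma> * z + \<beta> * \<sigma>\<^sup>2 * s)) * \<theta> (y + \<sigma> * z + \<beta> * \<sigma>\<^sup>2 * s) * heat s z)
    = exp (- \<beta> * y - \<beta>\<^sup>2 * \<sigma>\<^sup>2 * s / 2) * (LBINT z. \<theta> (y + \<sigma> * z) * heat s z)"
proof -
  have "(LBINT z. \<theta> (y + \<sigma> * z) * heat s z)
    = (LBINT z. \<theta> (y + \<sigma> * (\<beta> * \<sigma> * s + 1 * z)) * heat s (\<beta> * \<sigma> * s + 1 * z))"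
    by (subst lborel_integral_real_affine[of 1 _ "\<beta> * \<sigma> * s"]) auto
  moreover have "exp (- \<beta> * (y + \<sigma> * z + \<beta> * \<sigma>\<^sup>2 * s)) * \<theta> (y + \<sigma> * z + \<beta> * \<sigma>\<^sup>2 * s) * heat s z
    = exp (- \<beta> * y - \<beta>\<^sup>2 * \<sigma>\<^sup>2 * s / 2) * (\<theta> (y + \<sigma> * (\<beta> * \<sigma> * s + 1 * z)) * heat s (\<beta> * \<sigma> * s + 1 * z))" for z
  proof -
    have E: "exp (- \<beta> * (y + \<sigma> * z + \<beta> * \<sigma>\<^sup>2 * s)) * exp (- z\<^sup>2 / (2 * s))
      = exp (- \<beta> * y - \<beta>\<^sup>2 * \<sigma>\<^sup>2 * s / 2) * exp (- (\<beta> * \<sigma> * s + z)\<^sup>2 / (2 * s))"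
      using s by (simp add: power2_eq_square field_simps flip: exp_add)
    have F: "y + \<sigma> * (\<beta> * \<sigma> * s + 1 * z) = y + \<sigma> * z + \<beta> * \<sigma>\<^sup>2 * s"
      by (simp add: power2_eq_square algebra_simps)
    have n: "heat s u = 1 / sqrt (2 * pi * s) * exp (- u\<^sup>2 / (2 * s))" for u
      using s by (simp add: normal_density_def)
    have *: "a * t * (c * b) = d * (t * (c * e))" if "a * b = d * e" for a b c d e t :: real
      using arg_cong[OF that, of "\<lambda>u. u * (c * t)"] by (simp only: mult_ac)
    show ?thesis unfolding F n using E by (intro *) (simp only: mult_1)
  qed
  ultimately show ?thesis by (simp only: integral_mult_right_zero)
qed

text \<open>For \<open>y = 0\<close> the average vanishes by symmetry, and the Lipschitz bound
  compares the two starting points under the same noise.\<close>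

lemma abs_normal_expectation_odd:
  fixes \<theta> :: "real \<Rightarrow> real"
  assumes s: "s > 0" and [measurable]: "\<theta> \<in> borel_measurable borel"
    and odd: "\<And>l. \<theta> (- l) = - \<theta> l" and bd: "\<And>l. \<bar>\<theta> l\<bar> \<le> 1"
    and lip: "\<And>u v. \<bar>\<theta> u - \<theta> v\<bar> \<le> m * \<bar>u - v\<bar>"
  shows "\<bar>LBINT z. \<theta> (y + \<sigma> * z) * heat s z\<bar> \<le> m * \<bar>y\<bar>"
proof -
  let ?n = "heat s"
  have sq: "0 < sqrt s" using s by simp
  have int: "integrable lborel (\<lambda>z. \<theta> (y + \<sigma> * z) * ?n z)" for y
    by (rule Bochner_Integration.integrable_bound[OF integrable_normal_density[OF sq, of 0]])
      (use bd in \<open>auto simp: abs_mult mult_left_le_one_le\<close>)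
  have "(LBINT z. \<theta> (0 + \<sigma> * z) * ?n z) = (LBINT z. \<theta> (0 + \<sigma> * (0 + (-1) * z)) * ?n (0 + (-1) * z))"
    by (subst lborel_integral_real_affine[of "-1" _ 0]) auto
  also have "\<dots> = (LBINT z. - (\<theta> (0 + \<sigma> * z) * ?n z))"
    by (intro Bochner_Integration.integral_cong) (auto simp: odd normal_density_def)
  finally have zero: "(LBINT z. \<theta> (0 + \<sigma> * z) * ?n z) = 0" by simp
  have "\<bar>LBINT z. \<theta> (y + \<sigma> * z) * ?n z\<bar> = \<bar>(LBINT z. \<theta> (y + \<sigma> * z) * ?n z - \<theta> (0 + \<sigma> * z) * ?n z)\<bar>"
    by (subst Bochner_Integration.integral_diff[OF int int]) (simp only: zero diff_0_right)
  also have "\<dots> \<le> (LBINT z. \<bar>\<theta> (y + \<sigma> * z) * ?n z - \<theta> (0 + \<sigma> * z) * ?n z\<bar>)"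
    by (rule integral_abs_bound)
  also have "\<dots> \<le> (LBINT z. m * \<bar>y\<bar> * ?n z)"
  proof (rule integral_mono)
    show "integrable lborel (\<lambda>z. \<bar>\<theta> (y + \<sigma> * z) * ?n z - \<theta> (0 + \<sigma> * z) * ?n z\<bar>)"
      by (intro integrable_abs Bochner_Integration.integrable_diff int)
    show "\<bar>\<theta> (y + \<sigma> * z) * ?n z - \<theta> (0 + \<sigma> * z) * ?n z\<bar> \<le> m * \<bar>y\<bar> * ?n z" for z
      using lip[of "y + \<sigma> * z" "0 + \<sigma> * z"]
      by (simp add: abs_mult mult_right_mono flip: left_diff_distrib)
  qed (use integrable_normal_density[OF sq] in auto)
  also have "\<dots> = m * \<bar>y\<bar>" using integral_normal_density[OF sq, of 0] by simp
  finally show ?thesis .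
qed

text \<open>Stands in for conditioning on \<open>V\<close>: by independence the joint law is a
  product, so \<open>V\<close> can be frozen and the bound on the inner average integrated.\<close>

lemma (in prob_space) abs_expectation_indep_le:
  fixes h :: "'b \<times> 'b \<Rightarrow> real"
  assumes ind: "indep_var N V N' Z" and h [measurable]: "h \<in> borel_measurable (N \<Otimes>\<^sub>M N')"
    and C: "\<And>p. \<bar>h p\<bar> \<le> C" and [measurable]: "b \<in> borel_measurable N" and bC: "\<And>v. 0 \<le> b v" "\<And>v. b v \<le> C"
    and le: "\<And>v. v \<in> space N \<Longrightarrow> \<bar>\<integral>z. h (v, z) \<partial>distr M N' Z\<bar> \<le> b v"
  shows "\<bar>\<integral>\<omega>. h (V \<omega>, Z \<omega>) \<partial>M\<bar> \<le> (\<integral>\<omega>. b (V \<omega>) \<partial>M)"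
proof -
  have V [measurable]: "V \<in> measurable M N" and Z [measurable]: "Z \<in> measurable M N'"
    using ind by (auto dest: indep_var_rv1 indep_var_rv2)
  interpret V: prob_space "distr M N V" by (rule prob_space_distr) measurable
  interpret Z: prob_space "distr M N' Z" by (rule prob_space_distr) measurable
  interpret P: pair_prob_space "distr M N V" "distr M N' Z" ..
  have eq: "distr M N V \<Otimes>\<^sub>M distr M N' Z = distr M (N \<Otimes>\<^sub>M N') (\<lambda>\<omega>. (V \<omega>, Z \<omega>))"
    using ind indep_var_distribution_eq by blast
  have hi: "integrable (distr M N V \<Otimes>\<^sub>M distr M N' Z) h"
    by (rule P.integrable_const_bound[where B=C]) (use C in auto)
  have "(\<integral>\<omega>. h (V \<omega>, Z \<omega>) \<partial>M) = (\<integral>p. h p \<partial>(distr M N V \<Otimes>\<^sub>M distr M N' Z))"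
    unfolding eq by (subst integral_distr) auto
  also have "\<dots> = (\<integral>v. (\<integral>z. h (v, z) \<partial>distr M N' Z) \<partial>distr M N V)"
    by (rule P.integral_fst'[OF hi, symmetric])
  finally have "\<bar>\<integral>\<omega>. h (V \<omega>, Z \<omega>) \<partial>M\<bar> \<le> (\<integral>v. \<bar>\<integral>z. h (v, z) \<partial>distr M N' Z\<bar> \<partial>distr M N V)"
    by (simp only: integral_abs_bound)
  also have "\<dots> \<le> (\<integral>v. b v \<partial>distr M N V)"
  proof (rule integral_mono)
    show "integrable (distr M N V) (\<lambda>v. \<bar>\<integral>z. h (v, z) \<partial>distr M N' Z\<bar>)"
      by (intro integrable_abs P.integrable_fst'[OF hi])
    show "integrable (distr M N V) b"
      by (rule V.integrable_const_bound[where B=C]) (use bC in auto)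
  qed (use le in auto)
  also have "\<dots> = (\<integral>\<omega>. b (V \<omega>) \<partial>M)" by (subst integral_distr) auto
  finally show ?thesis .
qed

section \<open>Grid approximation of barrier crossings\<close>

locale drifted_brownian = prob_space M for M :: "'a measure" +
  fixes W :: "real \<Rightarrow> 'a \<Rightarrow> real" and x \<sigma> \<beta> :: real
  assumes brownian: "standard_brownian_motion M W" and x_pos: "x > 0" and sigma_pos: "\<sigma> > 0"
begin

abbreviation X where "X \<equiv> drifted_bm x \<sigma> \<beta> W"

lemma W_measurable [measurable]: "t \<ge> 0 \<Longrightarrow> W t \<in> borel_measurable M"
  using brownian by (auto simp: standard_brownian_motion_def)

lemma W_0: "\<omega> \<in> space M \<Longrightarrow> W 0 \<omega> = 0"
  using brownian by (auto simp: standard_brownian_motion_def)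

lemma X_measurable [measurable]: "t \<ge> 0 \<Longrightarrow> X t \<in> borel_measurable M"
  unfolding drifted_bm_def[abs_def] by measurable

lemma X_0: "\<omega> \<in> space M \<Longrightarrow> X 0 \<omega> = x"
  by (simp add: drifted_bm_def W_0)

lemma W_continuous: "\<omega> \<in> space M \<Longrightarrow> continuous_on {0..} (\<lambda>t. W t \<omega>)"
  using brownian by (auto simp: standard_brownian_motion_def)

lemma X_continuous: "\<omega> \<in> space M \<Longrightarrow> continuous_on {0..} (\<lambda>t. X t \<omega>)"
  unfolding drifted_bm_def by (intro continuous_intros W_continuous)

lemma W_increment:
  "0 \<le> s \<Longrightarrow> s < t \<Longrightarrow> distributed M lborel (\<lambda>\<omega>. W t \<omega> - W s \<omega>) (normal_density 0 (sqrt (t - s)))"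
  using brownian unfolding standard_brownian_motion_def by blast

lemma W_indep:
  "0 \<le> \<tau> 0 \<Longrightarrow> mono \<tau> \<Longrightarrow> indep_vars (\<lambda>_. borel) (\<lambda>i \<omega>. W (\<tau> (Suc i)) \<omega> - W (\<tau> i) \<omega>) {..<n}"
  for \<tau> :: "nat \<Rightarrow> real"
  using brownian unfolding standard_brownian_motion_def by blast

definition grid :: "real \<Rightarrow> nat \<Rightarrow> nat \<Rightarrow> real" where "grid g n i = g * real i / real n"

definition first_below :: "real \<Rightarrow> real \<Rightarrow> nat \<Rightarrow> nat \<Rightarrow> 'a \<Rightarrow> bool" where
  "first_below \<delta> g n i \<omega> \<longleftrightarrow> (\<forall>j<i. X (grid g n j) \<omega> \<ge> \<delta>) \<and> X (grid g n i) \<omega> < \<delta>"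

lemma grid_nonneg: "g \<ge> 0 \<Longrightarrow> grid g n i \<ge> 0"
  by (simp add: grid_def)

lemma grid_mem:
  assumes "g \<ge> 0" "i \<le> n"
  shows "grid g n i \<in> {0..g}"
proof -
  have "g * real i \<le> g * real n" using assms by (intro mult_left_mono) auto
  \<comment> \<open>For \<open>n = 0\<close> division by zero puts every grid point at 0.\<close>
  then show ?thesis using assms by (cases "n = 0") (auto simp: grid_def field_simps)
qed

lemma grid_measurable: "g \<ge> 0 \<Longrightarrow> X (grid g n i) \<in> borel_measurable M"
  by (intro X_measurable grid_nonneg)

lemma first_below_measurable [measurable]:
  assumes "g \<ge> 0"
  shows "Measurable.pred M (first_below \<delta> g n i)"
proof -
  note [measurable] = grid_measurable[OF assms]
  show ?thesis unfolding first_below_def[abs_def] by measurable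
qed

text \<open>The strict inequality makes crossings open in time, so a fine grid detects them; hitting
  the closed level 0 can be invisible to every grid and is reached by letting \<delta> tend to
  0.\<close>

definition below :: "real \<Rightarrow> real \<Rightarrow> 'a \<Rightarrow> bool" where
  "below \<delta> g \<omega> \<longleftrightarrow> (\<exists>s\<in>{0..g}. X s \<omega> < \<delta>)"

definition hits :: "real \<Rightarrow> 'a \<Rightarrow> bool" where
  "hits g \<omega> \<longleftrightarrow> (\<exists>s\<in>{0..g}. X s \<omega> \<le> 0)"

lemma sum_first_below_eq:
  assumes "first_below \<delta> g n i \<omega>" "i \<le> n"
  shows "(\<Sum>j\<le>n. indicator {\<omega>. first_below \<delta> g n j \<omega>} \<omega> * f j) = (f i :: real)"
proof -
  have "first_below \<delta> g n j \<omega> \<longleftrightarrow> j = i" for j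
    using assms(1) unfolding first_below_def by (meson linorder_neqE_nat not_less)
  then have "(\<Sum>j\<le>n. indicator {\<omega>. first_below \<delta> g n j \<omega>} \<omega> * f j) = (\<Sum>j\<le>n. if j = i then f j else 0)"
    by (intro sum.cong) (auto simp: indicator_def)
  also have "\<dots> = f i" using assms(2) by simp
  finally show ?thesis .
qed

lemma ex_first_below:
  assumes "X (grid g n i) \<omega> < \<delta>"
  shows "\<exists>j\<le>i. first_below \<delta> g n j \<omega>"
proof -
  define j where "j = (LEAST j. X (grid g n j) \<omega> < \<delta>)"
  have "X (grid g n j) \<omega> < \<delta>" unfolding j_def using assms by (rule LeastI)
  moreover have "j \<le> i" unfolding j_def using assms by (rule Least_le)
  moreover have "X (grid g n k) \<omega> \<ge> \<delta>" if "k < j" for k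
    using not_less_Least[OF that[unfolded j_def]] by simp
  ultimately show ?thesis by (auto simp: first_below_def)
qed

lemma grid_below:
  assumes "g > 0" "i \<le> n" "X (grid g n i) \<omega> < \<delta>"
  shows "below \<delta> g \<omega>"
proof -
  have "grid g n i \<in> {0..g}" using assms by (intro grid_mem) auto
  then show ?thesis using assms(3) by (auto simp: below_def)
qed

lemma below_grid:
  assumes \<omega>: "\<omega> \<in> space M" and g: "g > 0" and "below \<delta> g \<omega>"
  shows "eventually (\<lambda>n. \<exists>i\<le>n. X (grid g n i) \<omega> < \<delta>) sequentially"
proof -
  obtain s where s: "0 \<le> s" "s \<le> g" "X s \<omega> < \<delta>" using assms(3) by (auto simp: below_def)
  have "\<exists>d>0. \<forall>u\<in>{0..}. dist u s < d \<longrightarrow> dist (X u \<omega>) (X s \<omega>) < \<delta> - X s \<omega>"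
    using X_continuous[OF \<omega>] s unfolding continuous_on_iff by auto
  then obtain d where d: "d > 0" "\<And>u. u \<ge> 0 \<Longrightarrow> dist u s < d \<Longrightarrow> dist (X u \<omega>) (X s \<omega>) < \<delta> - X s \<omega>"
    by auto
  have "eventually (\<lambda>n. real n > g / d) sequentially"
    using filterlim_real_sequentially by (auto simp: filterlim_at_top_dense)
  then show ?thesis
  proof eventually_elim
    case (elim n)
    then have n: "real n > 0" using g d by (meson divide_pos_pos less_trans)
    let ?q = "s * real n / g"
    \<comment> \<open>The last grid point not after \<open>s\<close>; its distance to
      \<open>s\<close> is below the mesh \<open>g / n\<close>.\<close>
    define i where "i = nat \<lfloor>?q\<rfloor>"
    have q: "0 \<le> ?q" "?q \<le> real n" using s g n by (auto simp: field_simps)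
    then have i: "real i \<le> ?q" "?q < real i + 1" unfolding i_def by linarith+
    have "real i \<le> real n" using i(1) q(2) by linarith
    then have "i \<le> n" by simp
    have "grid g n i \<le> s" "s < grid g n i + g / real n"
      using i g n by (auto simp: grid_def field_simps)
    moreover have "g / real n < d" using elim n d by (simp add: field_simps)
    ultimately have "dist (grid g n i) s < d" by (simp add: dist_real_def)
    from d(2)[OF grid_nonneg this] g have "X (grid g n i) \<omega> < \<delta>"
      by (simp add: dist_real_def)
    with \<open>i \<le> n\<close> show ?case by blast
  qed
qed

text \<open>At the preceding grid point the path is still at least \<delta>, and on a fine grid it
  cannot drop by \<delta> in one step, so it is still positive. \<open>\<delta> \<le> x\<close>
  excludes index 0, which has no predecessor.\<close>

lemma first_below_near_zero:
  assumes \<omega>: "\<omega> \<in> space M" and g: "g > 0" and \<delta>: "0 < \<delta>" "\<delta> \<le> x"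
  shows "eventually (\<lambda>n. \<forall>i\<le>n. first_below \<delta> g n i \<omega> \<longrightarrow> \<bar>X (grid g n i) \<omega>\<bar> \<le> \<delta>) sequentially"
proof -
  have "uniformly_continuous_on {0..g} (\<lambda>t. X t \<omega>)"
    using continuous_on_subset[OF X_continuous[OF \<omega>], of "{0..g}"] by (intro compact_uniformly_continuous) auto
  then obtain d where d: "d > 0" "\<And>u v. u \<in> {0..g} \<Longrightarrow> v \<in> {0..g} \<Longrightarrow> dist u v < d \<Longrightarrow> dist (X u \<omega>) (X v \<omega>) < \<delta>"
    using \<delta>(1) unfolding uniformly_continuous_on_def by metis
  have "eventually (\<lambda>n. real n > g / d) sequentially"
    using filterlim_real_sequentially by (auto simp: filterlim_at_top_dense)
  then show ?thesis
  proof (eventually_elim, intro allI impI)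
    fix n i assume n: "g / d < real n" and i: "i \<le> n" "first_below \<delta> g n i \<omega>"
    have n0: "real n > 0" using n g d by (meson divide_pos_pos less_trans)
    have "i \<noteq> 0"
    proof
      assume "i = 0"
      with i(2) have "X 0 \<omega> < \<delta>" by (simp add: first_below_def grid_def)
      with X_0[OF \<omega>] \<delta> show False by simp
    qed
    then obtain j where j: "i = Suc j" by (cases i) auto
    have X: "X (grid g n j) \<omega> \<ge> \<delta>" "X (grid g n i) \<omega> < \<delta>" using i(2) by (auto simp: first_below_def j)
    have r: "grid g n j \<in> {0..g}" "grid g n i \<in> {0..g}" using i(1) g by (auto simp del: atLeastAtMost_iff simp: j intro!: grid_mem)
    have "dist (grid g n i) (grid g n j) = g / real n" using g n0 by (simp add: grid_def dist_real_def j field_simps)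
    also have "\<dots> < d" using n n0 d by (simp add: field_simps)
    finally show "\<bar>X (grid g n i) \<omega>\<bar> \<le> \<delta>" using d(2)[OF r(2,1)] X by (simp add: dist_real_def)
  qed
qed

text \<open>A continuous path that stays positive on a compact interval has a positive minimum,
  which serves as \<open>e\<close>.\<close>

lemma below_hits:
  assumes \<omega>: "\<omega> \<in> space M" and g: "g > 0" and "\<not> hits g \<omega>"
  shows "\<exists>e>0. \<not> below e g \<omega>"
proof -
  have c: "continuous_on {0..g} (\<lambda>t. X t \<omega>)"
    using continuous_on_subset[OF X_continuous[OF \<omega>], of "{0..g}"] by auto
  obtain s where s: "s \<in> {0..g}" "\<And>u. u \<in> {0..g} \<Longrightarrow> X s \<omega> \<le> X u \<omega>"
    using continuous_attains_inf[OF _ _ c] g by auto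
  have "X s \<omega> > 0" using assms(3) s(1) by (auto simp: hits_def not_le)
  moreover have "\<not> below (X s \<omega>) g \<omega>" using s(2) by (auto simp: below_def not_less)
  ultimately show ?thesis by blast
qed

end

section \<open>Odd test functions and the vanishing expectation on the hit event\<close>

text \<open>\<open>\<theta>_support\<close> records the one consequence of compact support that
  enters: the exponentially weighted function is bounded. The Lipschitz constant controls odd
  averages from a start near 0.\<close>

locale test_function = drifted_brownian M W x \<sigma> \<beta>
  for M :: "'a measure" and W x \<sigma> \<beta> +
  fixes \<theta> :: "real \<Rightarrow> real" and m C :: real
  assumes \<theta>_measurable [measurable]: "\<theta> \<in> borel_measurable borel"
    and \<theta>_odd: "\<And>l. \<theta> (- l) = - \<theta> l"
    and \<theta>_bound: "\<And>l. \<bar>\<theta> l\<bar> \<le> 1"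
    and \<theta>_lipschitz: "\<And>u v. \<bar>\<theta> u - \<theta> v\<bar> \<le> m * \<bar>u - v\<bar>"
    and \<theta>_support: "\<And>l. exp (- \<beta> * l) * \<bar>\<theta> l\<bar> \<le> C"
begin

text \<open>
  The factor \<open>exp (- \<beta> * l)\<close> absorbs the drift: for the process started at \<open>0\<close> the expectation of
  \<open>\<phi>\<close> is a positive multiple of a centred Gaussian average of the odd function \<open>\<theta>\<close>, hence \<open>0\<close>.
\<close>

definition \<phi> :: "real \<Rightarrow> real" where "\<phi> l = exp (- \<beta> * l) * \<theta> l"

text \<open>A common bound for \<open>\<phi>\<close> at distance \<open>r\<close> from 0 and for its
  Gaussian average from there. The cap \<open>C\<close> serves dominated convergence; the other term
  tends to 0 with \<open>r\<close>.\<close>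

definition \<rho> :: "real \<Rightarrow> real" where "\<rho> r = min C (exp (\<bar>\<beta>\<bar> * r) * (m * r))"

lemma \<phi>_measurable [measurable]: "\<phi> \<in> borel_measurable borel"
  unfolding \<phi>_def by measurable

lemma \<rho>_measurable [measurable]: "\<rho> \<in> borel_measurable borel"
  unfolding \<rho>_def by measurable

lemma abs_\<phi>_le: "\<bar>\<phi> l\<bar> \<le> C"
  using \<theta>_support[of l] by (simp add: \<phi>_def abs_mult)

lemma C_nonneg: "C \<ge> 0"
  using order.trans[OF abs_ge_zero abs_\<phi>_le] .

lemma m_nonneg: "m \<ge> 0"
  using order.trans[OF abs_ge_zero \<theta>_lipschitz[of 1 0]] by simp

lemma \<theta>_0: "\<theta> 0 = 0"
  using \<theta>_odd[of 0] by simp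

lemma \<rho>_nonneg: "r \<ge> 0 \<Longrightarrow> 0 \<le> \<rho> r"
  using C_nonneg m_nonneg by (simp add: \<rho>_def)

lemma \<rho>_mono: "0 \<le> r \<Longrightarrow> r \<le> r' \<Longrightarrow> \<rho> r \<le> \<rho> r'"
  unfolding \<rho>_def using m_nonneg
  by (intro min.mono mult_mono order_refl) (auto intro: mult_left_mono)

lemma abs_\<phi>_le_\<rho>: "\<bar>\<phi> y\<bar> \<le> \<rho> \<bar>y\<bar>"
proof -
  have "\<bar>\<phi> y\<bar> = exp (- \<beta> * y) * \<bar>\<theta> y\<bar>" by (simp add: \<phi>_def abs_mult)
  also have "\<dots> \<le> exp (\<bar>\<beta>\<bar> * \<bar>y\<bar>) * (m * \<bar>y\<bar>)"
    using \<theta>_lipschitz[of y 0] abs_ge_minus_self[of "\<beta> * y"]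
    by (intro mult_mono) (auto simp: \<theta>_0 simp flip: abs_mult)
  finally show ?thesis using abs_\<phi>_le by (simp add: \<rho>_def)
qed

lemma abs_expectation_\<phi>_le:
  assumes s: "s > 0"
  shows "\<bar>LBINT z. \<phi> (y + \<sigma> * z + \<beta> * \<sigma>\<^sup>2 * s) * heat s z\<bar> \<le> \<rho> \<bar>y\<bar>"
proof -
  let ?I = "LBINT z. \<phi> (y + \<sigma> * z + \<beta> * \<sigma>\<^sup>2 * s) * heat s z"
  have sq: "0 < sqrt s" using s by simp
  have "\<bar>?I\<bar> = exp (- \<beta> * y - \<beta>\<^sup>2 * \<sigma>\<^sup>2 * s / 2) * \<bar>LBINT z. \<theta> (y + \<sigma> * z) * heat s z\<bar>"
    unfolding \<phi>_def normal_expectation_drift[OF s] by (simp only: abs_mult abs_exp_cancel)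
  also have "\<dots> \<le> exp (\<bar>\<beta>\<bar> * \<bar>y\<bar>) * (m * \<bar>y\<bar>)"
  proof (intro mult_mono abs_normal_expectation_odd s \<theta>_measurable \<theta>_odd \<theta>_bound \<theta>_lipschitz)
    have "- \<beta> * y \<le> \<bar>\<beta>\<bar> * \<bar>y\<bar>" "0 \<le> \<beta>\<^sup>2 * \<sigma>\<^sup>2 * s / 2"
      using s abs_ge_minus_self[of "\<beta> * y"] by (auto simp: abs_mult)
    then show "exp (- \<beta> * y - \<beta>\<^sup>2 * \<sigma>\<^sup>2 * s / 2) \<le> exp (\<bar>\<beta>\<bar> * \<bar>y\<bar>)" unfolding exp_le_cancel_iff by linarith
  qed auto
  finally have 1: "\<bar>?I\<bar> \<le> exp (\<bar>\<beta>\<bar> * \<bar>y\<bar>) * (m * \<bar>y\<bar>)" .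
  have "\<bar>?I\<bar> \<le> (LBINT z. \<bar>\<phi> (y + \<sigma> * z + \<beta> * \<sigma>\<^sup>2 * s) * heat s z\<bar>)"
    by (rule integral_abs_bound)
  also have "\<dots> \<le> (LBINT z. C * heat s z)"
  proof (rule integral_mono')
    show "integrable lborel (\<lambda>z. C * heat s z)"
      using integrable_normal_density[OF sq] by simp
  qed (auto simp: abs_mult abs_\<phi>_le C_nonneg mult_right_mono)
  also have "\<dots> = C" using integral_normal_density[OF sq, of 0] by simp
  finally show ?thesis using 1 by (simp add: \<rho>_def)
qed

text \<open>
  The Markov property at the first grid point below the barrier: conditionally on the past, the
  expectation of \<open>\<phi> (X g)\<close> is an odd average, hence small because \<open>X\<close> is close to \<open>0\<close> there.
\<close>

lemma first_below_step:
  assumes g: "g > 0" and i: "i \<le> n" and n: "n > 0"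
  shows "\<bar>\<integral>\<omega>. indicator {\<omega>. first_below \<delta> g n i \<omega>} \<omega> * \<phi> (X g \<omega>) \<partial>M\<bar>
    \<le> (\<integral>\<omega>. indicator {\<omega>. first_below \<delta> g n i \<omega>} \<omega> * \<rho> \<bar>X (grid g n i) \<omega>\<bar> \<partial>M)"
proof (cases "i = n")
  \<comment> \<open>No time is left after the last grid point, so \<open>\<phi>\<close> is bounded
    directly.\<close>
  case True
  have gr: "grid g n i = g" using True n by (simp add: grid_def)
  note [measurable] = grid_measurable[of g n i] first_below_measurable[of g \<delta> n i]
  have [measurable]: "X g \<in> borel_measurable M" using g by simp
  have "\<bar>\<integral>\<omega>. indicator {\<omega>. first_below \<delta> g n i \<omega>} \<omega> * \<phi> (X g \<omega>) \<partial>M\<bar>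
    \<le> (\<integral>\<omega>. \<bar>indicator {\<omega>. first_below \<delta> g n i \<omega>} \<omega> * \<phi> (X g \<omega>)\<bar> \<partial>M)"
    by (rule integral_abs_bound)
  also have "\<dots> \<le> (\<integral>\<omega>. indicator {\<omega>. first_below \<delta> g n i \<omega>} \<omega> * \<rho> \<bar>X (grid g n i) \<omega>\<bar> \<partial>M)"
  proof (rule integral_mono')
    show "integrable M (\<lambda>\<omega>. indicator {\<omega>. first_below \<delta> g n i \<omega>} \<omega> * \<rho> \<bar>X (grid g n i) \<omega>\<bar>)"
      using g C_nonneg \<rho>_nonneg
      by (intro integrable_const_bound[where B=C]) (auto simp: indicator_def \<rho>_def)
  qed (use abs_\<phi>_le_\<rho> \<rho>_nonneg in \<open>auto simp: indicator_def gr\<close>)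
  finally show ?thesis .
next
  case False
  then have lt: "i < n" using i by simp
  \<comment> \<open>Grid times up to \<open>i\<close>, then a jump to \<open>g\<close>: the
    increment with index \<open>i\<close> covers all the remaining time.\<close>
  define \<tau> where "\<tau> j = (if j \<le> i then grid g n j else g)" for j
  define r where "r = g - grid g n i"
  have r: "r > 0" using lt g n by (simp add: r_def grid_def field_simps)
  have \<tau>0: "\<tau> 0 = 0" by (simp add: \<tau>_def grid_def)
  have gl: "grid g n j \<le> grid g n k" "grid g n j \<le> g" if "j \<le> k" "j \<le> n" for j k
    using that g n by (auto simp: grid_def field_simps)
  have "mono \<tau>" unfolding \<tau>_def mono_def using gl i by (auto intro: order.trans)
  define D where "D k \<omega> = W (\<tau> (Suc k)) \<omega> - W (\<tau> k) \<omega>" for k \<omega>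
  have ind: "indep_vars (\<lambda>_. borel) D {..<Suc i}"
    unfolding D_def[abs_def] using \<tau>0 \<open>mono \<tau>\<close> by (intro W_indep) auto
  have [measurable]: "D k \<in> borel_measurable M" if "k \<le> i" for k
    using ind that unfolding indep_vars_def2 by auto
  let ?N = "PiM {..<i} (\<lambda>_. borel) :: (nat \<Rightarrow> real) measure" and ?N' = "PiM {i} (\<lambda>_. borel) :: (nat \<Rightarrow> real) measure"
  let ?V = "\<lambda>\<omega>. restrict (\<lambda>k. D k \<omega>) {..<i}" and ?Z = "\<lambda>\<omega>. restrict (\<lambda>k. D k \<omega>) {i}"
  have ind2: "indep_var ?N ?V ?N' ?Z"
    by (rule indep_var_restrict[OF ind]) auto
  \<comment> \<open>The path at grid time \<open>j\<close> rebuilt from the increments, so that the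
    event and the position at step \<open>i\<close> depend on \<open>?V\<close> only.\<close>
  define \<xi> where "\<xi> j v = x + \<sigma> * (\<Sum>k<j. v k) + \<beta> * \<sigma>\<^sup>2 * grid g n j" for j and v :: "nat \<Rightarrow> real"
  have \<xi>_meas [measurable]: "\<xi> j \<in> borel_measurable ?N" if "j \<le> i" for j
  proof -
    have "(\<lambda>v. v k) \<in> borel_measurable ?N" if "k < j" for k
      by (rule measurable_component_singleton) (use that \<open>j \<le> i\<close> in simp)
    then show ?thesis unfolding \<xi>_def[abs_def] by (intro borel_measurable_add borel_measurable_times borel_measurable_sum borel_measurable_const) auto
  qed
  define S where "S v \<longleftrightarrow> (\<forall>j<i. \<xi> j v \<ge> \<delta>) \<and> \<xi> i v < \<delta>" for v
  have S_meas [measurable]: "Measurable.pred ?N S"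
  proof -
    have [measurable]: "Measurable.pred ?N (\<lambda>v. j < i \<longrightarrow> \<xi> j v \<ge> \<delta>)" for j
      using \<xi>_meas[of j] by (cases "j < i") simp_all
    have [measurable]: "\<xi> i \<in> borel_measurable ?N" by (rule \<xi>_meas) simp
    show ?thesis unfolding S_def[abs_def] by measurable
  qed
  have [measurable]: "\<xi> i \<in> borel_measurable ?N" by (rule \<xi>_meas) simp
  have [measurable]: "(\<lambda>z. z i) \<in> borel_measurable ?N'" by (rule measurable_component_singleton) simp
  have path: "\<xi> j (?V \<omega>) = X (grid g n j) \<omega>" if "\<omega> \<in> space M" "j \<le> i" for j \<omega>
  proof -
    have "(\<Sum>k<j. ?V \<omega> k) = (\<Sum>k<j. W (\<tau> (Suc k)) \<omega> - W (\<tau> k) \<omega>)"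
      using that by (intro sum.cong) (auto simp: D_def)
    also have "\<dots> = W (\<tau> j) \<omega> - W (\<tau> 0) \<omega>" by (rule sum_lessThan_telescope)
    also have "\<dots> = W (grid g n j) \<omega>" using that unfolding \<tau>0 by (simp add: W_0 \<tau>_def)
    finally show ?thesis by (simp add: \<xi>_def drifted_bm_def)
  qed
  have last: "X g \<omega> = \<xi> i (?V \<omega>) + \<sigma> * ?Z \<omega> i + \<beta> * \<sigma>\<^sup>2 * r" if "\<omega> \<in> space M" for \<omega>
    using path[OF that order_refl] by (simp add: D_def \<tau>_def drifted_bm_def r_def algebra_simps)
  have firstS: "first_below \<delta> g n i \<omega> \<longleftrightarrow> S (?V \<omega>)" if "\<omega> \<in> space M" for \<omega>
    using path[OF that] by (simp add: first_below_def S_def)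
  define h where "h p = indicator {v. S v} (fst p) * \<phi> (\<xi> i (fst p) + \<sigma> * snd p i + \<beta> * \<sigma>\<^sup>2 * r)" for p :: "(nat \<Rightarrow> real) \<times> (nat \<Rightarrow> real)"
  define b where "b v = indicator {v. S v} v * \<rho> \<bar>\<xi> i v\<bar>" for v
  have h_meas: "h \<in> borel_measurable (?N \<Otimes>\<^sub>M ?N')"
    unfolding h_def[abs_def] by measurable
  have b_meas: "b \<in> borel_measurable ?N"
    unfolding b_def[abs_def] by measurable
  have Zdist: "distr M borel (\<lambda>\<omega>. ?Z \<omega> i) = density lborel (heat r)"
  proof -
    have "distributed M lborel (\<lambda>\<omega>. W g \<omega> - W (grid g n i) \<omega>) (heat r)"
      unfolding r_def using r g by (intro W_increment grid_nonneg) (auto simp: r_def)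
    then have "distr M lborel (\<lambda>\<omega>. W g \<omega> - W (grid g n i) \<omega>) = density lborel (heat r)"
      by (rule distributed_distr_eq_density)
    moreover have "(\<lambda>\<omega>. ?Z \<omega> i) = (\<lambda>\<omega>. W g \<omega> - W (grid g n i) \<omega>)" by (simp add: D_def \<tau>_def fun_eq_iff)
    moreover have "distr M borel f = distr M lborel f" for f :: "'a \<Rightarrow> real" by (rule distr_cong) auto
    ultimately show ?thesis by simp
  qed
  have "\<bar>\<integral>\<omega>. h (?V \<omega>, ?Z \<omega>) \<partial>M\<bar> \<le> (\<integral>\<omega>. b (?V \<omega>) \<partial>M)"
  proof (rule abs_expectation_indep_le[OF ind2 h_meas _ b_meas])
    show "\<bar>h p\<bar> \<le> C" for p using abs_\<phi>_le C_nonneg by (simp add: h_def abs_mult indicator_def)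
    show "0 \<le> b v" "b v \<le> C" for v using C_nonneg \<rho>_nonneg by (auto simp: b_def indicator_def \<rho>_def)
    fix v assume v: "v \<in> space ?N"
    have [measurable]: "?Z \<in> measurable M ?N'" using ind2 by (rule indep_var_rv2)
    have "(\<integral>z. h (v, z) \<partial>distr M ?N' ?Z) = indicator {v. S v} v * (\<integral>z. \<phi> (\<xi> i v + \<sigma> * z i + \<beta> * \<sigma>\<^sup>2 * r) \<partial>distr M ?N' ?Z)"
      by (simp add: h_def)
    also have "(\<integral>z. \<phi> (\<xi> i v + \<sigma> * z i + \<beta> * \<sigma>\<^sup>2 * r) \<partial>distr M ?N' ?Z) = (\<integral>\<omega>. \<phi> (\<xi> i v + \<sigma> * ?Z \<omega> i + \<beta> * \<sigma>\<^sup>2 * r) \<partial>M)"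
      by (subst integral_distr) auto
    also have "\<dots> = (\<integral>z. \<phi> (\<xi> i v + \<sigma> * z + \<beta> * \<sigma>\<^sup>2 * r) \<partial>distr M borel (\<lambda>\<omega>. ?Z \<omega> i))"
      by (subst integral_distr) auto
    also have "\<dots> = (LBINT z. \<phi> (\<xi> i v + \<sigma> * z + \<beta> * \<sigma>\<^sup>2 * r) * heat r z)"
      unfolding Zdist by (subst integral_density) (auto simp: mult.commute)
    also have "\<bar>indicator {v. S v} v * \<dots>\<bar> \<le> b v"
      unfolding abs_mult b_def using abs_expectation_\<phi>_le[OF r] by (intro mult_mono) auto
    finally show "\<bar>\<integral>z. h (v, z) \<partial>distr M ?N' ?Z\<bar> \<le> b v" .
  qed
  moreover have "(\<integral>\<omega>. h (?V \<omega>, ?Z \<omega>) \<partial>M) = (\<integral>\<omega>. indicator {\<omega>. first_below \<delta> g n i \<omega>} \<omega> * \<phi> (X g \<omega>) \<partial>M)"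
    using last firstS by (intro Bochner_Integration.integral_cong) (auto simp: h_def indicator_def)
  moreover have "(\<integral>\<omega>. b (?V \<omega>) \<partial>M) = (\<integral>\<omega>. indicator {\<omega>. first_below \<delta> g n i \<omega>} \<omega> * \<rho> \<bar>X (grid g n i) \<omega>\<bar> \<partial>M)"
    using path firstS by (intro Bochner_Integration.integral_cong) (auto simp: b_def indicator_def)
  ultimately show ?thesis by simp
qed

end

context drifted_brownian begin

lemma sum_first_below_tendsto:
  assumes \<omega>: "\<omega> \<in> space M" and g: "g > 0"
  shows "(\<lambda>n. \<Sum>i\<le>n. indicator {\<omega>. first_below \<delta> g n i \<omega>} \<omega> * 1) \<longlonglongrightarrow> (indicator {\<omega>. below \<delta> g \<omega>} \<omega> :: real)"
proof (rule tendsto_eventually, cases "below \<delta> g \<omega>")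
  case True
  show "eventually (\<lambda>n. (\<Sum>i\<le>n. indicator {\<omega>. first_below \<delta> g n i \<omega>} \<omega> * 1) = (indicator {\<omega>. below \<delta> g \<omega>} \<omega> :: real)) sequentially"
    using below_grid[OF \<omega> g True]
  proof eventually_elim
    case (elim n)
    then obtain i where "i \<le> n" "first_below \<delta> g n i \<omega>" using ex_first_below by (meson order.trans)
    then show ?case using sum_first_below_eq[of \<delta> g n i \<omega> "\<lambda>_. 1"] True by simp
  qed
next
  case False
  have "\<not> first_below \<delta> g n i \<omega>" if "i \<le> n" for i n
    using False grid_below[OF g that] by (auto simp: first_below_def)
  then show "eventually (\<lambda>n. (\<Sum>i\<le>n. indicator {\<omega>. first_below \<delta> g n i \<omega>} \<omega> * 1) = (indicator {\<omega>. below \<delta> g \<omega>} \<omega> :: real)) sequentially"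
    using False by simp
qed

text \<open>The event is an uncountable union; it is measurable because its indicator is the
  pointwise limit of finite grid sums.\<close>

lemma below_measurable [measurable]:
  assumes g: "g > 0"
  shows "Measurable.pred M (below \<delta> g)"
proof -
  have [measurable]: "Measurable.pred M (first_below \<delta> g n i)" for n i using g by simp
  have "(indicator {\<omega>. below \<delta> g \<omega>} :: 'a \<Rightarrow> real) \<in> borel_measurable M"
    by (rule borel_measurable_LIMSEQ_metric[OF _ sum_first_below_tendsto[OF _ g]]) measurable
  then show ?thesis
    unfolding borel_measurable_indicator_iff by (simp add: pred_def Int_def conj_commute)
qed

text \<open>The levels \<open>x / (n + 1)\<close> decrease to 0 and never exceed \<open>x\<close>,
  as the barrier estimate requires.\<close>

lemma below_tendsto_hits:
  assumes \<omega>: "\<omega> \<in> space M" and g: "g > 0"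
  shows "(\<lambda>n. indicator {\<omega>. below (x / real (Suc n)) g \<omega>} \<omega>) \<longlonglongrightarrow> (indicator {\<omega>. hits g \<omega>} \<omega> :: real)"
proof (rule tendsto_eventually, cases "hits g \<omega>")
  case True
  then have "below (x / real (Suc n)) g \<omega>" for n
    using x_pos divide_pos_pos[OF x_pos, of "real (Suc n)"] unfolding hits_def below_def
    by (meson le_less_trans of_nat_0_less_iff zero_less_Suc)
  then show "eventually (\<lambda>n. (indicator {\<omega>. below (x / real (Suc n)) g \<omega>} \<omega> :: real) = indicator {\<omega>. hits g \<omega>} \<omega>) sequentially"
    using True by simp
next
  case False
  obtain e where e: "e > 0" "\<not> below e g \<omega>" using below_hits[OF \<omega> g False] by blast
  have "(\<lambda>n. x / real (Suc n)) \<longlonglongrightarrow> 0" by (rule LIMSEQ_Suc[OF lim_const_over_n])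
  from order_tendstoD(2)[OF this e(1)]
  show "eventually (\<lambda>n. (indicator {\<omega>. below (x / real (Suc n)) g \<omega>} \<omega> :: real) = indicator {\<omega>. hits g \<omega>} \<omega>) sequentially"
  proof eventually_elim
    case (elim n)
    then have "\<not> below (x / real (Suc n)) g \<omega>" using e(2) unfolding below_def by (meson less_trans)
    then show ?case using False by simp
  qed
qed

lemma hits_measurable [measurable]:
  assumes g: "g > 0"
  shows "Measurable.pred M (hits g)"
proof -
  note [measurable] = below_measurable[OF g]
  have "(indicator {\<omega>. hits g \<omega>} :: 'a \<Rightarrow> real) \<in> borel_measurable M"
    by (rule borel_measurable_LIMSEQ_metric[OF _ below_tendsto_hits[OF _ g]]) measurable
  then show ?thesis
    unfolding borel_measurable_indicator_iff by (simp add: pred_def Int_def conj_commute)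
qed

end

context test_function begin

text \<open>The one-step bounds are summed over the grid, which is then refined: at most one summand
  is active on each path, and there the path is within \<delta> of 0 once the grid is fine.\<close>

lemma abs_expectation_below_le:
  assumes g: "g > 0" and \<delta>: "0 < \<delta>" "\<delta> \<le> x"
  shows "\<bar>\<integral>\<omega>. indicator {\<omega>. below \<delta> g \<omega>} \<omega> * \<phi> (X g \<omega>) \<partial>M\<bar> \<le> \<rho> \<delta>"
proof -
  note [measurable] = below_measurable[OF g]
  have [measurable]: "X g \<in> borel_measurable M" "Measurable.pred M (first_below \<delta> g n i)"
    "X (grid g n i) \<in> borel_measurable M" for n i
    using g by (auto intro: grid_measurable first_below_measurable)
  define I where "I n i \<omega> = (indicator {\<omega>. first_below \<delta> g n i \<omega>} \<omega> :: real)" for n i \<omega>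
  have [measurable]: "I n i \<in> borel_measurable M" for n i unfolding I_def[abs_def] by measurable
  have I_sum: "0 \<le> (\<Sum>i\<le>n. I n i \<omega> * f i)" "(\<Sum>i\<le>n. I n i \<omega> * f i) \<le> c"
    if "\<And>i. 0 \<le> f i \<and> f i \<le> c" "0 \<le> c" for f c n \<omega>
  proof -
    have "0 \<le> (\<Sum>i\<le>n. I n i \<omega> * f i) \<and> (\<Sum>i\<le>n. I n i \<omega> * f i) \<le> c"
    proof (cases "\<exists>i\<le>n. first_below \<delta> g n i \<omega>")
      case True
      then obtain i where "i \<le> n" "first_below \<delta> g n i \<omega>" by blast
      then have "(\<Sum>i\<le>n. I n i \<omega> * f i) = f i" unfolding I_def by (intro sum_first_below_eq)
      then show ?thesis using that by simp
    next
      case False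
      then have "(\<Sum>i\<le>n. I n i \<omega> * f i) = 0" by (intro sum.neutral) (auto simp: I_def)
      then show ?thesis using that by simp
    qed
    then show "0 \<le> (\<Sum>i\<le>n. I n i \<omega> * f i)" "(\<Sum>i\<le>n. I n i \<omega> * f i) \<le> c" by auto
  qed
  let ?S = "\<lambda>n \<omega>. \<Sum>i\<le>n. I n i \<omega> * 1" and ?R = "\<lambda>n \<omega>. \<Sum>i\<le>n. I n i \<omega> * \<rho> \<bar>X (grid g n i) \<omega>\<bar>"
  have R: "?R n \<omega> \<le> C" for n \<omega>
    using \<rho>_nonneg C_nonneg by (intro I_sum(2)) (auto simp: \<rho>_def)
  have lim1: "(\<lambda>n. \<integral>\<omega>. ?S n \<omega> * \<phi> (X g \<omega>) \<partial>M) \<longlonglongrightarrow> (\<integral>\<omega>. indicator {\<omega>. below \<delta> g \<omega>} \<omega> * \<phi> (X g \<omega>) \<partial>M)"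
  proof (rule integral_dominated_convergence[where w="\<lambda>_. C"])
    show "AE \<omega> in M. (\<lambda>n. ?S n \<omega> * \<phi> (X g \<omega>)) \<longlonglongrightarrow> indicator {\<omega>. below \<delta> g \<omega>} \<omega> * \<phi> (X g \<omega>)"
      unfolding I_def using g by (intro AE_I2 tendsto_mult sum_first_below_tendsto tendsto_const)
    show "AE \<omega> in M. norm (?S n \<omega> * \<phi> (X g \<omega>)) \<le> C" for n
    proof (rule AE_I2)
      fix \<omega>
      have "\<bar>?S n \<omega>\<bar> \<le> 1" using I_sum[of "\<lambda>_. 1" 1 n \<omega>] by simp
      then have "\<bar>?S n \<omega>\<bar> * \<bar>\<phi> (X g \<omega>)\<bar> \<le> 1 * C" by (intro mult_mono abs_\<phi>_le) auto
      then show "norm (?S n \<omega> * \<phi> (X g \<omega>)) \<le> C" by (simp add: abs_mult)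
    qed
  qed auto
  \<comment> \<open>\<open>?R n\<close> need not converge. Its maximum with
    \<open>\<rho> \<delta>\<close> is eventually constant along each path, so dominated convergence
    applies.\<close>
  have lim2: "(\<lambda>n. \<integral>\<omega>. max (?R n \<omega>) (\<rho> \<delta>) \<partial>M) \<longlonglongrightarrow> (\<integral>\<omega>. \<rho> \<delta> \<partial>M)"
  proof (rule integral_dominated_convergence[where w="\<lambda>_. C"])
    show "AE \<omega> in M. (\<lambda>n. max (?R n \<omega>) (\<rho> \<delta>)) \<longlonglongrightarrow> \<rho> \<delta>"
    proof (rule AE_I2, rule tendsto_eventually)
      fix \<omega> assume "\<omega> \<in> space M"
      from first_below_near_zero[OF this g \<delta>]
      show "eventually (\<lambda>n. max (?R n \<omega>) (\<rho> \<delta>) = \<rho> \<delta>) sequentially"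
      proof eventually_elim
        case (elim n)
        have "?R n \<omega> \<le> \<rho> \<delta>"
        proof (cases "\<exists>i\<le>n. first_below \<delta> g n i \<omega>")
          case True
          then obtain i where i: "i \<le> n" "first_below \<delta> g n i \<omega>" by blast
          then have "?R n \<omega> = \<rho> \<bar>X (grid g n i) \<omega>\<bar>"
            unfolding I_def by (intro sum_first_below_eq)
          also have "\<dots> \<le> \<rho> \<delta>" using elim i by (intro \<rho>_mono) auto
          finally show ?thesis .
        next
          case False
          then have "?R n \<omega> = 0" by (intro sum.neutral) (auto simp: I_def)
          then show ?thesis using \<rho>_nonneg[of \<delta>] \<delta> by simp
        qed
        then show ?case by simp
      qed
    qed
    show "AE \<omega> in M. norm (max (?R n \<omega>) (\<rho> \<delta>)) \<le> C" for n
      using R \<rho>_nonneg[of \<delta>] \<delta> by (intro AE_I2) (auto simp: \<rho>_def)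
  qed auto
  have int1: "integrable M (\<lambda>\<omega>. I n i \<omega> * \<phi> (X g \<omega>))" for n i
    using abs_\<phi>_le C_nonneg by (intro integrable_const_bound[where B=C]) (auto simp: I_def indicator_def)
  have int2: "integrable M (\<lambda>\<omega>. I n i \<omega> * \<rho> \<bar>X (grid g n i) \<omega>\<bar>)" for n i
    using \<rho>_nonneg C_nonneg by (intro integrable_const_bound[where B=C]) (auto simp: I_def indicator_def \<rho>_def)
  have le: "\<bar>\<integral>\<omega>. ?S n \<omega> * \<phi> (X g \<omega>) \<partial>M\<bar> \<le> (\<integral>\<omega>. max (?R n \<omega>) (\<rho> \<delta>) \<partial>M)" if n: "n \<ge> 1" for n
  proof -
    have "(\<integral>\<omega>. ?S n \<omega> * \<phi> (X g \<omega>) \<partial>M) = (\<Sum>i\<le>n. \<integral>\<omega>. I n i \<omega> * \<phi> (X g \<omega>) \<partial>M)"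
      using int1 by (simp add: sum_distrib_right Bochner_Integration.integral_sum)
    also have "\<bar>\<dots>\<bar> \<le> (\<Sum>i\<le>n. \<bar>\<integral>\<omega>. I n i \<omega> * \<phi> (X g \<omega>) \<partial>M\<bar>)" by (rule sum_abs)
    also have "\<dots> \<le> (\<Sum>i\<le>n. \<integral>\<omega>. I n i \<omega> * \<rho> \<bar>X (grid g n i) \<omega>\<bar> \<partial>M)"
      unfolding I_def using n g by (intro sum_mono first_below_step) auto
    also have "\<dots> = (\<integral>\<omega>. ?R n \<omega> \<partial>M)"
      using int2 by (simp add: Bochner_Integration.integral_sum)
    also have "\<dots> \<le> (\<integral>\<omega>. max (?R n \<omega>) (\<rho> \<delta>) \<partial>M)"
      using int2 by (intro integral_mono integrable_max Bochner_Integration.integrable_sum) auto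
    finally show ?thesis .
  qed
  have "\<bar>\<integral>\<omega>. indicator {\<omega>. below \<delta> g \<omega>} \<omega> * \<phi> (X g \<omega>) \<partial>M\<bar> \<le> (\<integral>\<omega>. \<rho> \<delta> \<partial>M)"
    by (rule LIMSEQ_le[OF tendsto_rabs[OF lim1] lim2]) (use le in blast)
  then show ?thesis by (simp add: prob_space)
qed

text \<open>At a positive barrier only the bound \<open>\<rho> \<delta>\<close> is available; it
  vanishes as \<delta> tends to 0, since the odd average is exactly 0 at the origin.\<close>

lemma expectation_hits_eq_0:
  assumes g: "g > 0"
  shows "(\<integral>\<omega>. indicator {\<omega>. hits g \<omega>} \<omega> * \<phi> (X g \<omega>) \<partial>M) = 0"
proof -
  note [measurable] = below_measurable[OF g] hits_measurable[OF g]
  have [measurable]: "X g \<in> borel_measurable M" using g by simp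
  let ?\<delta> = "\<lambda>n. x / real (Suc n)"
  have \<delta>0: "?\<delta> \<longlonglongrightarrow> 0" by (rule LIMSEQ_Suc[OF lim_const_over_n])
  have "(\<lambda>n. \<integral>\<omega>. indicator {\<omega>. below (?\<delta> n) g \<omega>} \<omega> * \<phi> (X g \<omega>) \<partial>M) \<longlonglongrightarrow>
    (\<integral>\<omega>. indicator {\<omega>. hits g \<omega>} \<omega> * \<phi> (X g \<omega>) \<partial>M)"
  proof (rule integral_dominated_convergence[where w="\<lambda>_. C"])
    show "AE \<omega> in M. (\<lambda>n. indicator {\<omega>. below (?\<delta> n) g \<omega>} \<omega> * \<phi> (X g \<omega>)) \<longlonglongrightarrow> indicator {\<omega>. hits g \<omega>} \<omega> * \<phi> (X g \<omega>)"
      using g by (intro AE_I2 tendsto_mult below_tendsto_hits tendsto_const)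
    show "AE \<omega> in M. norm (indicator {\<omega>. below (?\<delta> n) g \<omega>} \<omega> * \<phi> (X g \<omega>)) \<le> C" for n
      using abs_\<phi>_le C_nonneg by (intro AE_I2) (simp add: indicator_def)
  qed auto
  moreover have "(\<lambda>n. \<integral>\<omega>. indicator {\<omega>. below (?\<delta> n) g \<omega>} \<omega> * \<phi> (X g \<omega>) \<partial>M) \<longlonglongrightarrow> 0"
  proof (rule Lim_null_comparison)
    have "?\<delta> n \<le> x" for n using x_pos by (simp add: field_simps)
    then show "eventually (\<lambda>n. norm (\<integral>\<omega>. indicator {\<omega>. below (?\<delta> n) g \<omega>} \<omega> * \<phi> (X g \<omega>) \<partial>M)
        \<le> exp (\<bar>\<beta>\<bar> * ?\<delta> n) * (m * ?\<delta> n)) sequentially"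
      using abs_expectation_below_le[OF g, of "?\<delta> _"] x_pos
      by (intro always_eventually allI) (auto simp: \<rho>_def intro: order.trans)
    have "(\<lambda>n. exp (\<bar>\<beta>\<bar> * ?\<delta> n) * (m * ?\<delta> n)) \<longlonglongrightarrow> exp (\<bar>\<beta>\<bar> * 0) * (m * 0)"
      by (intro tendsto_intros \<delta>0)
    then show "(\<lambda>n. exp (\<bar>\<beta>\<bar> * ?\<delta> n) * (m * ?\<delta> n)) \<longlonglongrightarrow> 0" by simp
  qed
  ultimately show ?thesis by (rule LIMSEQ_unique)
qed

lemma expectation_\<phi>:
  assumes g: "g > 0"
  shows "(\<integral>\<omega>. \<phi> (X g \<omega>) \<partial>M) = exp (- \<beta> * x - \<beta>\<^sup>2 * \<sigma>\<^sup>2 * g / 2) *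
    (LBINT z. \<theta> (x + \<sigma> * z) * heat g z)"
proof -
  have d: "distributed M lborel (\<lambda>\<omega>. W g \<omega> - W 0 \<omega>) (heat g)"
    using W_increment[of 0 g] g by simp
  have "(\<integral>\<omega>. \<phi> (X g \<omega>) \<partial>M) = (\<integral>\<omega>. \<phi> (x + \<sigma> * (W g \<omega> - W 0 \<omega>) + \<beta> * \<sigma>\<^sup>2 * g) \<partial>M)"
    by (intro Bochner_Integration.integral_cong) (auto simp: drifted_bm_def W_0)
  also have "\<dots> = (LBINT z. heat g z * \<phi> (x + \<sigma> * z + \<beta> * \<sigma>\<^sup>2 * g))"
    by (rule distributed_integral[OF d, symmetric]) auto
  also have "\<dots> = (LBINT z. exp (- \<beta> * (x + \<sigma> * z + \<beta> * \<sigma>\<^sup>2 * g)) * \<theta> (x + \<sigma> * z + \<beta> * \<sigma>\<^sup>2 * g) * heat g z)"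
    by (simp add: \<phi>_def mult.commute)
  finally show ?thesis unfolding normal_expectation_drift[OF g] .
qed

end

section \<open>Lipschitz odd approximations of interval indicators\<close>

definition tent :: "real \<Rightarrow> real \<Rightarrow> real \<Rightarrow> real \<Rightarrow> real" where
  "tent a b m l = max 0 (min 1 (min (m * (l - a)) (m * (b - l))))"

text \<open>For \<open>a \<ge> 0\<close> and nonnegative slope the two tents have disjoint supports
  up to boundary points, and on the positive half-line this is the tent itself.\<close>

definition odd_tent :: "real \<Rightarrow> real \<Rightarrow> real \<Rightarrow> real \<Rightarrow> real" where
  "odd_tent a b m l = tent a b m l - tent a b m (- l)"

lemma tent_measurable [measurable]: "tent a b m \<in> borel_measurable borel"
  unfolding tent_def by measurable

lemma odd_tent_measurable [measurable]: "odd_tent a b m \<in> borel_measurable borel"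
  unfolding odd_tent_def by measurable

lemma tent_bounds: "0 \<le> tent a b m l" "tent a b m l \<le> 1"
  by (auto simp: tent_def)

lemma abs_odd_tent_le: "\<bar>odd_tent a b m l\<bar> \<le> 1"
  using tent_bounds[of a b m l] tent_bounds[of a b m "- l"] by (auto simp: odd_tent_def)

lemma tent_eq_0:
  assumes "m \<ge> 0" "l \<notin> {a<..<b}"
  shows "tent a b m l = 0"
proof -
  have "m * (l - a) \<le> 0 \<or> m * (b - l) \<le> 0"
    using assms by (auto simp: mult_le_0_iff)
  then show ?thesis by (auto simp: tent_def)
qed

lemma odd_tent_lipschitz:
  assumes "m \<ge> 0"
  shows "\<bar>odd_tent a b m u - odd_tent a b m v\<bar> \<le> 2 * m * \<bar>u - v\<bar>"
proof -
  have aux: "\<bar>max 0 (min 1 (min p q)) - max 0 (min 1 (min p' q'))\<bar> \<le> K"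
    if "\<bar>p - p'\<bar> \<le> K" "\<bar>q - q'\<bar> \<le> K" for p q p' q' K :: real
    using that by (auto simp: max_def min_def)
  have "\<bar>tent a b m u - tent a b m v\<bar> \<le> m * \<bar>u - v\<bar>" for u v
  proof -
    have "\<bar>m * (u - a) - m * (v - a)\<bar> = m * \<bar>u - v\<bar>" "\<bar>m * (b - u) - m * (b - v)\<bar> = m * \<bar>u - v\<bar>"
      using assms by (simp_all add: abs_mult abs_minus_commute flip: right_diff_distrib)
    then show ?thesis unfolding tent_def by (intro aux) auto
  qed
  from this[of u v] this[of "- u" "- v"] show ?thesis by (simp add: odd_tent_def abs_minus_commute)
qed

lemma tent_tendsto: "(\<lambda>n. tent a b (real n) l) \<longlonglongrightarrow> indicator {a<..<b} l"
proof (cases "l \<in> {a<..<b}")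
  case True
  have "filterlim (\<lambda>n. real n * c) at_top sequentially" if "c > 0" for c
    using that by (intro filterlim_at_top_mult_tendsto_pos[OF tendsto_const _ filterlim_real_sequentially])
  then have "eventually (\<lambda>n. 1 \<le> real n * c) sequentially" if "c > 0" for c
    using that by (auto simp: filterlim_at_top)
  from this[of "l - a"] this[of "b - l"]
  have "eventually (\<lambda>n. 1 \<le> real n * (l - a)) sequentially" "eventually (\<lambda>n. 1 \<le> real n * (b - l)) sequentially"
    using True by auto
  then have "eventually (\<lambda>n. tent a b (real n) l = 1) sequentially"
    by eventually_elim (simp add: tent_def)
  then show ?thesis using True by (simp add: tendsto_eventually)
qed (simp add: tent_eq_0)

context drifted_brownian begin

lemma test_function_odd_tent:
  assumes "m \<ge> 0" "a \<ge> 0"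
  shows "test_function M W x \<sigma> \<beta> (odd_tent a b m) (2 * m) (exp (\<bar>\<beta>\<bar> * \<bar>b\<bar>))"
proof unfold_locales
  show "exp (- \<beta> * l) * \<bar>odd_tent a b m l\<bar> \<le> exp (\<bar>\<beta>\<bar> * \<bar>b\<bar>)" for l
  proof (cases "\<bar>l\<bar> \<le> \<bar>b\<bar>")
    case True
    have "- \<beta> * l \<le> \<bar>\<beta>\<bar> * \<bar>l\<bar>" using abs_ge_minus_self[of "\<beta> * l"] by (simp add: abs_mult)
    also have "\<dots> \<le> \<bar>\<beta>\<bar> * \<bar>b\<bar>" using True by (rule mult_left_mono) simp
    finally have "exp (- \<beta> * l) * \<bar>odd_tent a b m l\<bar> \<le> exp (\<bar>\<beta>\<bar> * \<bar>b\<bar>) * 1"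
      by (intro mult_mono abs_odd_tent_le) auto
    then show ?thesis by simp
  next
    case False
    then have "l \<notin> {a<..<b}" "- l \<notin> {a<..<b}" using assms(2) by auto
    then have "odd_tent a b m l = 0"
      using assms by (simp add: odd_tent_def tent_eq_0)
    then show ?thesis by simp
  qed
qed (use assms in \<open>auto simp: odd_tent_def odd_tent_lipschitz abs_odd_tent_le intro: odd_tent_lipschitz[unfolded odd_tent_def] abs_odd_tent_le[unfolded odd_tent_def]\<close>)

lemma not_hits_pos: "\<not> hits g \<omega> \<Longrightarrow> g > 0 \<Longrightarrow> X g \<omega> > 0"
  unfolding hits_def by (meson atLeastAtMost_iff less_imp_le linorder_not_le order_refl)

text \<open>Odd tents approximate the odd extension of the indicator. Its negative half is invisible
  on survival, but in the full expectation it supplies the image term after reflection.\<close>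

lemma expectation_interval:
  assumes g: "g > 0" and a: "a \<ge> 0"
  defines "s \<equiv> \<sigma>\<^sup>2 * g"
  shows "(\<integral>\<omega>. indicator {\<omega>. \<not> hits g \<omega>} \<omega> * (exp (- \<beta> * X g \<omega>) * indicator {a<..<b} (X g \<omega>)) \<partial>M)
    = (LBINT l. indicator {a<..<b} l * (exp (- \<beta> * x - \<beta>\<^sup>2 * s / 2) * image_kernel s x l))"
proof -
  note [measurable] = hits_measurable[OF g]
  have [measurable]: "X g \<in> borel_measurable M" using g by simp
  let ?K = "exp (- \<beta> * x - \<beta>\<^sup>2 * s / 2)" and ?C = "exp (\<bar>\<beta>\<bar> * \<bar>b\<bar>)"
  let ?o = "\<lambda>m l. odd_tent a b (real m) l"
  let ?n = "heat s"
  have s: "s > 0" using g sigma_pos by (simp add: s_def)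
  then have sq: "0 < sqrt s" by simp
  have eq: "(\<integral>\<omega>. indicator {\<omega>. \<not> hits g \<omega>} \<omega> * (exp (- \<beta> * X g \<omega>) * ?o m (X g \<omega>)) \<partial>M)
    = ?K * (LBINT l. ?o m l * ?n (l - x))" for m
  proof -
    interpret T: test_function M W x \<sigma> \<beta> "odd_tent a b (real m)" "2 * real m" ?C
      by (rule test_function_odd_tent) (use a in auto)
    have i: "integrable M (\<lambda>\<omega>. T.\<phi> (X g \<omega>))" "integrable M (\<lambda>\<omega>. indicator {\<omega>. hits g \<omega>} \<omega> * T.\<phi> (X g \<omega>))"
      using T.abs_\<phi>_le by (auto intro!: integrable_const_bound[where B="?C"] simp: indicator_def)
    have "(\<integral>\<omega>. indicator {\<omega>. \<not> hits g \<omega>} \<omega> * (exp (- \<beta> * X g \<omega>) * ?o m (X g \<omega>)) \<partial>M)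
      = (\<integral>\<omega>. T.\<phi> (X g \<omega>) - indicator {\<omega>. hits g \<omega>} \<omega> * T.\<phi> (X g \<omega>) \<partial>M)"
      by (intro Bochner_Integration.integral_cong) (auto simp: indicator_def T.\<phi>_def)
    also have "\<dots> = (\<integral>\<omega>. T.\<phi> (X g \<omega>) \<partial>M)"
      using i T.expectation_hits_eq_0[OF g] by simp
    also have "\<dots> = ?K * (LBINT z. ?o m (x + \<sigma> * z) * heat g z)"
      unfolding T.expectation_\<phi>[OF g] by (simp add: s_def mult_ac)
    \<comment> \<open>Change of variables \<open>l = x + \<sigma> * z\<close>, from variance
      \<open>g\<close> to variance \<open>s\<close>.\<close>
    also have "(LBINT z. ?o m (x + \<sigma> * z) * heat g z) = (LBINT l. ?o m l * ?n (l - x))"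
    proof -
      have "heat g z = \<sigma> * ?n (\<sigma> * z)" for z
        using sigma_pos g by (simp add: normal_density_def s_def power_mult_distrib real_sqrt_mult)
      then show ?thesis
        using sigma_pos by (subst lborel_integral_real_affine[of \<sigma> _ x]) (auto simp: mult_ac simp flip: integral_mult_right_zero)
    qed
    finally show ?thesis .
  qed
  have o_lim: "(\<lambda>m. ?o m l) \<longlonglongrightarrow> indicator {a<..<b} l - indicator {a<..<b} (- l)" for l
    unfolding odd_tent_def by (intro tendsto_diff tent_tendsto)
  have "(\<lambda>m. \<integral>\<omega>. indicator {\<omega>. \<not> hits g \<omega>} \<omega> * (exp (- \<beta> * X g \<omega>) * ?o m (X g \<omega>)) \<partial>M) \<longlonglongrightarrow>
    (\<integral>\<omega>. indicator {\<omega>. \<not> hits g \<omega>} \<omega> * (exp (- \<beta> * X g \<omega>) * (indicator {a<..<b} (X g \<omega>) - indicator {a<..<b} (- X g \<omega>))) \<partial>M)"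
  proof (rule integral_dominated_convergence[where w="\<lambda>_. ?C"])
    show "AE \<omega> in M. (\<lambda>m. indicator {\<omega>. \<not> hits g \<omega>} \<omega> * (exp (- \<beta> * X g \<omega>) * ?o m (X g \<omega>))) \<longlonglongrightarrow>
      indicator {\<omega>. \<not> hits g \<omega>} \<omega> * (exp (- \<beta> * X g \<omega>) * (indicator {a<..<b} (X g \<omega>) - indicator {a<..<b} (- X g \<omega>)))"
      by (intro AE_I2 tendsto_mult tendsto_const o_lim)
    show "AE \<omega> in M. norm (indicator {\<omega>. \<not> hits g \<omega>} \<omega> * (exp (- \<beta> * X g \<omega>) * ?o m (X g \<omega>))) \<le> ?C" for m
      using test_function.\<theta>_support[OF test_function_odd_tent[of "real m" a b]] a
      by (intro AE_I2) (auto simp: abs_mult indicator_def)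
  qed auto
  moreover have "(\<lambda>m. ?K * (LBINT l. ?o m l * ?n (l - x))) \<longlonglongrightarrow>
    ?K * (LBINT l. (indicator {a<..<b} l - indicator {a<..<b} (- l)) * ?n (l - x))"
  proof (intro tendsto_mult tendsto_const integral_dominated_convergence[where w="\<lambda>l. ?n (l - x)"])
    show "integrable lborel (\<lambda>l. ?n (l - x))"
      using integral_exp_mult_normal_density(1)[OF s, of 0] by simp
    show "AE l in lborel. (\<lambda>m. ?o m l * ?n (l - x)) \<longlonglongrightarrow> (indicator {a<..<b} l - indicator {a<..<b} (- l)) * ?n (l - x)"
      by (intro AE_I2 tendsto_mult tendsto_const o_lim)
    show "AE l in lborel. norm (?o m l * ?n (l - x)) \<le> ?n (l - x)" for m
      using abs_odd_tent_le by (intro AE_I2) (auto simp: abs_mult intro: mult_left_le_one_le)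
  qed auto
  ultimately have 1: "(\<integral>\<omega>. indicator {\<omega>. \<not> hits g \<omega>} \<omega> * (exp (- \<beta> * X g \<omega>) * (indicator {a<..<b} (X g \<omega>) - indicator {a<..<b} (- X g \<omega>))) \<partial>M)
    = ?K * (LBINT l. (indicator {a<..<b} l - indicator {a<..<b} (- l)) * ?n (l - x))"
    unfolding eq by (rule LIMSEQ_unique)
  have "indicator {\<omega>. \<not> hits g \<omega>} \<omega> * (exp (- \<beta> * X g \<omega>) * (indicator {a<..<b} (X g \<omega>) - indicator {a<..<b} (- X g \<omega>)))
    = indicator {\<omega>. \<not> hits g \<omega>} \<omega> * (exp (- \<beta> * X g \<omega>) * (indicator {a<..<b} (X g \<omega>) :: real))" for \<omega>
    using not_hits_pos[of g \<omega>] a g by (auto simp: indicator_def)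
  note 1 = 1[unfolded this]
  have int: "integrable lborel (\<lambda>l. indicator {a<..<b} l * ?n (l - c))" for c
    using integrable_mult_indicator[OF _ integral_exp_mult_normal_density(1)[OF s, of 0], of "{a<..<b}"] by simp
  have int2: "integrable lborel (\<lambda>l. indicator {a<..<b} (- l) * ?n (l - x))"
    using integrable_mult_indicator[OF _ integral_exp_mult_normal_density(1)[OF s, of 0], of "{-b<..<-a}" x]
    by (rule Bochner_Integration.integrable_cong[THEN iffD1, rotated 2]) (auto simp: indicator_def)
  \<comment> \<open>Reflecting \<open>l\<close> moves the mirror image from the test function to the
    density.\<close>
  have "(LBINT l. indicator {a<..<b} (- l) * ?n (l - x)) = (LBINT l. indicator {a<..<b} l * ?n (l - (- x)))"
  proof -
    have "?n (- l - x) = ?n (l - (- x))" for l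
      by (simp add: normal_density_def power2_eq_square algebra_simps)
    then show ?thesis by (subst lborel_integral_real_affine[of "-1" _ 0]) auto
  qed
  then have "(LBINT l. (indicator {a<..<b} l - indicator {a<..<b} (- l)) * ?n (l - x))
    = (LBINT l. indicator {a<..<b} l * image_kernel s x l)"
    using int[of x] int2 int[of "- x"] by (simp add: image_kernel_def left_diff_distrib right_diff_distrib)
  moreover have "(LBINT l. indicator {a<..<b} l * (?K * image_kernel s x l)) = ?K * (LBINT l. indicator {a<..<b} l * image_kernel s x l)"
    by (simp only: mult.left_commute[of _ ?K] integral_mult_right_zero)
  ultimately show ?thesis using 1 by (simp only:)
qed

end

section \<open>Laws of the drifted motion, free and killed\<close>

definition survival_density :: "real \<Rightarrow> real \<Rightarrow> real \<Rightarrow> real \<Rightarrow> real" where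
  "survival_density x \<beta> s l = indicator {0<..} l * (exp (\<beta> * (l - x) - \<beta>\<^sup>2 * s / 2) * image_kernel s x l)"

text \<open>The normal density with mean \<open>x + \<beta> * s\<close> in tilted form. It shares
  its prefactor with \<open>survival_density\<close>, so that their difference is a multiple of a
  single heat density.\<close>

definition drift_density :: "real \<Rightarrow> real \<Rightarrow> real \<Rightarrow> real \<Rightarrow> real" where
  "drift_density x \<beta> s l = exp (\<beta> * (l - x) - \<beta>\<^sup>2 * s / 2) * heat s (l - x)"

lemma survival_density_measurable [measurable (raw)]:
  assumes [measurable]: "s \<in> borel_measurable M" "l \<in> borel_measurable M"
  shows "(\<lambda>\<omega>. survival_density x \<beta> (s \<omega>) (l \<omega>)) \<in> borel_measurable M"
  unfolding survival_density_def by measurable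

lemma drift_density_measurable [measurable (raw)]:
  assumes [measurable]: "s \<in> borel_measurable M" "l \<in> borel_measurable M"
  shows "(\<lambda>\<omega>. drift_density x \<beta> (s \<omega>) (l \<omega>)) \<in> borel_measurable M"
  unfolding drift_density_def by measurable

lemma drift_density_eq:
  assumes "s > 0"
  shows "drift_density x \<beta> s l = normal_density (x + \<beta> * s) (sqrt s) l"
proof -
  have "drift_density x \<beta> s l = exp (- \<beta> * x - \<beta>\<^sup>2 * s / 2) * (exp (\<beta> * l) * heat s (l - x))"
    by (simp add: drift_density_def algebra_simps flip: exp_add)
  also have "\<dots> = normal_density (x + \<beta> * s) (sqrt s) l"
    unfolding exp_mult_normal_density[OF assms] by (simp flip: exp_add mult.assoc)
  finally show ?thesis .
qed

context drifted_brownian begin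

lemma law_of_X:
  assumes g: "g > 0" and [measurable]: "B \<in> sets borel"
  shows "emeasure M {\<omega> \<in> space M. X g \<omega> \<in> B} = (\<integral>\<^sup>+l. ennreal (drift_density x \<beta> (\<sigma>\<^sup>2 * g) l) * indicator B l \<partial>lborel)"
proof -
  have s: "\<sigma>\<^sup>2 * g > 0" using g sigma_pos by simp
  have "distributed M lborel (\<lambda>\<omega>. W g \<omega> - W 0 \<omega>) (heat g)"
    using W_increment[of 0 g] g by simp
  then have "distributed M lborel (\<lambda>\<omega>. (x + \<beta> * \<sigma>\<^sup>2 * g) + \<sigma> * (W g \<omega> - W 0 \<omega>))
      (normal_density ((x + \<beta> * \<sigma>\<^sup>2 * g) + \<sigma> * 0) (\<bar>\<sigma>\<bar> * sqrt g))"
    using sigma_pos g by (intro normal_density_affine) auto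
  moreover have "(\<lambda>l. ennreal (normal_density ((x + \<beta> * \<sigma>\<^sup>2 * g) + \<sigma> * 0) (\<bar>\<sigma>\<bar> * sqrt g) l)) = (\<lambda>l. ennreal (drift_density x \<beta> (\<sigma>\<^sup>2 * g) l))"
    unfolding drift_density_eq[OF s] using sigma_pos g by (simp add: real_sqrt_mult mult.assoc)
  ultimately have "distributed M lborel (\<lambda>\<omega>. (x + \<beta> * \<sigma>\<^sup>2 * g) + \<sigma> * (W g \<omega> - W 0 \<omega>)) (\<lambda>l. ennreal (drift_density x \<beta> (\<sigma>\<^sup>2 * g) l))"
    by simp
  from distributed_emeasure[OF this, of B]
  have "emeasure M ((\<lambda>\<omega>. (x + \<beta> * \<sigma>\<^sup>2 * g) + \<sigma> * (W g \<omega> - W 0 \<omega>)) -` B \<inter> space M) = (\<integral>\<^sup>+l. ennreal (drift_density x \<beta> (\<sigma>\<^sup>2 * g) l) * indicator B l \<partial>lborel)"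
    by simp
  also have "(\<lambda>\<omega>. (x + \<beta> * \<sigma>\<^sup>2 * g) + \<sigma> * (W g \<omega> - W 0 \<omega>)) -` B \<inter> space M = {\<omega> \<in> space M. X g \<omega> \<in> B}"
    by (auto simp: drifted_bm_def W_0 algebra_simps)
  finally show ?thesis .
qed

text \<open>Interval expectations are known only under the weight
  \<open>exp (- \<beta> * X\<^sub>g)\<close>. The weighted law is identified first, from its finite
  values on open intervals, and the weight is then removed by integrating
  \<open>exp (\<beta> * l)\<close> over \<open>B\<close>.\<close>

lemma law_of_killed_X:
  assumes g: "g > 0" and B [measurable]: "B \<in> sets borel"
  shows "emeasure M {\<omega> \<in> space M. \<not> hits g \<omega> \<and> X g \<omega> \<in> B}
    = (\<integral>\<^sup>+l. ennreal (survival_density x \<beta> (\<sigma>\<^sup>2 * g) l) * indicator B l \<partial>lborel)"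
proof -
  note [measurable] = hits_measurable[OF g]
  have Xm [measurable]: "X g \<in> borel_measurable M" using g by simp
  let ?s = "\<sigma>\<^sup>2 * g"
  have s: "?s > 0" using g sigma_pos by simp
  let ?K = "exp (- \<beta> * x - \<beta>\<^sup>2 * ?s / 2)"
  let ?u = "\<lambda>\<omega>. ennreal (indicator {\<omega>. \<not> hits g \<omega>} \<omega> * exp (- \<beta> * X g \<omega>))"
  let ?v = "\<lambda>l. ennreal (indicator {0<..} l * (?K * image_kernel ?s x l))"
  let ?\<mu> = "distr (density M ?u) borel (X g)" and ?\<nu> = "density lborel ?v"
  have interval: "emeasure ?\<mu> {a<..<b} = emeasure ?\<nu> {a<..<b} \<and> emeasure ?\<mu> {a<..<b} \<noteq> \<infinity>" for a b
  proof -
    \<comment> \<open>Survivors are positive, and the interval formula asks for a nonnegative left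
      endpoint.\<close>
    define a' where "a' = max a 0"
    let ?f = "\<lambda>\<omega>. indicator {\<omega>. \<not> hits g \<omega>} \<omega> * (exp (- \<beta> * X g \<omega>) * indicator {a'<..<b} (X g \<omega>))"
    let ?h = "\<lambda>l. indicator {a'<..<b} l * (?K * image_kernel ?s x l)"
    have "emeasure ?\<mu> {a<..<b} = (\<integral>\<^sup>+\<omega>. ?u \<omega> * indicator (X g -` {a<..<b} \<inter> space M) \<omega> \<partial>M)"
      by (subst emeasure_distr) (auto intro!: emeasure_density)
    also have "\<dots> = (\<integral>\<^sup>+\<omega>. ennreal (?f \<omega>) \<partial>M)"
      by (intro nn_integral_cong) (use not_hits_pos[of g] g in \<open>auto simp: indicator_def a'_def\<close>)
    also have "\<dots> = ennreal (\<integral>\<omega>. ?f \<omega> \<partial>M)"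
    proof (rule nn_integral_eq_integral)
      show "integrable M ?f"
      proof (rule integrable_const_bound[where B="exp (\<bar>\<beta>\<bar> * \<bar>b\<bar>)"])
        show "AE \<omega> in M. norm (?f \<omega>) \<le> exp (\<bar>\<beta>\<bar> * \<bar>b\<bar>)"
        proof (rule AE_I2)
          fix \<omega>
          have "exp (- \<beta> * X g \<omega>) \<le> exp (\<bar>\<beta>\<bar> * \<bar>b\<bar>)" if "X g \<omega> \<in> {a'<..<b}"
          proof -
            have "- \<beta> * X g \<omega> \<le> \<bar>\<beta>\<bar> * \<bar>X g \<omega>\<bar>" using abs_ge_minus_self[of "\<beta> * X g \<omega>"] by (simp add: abs_mult)
            also have "\<dots> \<le> \<bar>\<beta>\<bar> * \<bar>b\<bar>" using that by (intro mult_left_mono) (auto simp: a'_def)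
            finally show ?thesis by simp
          qed
          then show "norm (?f \<omega>) \<le> exp (\<bar>\<beta>\<bar> * \<bar>b\<bar>)" by (auto simp: indicator_def)
        qed
      qed measurable
    qed auto
    finally have \<mu>: "emeasure ?\<mu> {a<..<b} = ennreal (\<integral>\<omega>. ?f \<omega> \<partial>M)" .
    also have "(\<integral>\<omega>. ?f \<omega> \<partial>M) = (LBINT l. ?h l)"
      by (rule expectation_interval[OF g]) (simp add: a'_def)
    also have "ennreal \<dots> = (\<integral>\<^sup>+l. ennreal (?h l) \<partial>lborel)"
    proof (rule nn_integral_eq_integral[symmetric])
      have "integrable lborel (\<lambda>l. ?K * (exp (0 * l) * image_kernel ?s x l))"
        by (intro integrable_mult_right integral_exp_mult_image_kernel s)
      from integrable_mult_indicator[OF _ this, of "{a'<..<b}"] show "integrable lborel ?h" by simp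
      show "AE l in lborel. 0 \<le> ?h l"
        using image_kernel_nonneg[OF s x_pos] by (intro AE_I2) (auto simp: indicator_def a'_def)
    qed
    also have "\<dots> = (\<integral>\<^sup>+l. ?v l * indicator {a<..<b} l \<partial>lborel)"
      by (intro nn_integral_cong) (auto simp: indicator_def a'_def)
    also have "\<dots> = emeasure ?\<nu> {a<..<b}"
      by (subst emeasure_density) auto
    finally have "emeasure ?\<mu> {a<..<b} = emeasure ?\<nu> {a<..<b}" .
    moreover have "emeasure ?\<mu> {a<..<b} \<noteq> \<infinity>" unfolding \<mu> by simp
    ultimately show ?thesis by blast
  qed
  have eq: "?\<mu> = ?\<nu>"
  proof (rule measure_eqI_generator_eq[where E="range (\<lambda>(a, b). {a<..<b::real})" and \<Omega>=UNIV and A="\<lambda>n. {- real n<..<real n}"])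
    show "Int_stable (range (\<lambda>(a, b). {a<..<b::real}))"
    proof -
      have "{a<..<b} \<inter> {c<..<d} = {max a c<..<min b d}" for a b c d :: real by auto
      then show ?thesis by (auto simp: Int_stable_def)
    qed
    show "(\<Union>n. {- real n<..<real n}) = UNIV"
    proof -
      have "\<exists>n. u \<in> {- real n<..<real n}" for u
      proof -
        obtain n where "\<bar>u\<bar> < real n" using reals_Archimedean2 by blast
        then have "u \<in> {- real n<..<real n}" by auto
        then show ?thesis by blast
      qed
      then show ?thesis by blast
    qed
    show "sets ?\<mu> = sigma_sets UNIV (range (\<lambda>(a, b). {a<..<b::real}))"
      "sets ?\<nu> = sigma_sets UNIV (range (\<lambda>(a, b). {a<..<b::real}))"
      by (simp_all add: borel_eq_box box_real[abs_def])
    show "emeasure ?\<mu> {- real n<..<real n} \<noteq> \<infinity>" for n using interval by blast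
    show "emeasure ?\<mu> E = emeasure ?\<nu> E" if "E \<in> range (\<lambda>(a, b). {a<..<b})" for E
      using that interval by auto
  qed auto
  have "emeasure M {\<omega> \<in> space M. \<not> hits g \<omega> \<and> X g \<omega> \<in> B} = (\<integral>\<^sup>+\<omega>. indicator {\<omega> \<in> space M. \<not> hits g \<omega> \<and> X g \<omega> \<in> B} \<omega> \<partial>M)"
    by (subst nn_integral_indicator) measurable
  also have "\<dots> = (\<integral>\<^sup>+\<omega>. ?u \<omega> * (ennreal (exp (\<beta> * X g \<omega>)) * indicator B (X g \<omega>)) \<partial>M)"
    by (intro nn_integral_cong) (auto simp: indicator_def simp flip: ennreal_mult exp_add)
  also have "\<dots> = (\<integral>\<^sup>+l. ennreal (exp (\<beta> * l)) * indicator B l \<partial>?\<mu>)"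
    by (subst nn_integral_distr) (auto simp: nn_integral_density)
  also have "\<dots> = (\<integral>\<^sup>+l. ?v l * (ennreal (exp (\<beta> * l)) * indicator B l) \<partial>lborel)"
    unfolding eq by (subst nn_integral_density) auto
  also have "\<dots> = (\<integral>\<^sup>+l. ennreal (survival_density x \<beta> ?s l) * indicator B l \<partial>lborel)"
  proof (intro nn_integral_cong)
    fix l
    have "exp (\<beta> * (l - x) - \<beta>\<^sup>2 * ?s / 2) = ?K * exp (\<beta> * l)" by (simp add: algebra_simps flip: exp_add)
    then have "survival_density x \<beta> ?s l = indicator {0<..} l * (?K * image_kernel ?s x l) * exp (\<beta> * l)"
      by (simp only: survival_density_def mult_ac)
    moreover have "0 \<le> indicator {0<..} l * (?K * image_kernel ?s x l)"
      using image_kernel_nonneg[OF s x_pos, of l] by (auto simp: indicator_def)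
    ultimately have "ennreal (survival_density x \<beta> ?s l) = ?v l * ennreal (exp (\<beta> * l))"
      by (simp only: ennreal_mult exp_ge_zero)
    then show "?v l * (ennreal (exp (\<beta> * l)) * indicator B l) = ennreal (survival_density x \<beta> ?s l) * indicator B l"
      by (simp only: mult.assoc)
  qed
  finally show ?thesis .
qed

end

section \<open>Mixing over the time change\<close>

text \<open>Approximates \<open>s\<close> from below on a grid of rational times, so that a path at
  a variable time is read from countably many coordinates.\<close>

definition floor_time :: "nat \<Rightarrow> real \<Rightarrow> real" where
  "floor_time n s = real (nat \<lfloor>s * real (Suc n)\<rfloor>) / real (Suc n)"

lemma floor_time_bounds:
  assumes "s \<ge> 0"
  shows "0 \<le> floor_time n s" "floor_time n s \<le> s" "s \<le> floor_time n s + 1 / real (Suc n)"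
proof -
  have q: "0 \<le> s * real (Suc n)" using assms by simp
  then have "real (nat \<lfloor>s * real (Suc n)\<rfloor>) \<le> s * real (Suc n)" "s * real (Suc n) \<le> real (nat \<lfloor>s * real (Suc n)\<rfloor>) + 1"
    by linarith+
  then show "floor_time n s \<le> s" "s \<le> floor_time n s + 1 / real (Suc n)"
    by (simp_all add: floor_time_def field_simps)
qed (simp add: floor_time_def)

lemma floor_time_tendsto:
  assumes "s \<ge> 0"
  shows "(\<lambda>n. floor_time n s) \<longlonglongrightarrow> s"
proof (rule real_tendsto_sandwich)
  show "eventually (\<lambda>n. s - 1 / real (Suc n) \<le> floor_time n s) sequentially"
    using floor_time_bounds(3)[OF assms] by (simp add: algebra_simps)
  show "eventually (\<lambda>n. floor_time n s \<le> s) sequentially" using floor_time_bounds(2)[OF assms] by simp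
  have "(\<lambda>n. s - 1 / real (Suc n)) \<longlonglongrightarrow> s - 0"
    by (intro tendsto_diff tendsto_const LIMSEQ_Suc[OF lim_const_over_n])
  then show "(\<lambda>n. s - 1 / real (Suc n)) \<longlonglongrightarrow> s" by simp
qed simp

lemma tendsto_floor_time:
  assumes "continuous_on {0..} f" "s \<ge> 0"
  shows "(\<lambda>n. f (floor_time n s)) \<longlonglongrightarrow> f s"
  by (rule continuous_on_tendsto_compose[OF assms(1) floor_time_tendsto[OF assms(2)]])
    (use assms(2) floor_time_bounds(1)[OF assms(2)] in auto)

text \<open>A set in the product sigma-algebra depends on countably many coordinates only, so plain
  evaluation at a variable time is not jointly measurable. This limit is, and it agrees with
  evaluation on continuous paths.\<close>

definition path_value :: "(real \<Rightarrow> real) \<Rightarrow> real \<Rightarrow> real" where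
  "path_value w s = lim (\<lambda>n. w (floor_time n s))"

abbreviation path_space :: "(real \<Rightarrow> real) measure" where
  "path_space \<equiv> PiM {0..} (\<lambda>_. borel)"

lemma path_value_measurable [measurable]:
  "(\<lambda>p. path_value (fst p) (snd p)) \<in> borel_measurable (path_space \<Otimes>\<^sub>M borel)"
proof -
  have "(\<lambda>p. fst p (floor_time n (snd p))) \<in> borel_measurable (path_space \<Otimes>\<^sub>M (borel :: real measure))" for n
  proof -
    have [measurable]: "(\<lambda>w. w (real i / real (Suc n))) \<in> borel_measurable path_space" for i
      by (rule measurable_component_singleton) simp
    have "(\<lambda>p. fst p (real i / real (Suc n))) \<in> borel_measurable (path_space \<Otimes>\<^sub>M (borel :: real measure))" for i
      by measurable
    moreover have "(\<lambda>p. nat \<lfloor>snd p * real (Suc n)\<rfloor>) \<in> measurable (path_space \<Otimes>\<^sub>M borel) (count_space UNIV)"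
      by measurable
    ultimately show ?thesis unfolding floor_time_def by (rule measurable_compose_countable)
  qed
  then show ?thesis unfolding path_value_def by (rule borel_measurable_lim_metric)
qed

context drifted_brownian begin

abbreviation W_path :: "'a \<Rightarrow> real \<Rightarrow> real" where
  "W_path \<omega> \<equiv> restrict (\<lambda>t. W t \<omega>) {0..}"

lemma path_value_W:
  assumes "\<omega> \<in> space M" "s \<ge> 0"
  shows "path_value (W_path \<omega>) s = W s \<omega>"
proof -
  have "(\<lambda>n. W_path \<omega> (floor_time n s)) \<longlonglongrightarrow> W s \<omega>"
    using tendsto_floor_time[OF W_continuous[OF assms(1)] assms(2)] floor_time_bounds(1)[OF assms(2)] by simp
  then show ?thesis unfolding path_value_def by (rule limI)
qed

text \<open>
  On continuous paths this is survival up to time \<open>g\<close>. Only countably many coordinates occur, which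
  makes the event measurable on the path space, jointly with \<open>g\<close>.
\<close>

definition path_survives :: "(real \<Rightarrow> real) \<Rightarrow> real \<Rightarrow> bool" where
  "path_survives w g \<longleftrightarrow> (\<exists>m::nat. \<forall>n i::nat. real i / real (Suc n) \<le> g \<longrightarrow>
     1 / real (Suc m) \<le> x + \<sigma> * w (real i / real (Suc n)) + \<beta> * \<sigma>\<^sup>2 * (real i / real (Suc n)))"

lemma path_survives_measurable [measurable]:
  "Measurable.pred (path_space \<Otimes>\<^sub>M borel) (\<lambda>p. path_survives (fst p) (snd p))"
proof -
  have [measurable]: "(\<lambda>w. w (real i / real (Suc n))) \<in> borel_measurable path_space" for n i
    by (rule measurable_component_singleton) simp
  show ?thesis unfolding path_survives_def by measurable
qed

text \<open>Strict positivity at rational times would not survive the limit; the uniform margin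
  \<open>1 / Suc m\<close> does. Conversely the positive minimum of a surviving path provides the
  margin.\<close>

lemma path_survives_W:
  assumes \<omega>: "\<omega> \<in> space M" and g: "g > 0"
  shows "path_survives (W_path \<omega>) g \<longleftrightarrow> \<not> hits g \<omega>"
proof -
  have eq: "path_survives (W_path \<omega>) g \<longleftrightarrow>
    (\<exists>m::nat. \<forall>n i. real i / real (Suc n) \<le> g \<longrightarrow> 1 / real (Suc m) \<le> X (real i / real (Suc n)) \<omega>)"
    by (simp add: path_survives_def drifted_bm_def)
  show ?thesis
  proof
    assume "path_survives (W_path \<omega>) g"
    then obtain m where m: "\<And>n i. real i / real (Suc n) \<le> g \<Longrightarrow> 1 / real (Suc m) \<le> X (real i / real (Suc n)) \<omega>"
      unfolding eq by blast
    have "X s \<omega> > 0" if s: "s \<in> {0..g}" for s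
    proof -
      have "1 / real (Suc m) \<le> X (floor_time n s) \<omega>" for n
      proof -
        have "floor_time n s \<le> g" using floor_time_bounds(2)[of s n] s by simp
        then show ?thesis unfolding floor_time_def by (rule m)
      qed
      then have "1 / real (Suc m) \<le> X s \<omega>"
        using tendsto_floor_time[OF X_continuous[OF \<omega>], of s] s by (intro LIMSEQ_le_const) auto
      then show ?thesis by (meson less_le_trans of_nat_0_less_iff zero_less_Suc zero_less_divide_1_iff)
    qed
    then show "\<not> hits g \<omega>" by (auto simp: hits_def not_le)
  next
    assume "\<not> hits g \<omega>"
    then obtain e where e: "e > 0" "\<not> below e g \<omega>" using below_hits[OF \<omega> g] by blast
    obtain m where m: "1 / real (Suc m) < e" using e(1) reals_Archimedean[of e] by (auto simp: inverse_eq_divide)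
    have "1 / real (Suc m) \<le> X (real i / real (Suc n)) \<omega>" if "real i / real (Suc n) \<le> g" for n i
    proof -
      have "real i / real (Suc n) \<in> {0..g}" using that by simp
      then have "e \<le> X (real i / real (Suc n)) \<omega>" using e(2) unfolding below_def by (meson not_le)
      then show ?thesis using m by simp
    qed
    then show "path_survives (W_path \<omega>) g" unfolding eq by blast
  qed
qed

text \<open>The infimum of the hitting set could be \<open>g\<close> without a hit by time
  \<open>g\<close> only if hits accumulated at \<open>g\<close> from the right; continuity at
  \<open>g\<close> rules this out.\<close>

lemma first_passage_le_iff:
  assumes \<omega>: "\<omega> \<in> space M" and g: "g > 0"
  shows "first_passage X \<omega> \<le> ereal g \<longleftrightarrow> hits g \<omega>"
proof
  assume "hits g \<omega>"
  then obtain s where "0 \<le> s" "s \<le> g" "X s \<omega> \<le> 0" by (auto simp: hits_def)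
  then have "first_passage X \<omega> \<le> ereal s" unfolding first_passage_def by (intro Inf_lower) auto
  also have "\<dots> \<le> ereal g" using \<open>s \<le> g\<close> by simp
  finally show "first_passage X \<omega> \<le> ereal g" .
next
  assume le: "first_passage X \<omega> \<le> ereal g"
  show "hits g \<omega>"
  proof (rule ccontr)
    assume nh: "\<not> hits g \<omega>"
    have pos: "X g \<omega> > 0" using not_hits_pos[OF nh g] .
    have "\<exists>d>0. \<forall>u\<in>{0..}. dist u g < d \<longrightarrow> dist (X u \<omega>) (X g \<omega>) < X g \<omega>"
      using X_continuous[OF \<omega>] g pos unfolding continuous_on_iff by auto
    then obtain d where d: "d > 0" "\<And>u. u \<ge> 0 \<Longrightarrow> dist u g < d \<Longrightarrow> dist (X u \<omega>) (X g \<omega>) < X g \<omega>" by auto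
    have "ereal (g + d) \<le> first_passage X \<omega>"
      unfolding first_passage_def
    proof (rule Inf_greatest, clarsimp)
      fix s assume s: "0 \<le> s" "X s \<omega> \<le> 0"
      show "g + d \<le> s"
      proof (rule ccontr)
        assume "\<not> g + d \<le> s"
        moreover have "s > g" using nh s by (force simp: hits_def)
        ultimately have "dist (X s \<omega>) (X g \<omega>) < X g \<omega>" using d(2)[of s] s by (simp add: dist_real_def)
        then show False using s by (simp add: dist_real_def)
      qed
    qed
    also note le
    finally show False using d(1) by simp
  qed
qed

end

section \<open>The time change and passage times of the second kind\<close>

locale time_changed_brownian = drifted_brownian M W x \<sigma> \<beta> for M :: "'a measure" and W x \<sigma> \<beta> +
  fixes G :: "real \<Rightarrow> 'a \<Rightarrow> real" and t :: real
  assumes time_change: "time_change M G" and indep: "independent_processes M W G" and t_pos: "t > 0"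
begin

lemma G_measurable [measurable]: "G t \<in> borel_measurable M"
  using time_change t_pos by (auto simp: time_change_def)

lemma G_mono: "\<omega> \<in> space M \<Longrightarrow> 0 \<le> u \<Longrightarrow> u < v \<Longrightarrow> G u \<omega> < G v \<omega>"
  using time_change unfolding time_change_def strict_mono_on_def by (meson atLeast_iff less_imp_le order_trans)

lemma G_pos: "\<omega> \<in> space M \<Longrightarrow> u > 0 \<Longrightarrow> G u \<omega> > 0"
  using G_mono[of \<omega> 0 u] time_change by (simp add: time_change_def)

abbreviation hitting_time :: "'a \<Rightarrow> ereal" where
  "hitting_time \<equiv> first_passage2 X G"

text \<open>Right-continuity of \<open>G\<close> is the point: if \<open>G\<^sub>t\<close> is below
  the first passage time, \<open>G\<close> stays below it for a while after \<open>t\<close>, so the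
  infimum exceeds \<open>t\<close> strictly.\<close>

lemma first_passage2_le_iff:
  assumes \<omega>: "\<omega> \<in> space M"
  shows "hitting_time \<omega> \<le> ereal t \<longleftrightarrow> hits (G t \<omega>) \<omega>"
proof -
  have "hitting_time \<omega> \<le> ereal t \<longleftrightarrow> first_passage X \<omega> \<le> ereal (G t \<omega>)"
  proof
    assume "first_passage X \<omega> \<le> ereal (G t \<omega>)"
    then show "hitting_time \<omega> \<le> ereal t"
      unfolding first_passage2_def using t_pos by (intro Inf_lower) auto
  next
    assume le: "hitting_time \<omega> \<le> ereal t"
    show "first_passage X \<omega> \<le> ereal (G t \<omega>)"
    proof (rule ccontr)
      assume "\<not> ?thesis"
      \<comment> \<open>A real number in between, also when the first passage time is
        infinite.\<close>
      then obtain c where c: "ereal (G t \<omega>) < ereal c" "ereal c < first_passage X \<omega>"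
        using ereal_dense2[of "ereal (G t \<omega>)" "first_passage X \<omega>"] by (auto simp: not_le)
      have "((\<lambda>u. G u \<omega>) \<longlongrightarrow> G t \<omega>) (at_right t)"
        using time_change t_pos \<omega> by (auto simp: time_change_def cadlag_def continuous_within)
      then have "eventually (\<lambda>u. G u \<omega> < c) (at_right t)" using c(1) by (intro order_tendstoD(2)) auto
      then obtain d where d: "d > t" "\<And>u. t < u \<Longrightarrow> u < d \<Longrightarrow> G u \<omega> < c"
        unfolding eventually_at_right_field by blast
      have "ereal d \<le> hitting_time \<omega>"
        unfolding first_passage2_def
      proof (rule Inf_greatest, clarsimp)
        fix u assume u: "0 \<le> u" "first_passage X \<omega> \<le> ereal (G u \<omega>)"
        then have "c < G u \<omega>" using c(2) by (metis ereal_less(2) less_ereal.simps(1) order_less_le_trans)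
        show "d \<le> u"
        proof (rule ccontr)
          assume "\<not> d \<le> u"
          with d(2)[of u] \<open>c < G u \<omega>\<close> have "u \<le> t" by force
          then have "G u \<omega> \<le> G t \<omega>" using G_mono[OF \<omega> u(1), of t] by (cases "u = t") auto
          then show False using \<open>c < G u \<omega>\<close> c(1) by simp
        qed
      qed
      also note le
      finally show False using d(1) by simp
    qed
  qed
  then show ?thesis using first_passage_le_iff[OF \<omega> G_pos[OF \<omega> t_pos]] by simp
qed

text \<open>Fubini on the product of the two path laws. \<open>F\<close> is a jointly measurable
  version of the event on path space and has to agree with \<open>E\<close> only along Brownian
  paths and at positive times.\<close>

lemma mixture_event:
  fixes F :: "(real \<Rightarrow> real) \<Rightarrow> real \<Rightarrow> bool" and E :: "real \<Rightarrow> 'a \<Rightarrow> bool"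
  assumes F [measurable]: "Measurable.pred (path_space \<Otimes>\<^sub>M borel) (\<lambda>p. F (fst p) (snd p))"
    and FE: "\<And>\<omega> g. \<omega> \<in> space M \<Longrightarrow> g > 0 \<Longrightarrow> F (W_path \<omega>) g \<longleftrightarrow> E g \<omega>"
    and k: "\<And>g. g > 0 \<Longrightarrow> emeasure M {\<omega> \<in> space M. E g \<omega>} = k g"
  shows "{\<omega> \<in> space M. E (G t \<omega>) \<omega>} \<in> sets M"
    and "emeasure M {\<omega> \<in> space M. E (G t \<omega>) \<omega>} = (\<integral>\<^sup>+\<omega>. k (G t \<omega>) \<partial>M)"
proof -
  let ?Z = "\<lambda>\<omega>. restrict (\<lambda>t. G t \<omega>) {0..}"
  have ind: "indep_var path_space W_path path_space ?Z"
    using indep unfolding independent_processes_def .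
  have V [measurable]: "W_path \<in> measurable M path_space" and Z [measurable]: "?Z \<in> measurable M path_space"
    using ind by (auto dest: indep_var_rv1 indep_var_rv2)
  interpret V: prob_space "distr M path_space W_path" by (rule prob_space_distr) measurable
  interpret Z: prob_space "distr M path_space ?Z" by (rule prob_space_distr) measurable
  interpret P: pair_prob_space "distr M path_space W_path" "distr M path_space ?Z" ..
  have [measurable]: "(\<lambda>w. w t) \<in> borel_measurable path_space"
    by (rule measurable_component_singleton) (use t_pos in simp)
  have Zt: "?Z \<omega> t = G t \<omega>" for \<omega> using t_pos by simp
  have iff: "E (G t \<omega>) \<omega> \<longleftrightarrow> F (W_path \<omega>) (G t \<omega>)" if "\<omega> \<in> space M" for \<omega>
    using FE[OF that G_pos[OF that t_pos]] by simp
  have mF: "(\<lambda>p. indicator {p. F (fst p) (snd p t)} p :: ennreal) \<in> borel_measurable (path_space \<Otimes>\<^sub>M path_space)"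
  proof -
    have "(\<lambda>p. (fst p, snd p t)) \<in> measurable (path_space \<Otimes>\<^sub>M path_space) (path_space \<Otimes>\<^sub>M borel)" by measurable
    from measurable_compose[OF this F] show ?thesis by simp
  qed
  have pair: "(\<lambda>\<omega>. (W_path \<omega>, ?Z \<omega>)) \<in> measurable M (path_space \<Otimes>\<^sub>M path_space)" by measurable
  have set_eq: "{\<omega> \<in> space M. E (G t \<omega>) \<omega>} = {\<omega> \<in> space M. F (W_path \<omega>) (G t \<omega>)}" using iff by auto
  have "(\<lambda>\<omega>. (W_path \<omega>, G t \<omega>)) \<in> measurable M (path_space \<Otimes>\<^sub>M borel)" by measurable
  from measurable_compose[OF this F] have mE: "Measurable.pred M (\<lambda>\<omega>. F (W_path \<omega>) (G t \<omega>))" by simp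
  then show sets: "{\<omega> \<in> space M. E (G t \<omega>) \<omega>} \<in> sets M" unfolding set_eq by measurable
  have "emeasure M {\<omega> \<in> space M. E (G t \<omega>) \<omega>} = (\<integral>\<^sup>+\<omega>. indicator {\<omega> \<in> space M. E (G t \<omega>) \<omega>} \<omega> \<partial>M)"
    using sets by (rule nn_integral_indicator[symmetric])
  also have "\<dots> = (\<integral>\<^sup>+\<omega>. indicator {p. F (fst p) (snd p t)} (W_path \<omega>, ?Z \<omega>) \<partial>M)"
    by (intro nn_integral_cong) (use iff t_pos in \<open>auto simp: indicator_def\<close>)
  also have "\<dots> = (\<integral>\<^sup>+p. indicator {p. F (fst p) (snd p t)} p \<partial>distr M (path_space \<Otimes>\<^sub>M path_space) (\<lambda>\<omega>. (W_path \<omega>, ?Z \<omega>)))"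
    by (rule nn_integral_distr[OF pair, symmetric]) (use mF in simp)
  also have "distr M (path_space \<Otimes>\<^sub>M path_space) (\<lambda>\<omega>. (W_path \<omega>, ?Z \<omega>)) = distr M path_space W_path \<Otimes>\<^sub>M distr M path_space ?Z"
    by (rule indep_var_distribution_eq[THEN iffD1, OF ind, THEN conjunct2, THEN conjunct2, symmetric])
  also have "(\<integral>\<^sup>+p. indicator {p. F (fst p) (snd p t)} p \<partial>(distr M path_space W_path \<Otimes>\<^sub>M distr M path_space ?Z))
    = (\<integral>\<^sup>+z. (\<integral>\<^sup>+w. indicator {p. F (fst p) (snd p t)} (w, z) \<partial>distr M path_space W_path) \<partial>distr M path_space ?Z)"
    by (rule P.nn_integral_snd[symmetric]) (use mF in simp)
  also have "\<dots> = (\<integral>\<^sup>+\<omega>. (\<integral>\<^sup>+w. indicator {p. F (fst p) (snd p t)} (w, ?Z \<omega>) \<partial>distr M path_space W_path) \<partial>M)"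
  proof (rule nn_integral_distr[OF Z])
    have [measurable]: "(\<lambda>p. indicator {p. F (fst p) (snd p t)} p :: ennreal) \<in> borel_measurable (distr M path_space W_path \<Otimes>\<^sub>M path_space)"
      using mF by (simp cong: measurable_cong_sets)
    show "(\<lambda>z. \<integral>\<^sup>+w. indicator {p. F (fst p) (snd p t)} (w, z) \<partial>distr M path_space W_path) \<in> borel_measurable (distr M path_space ?Z)"
      by measurable
  qed
  also have "\<dots> = (\<integral>\<^sup>+\<omega>. k (G t \<omega>) \<partial>M)"
  proof (rule nn_integral_cong)
    fix \<omega> assume \<omega>: "\<omega> \<in> space M"
    have g: "G t \<omega> > 0" using \<omega> t_pos by (rule G_pos)
    have m1: "Measurable.pred path_space (\<lambda>w. F w (G t \<omega>))"
    proof -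
      have "(\<lambda>w. (w, G t \<omega>)) \<in> measurable path_space (path_space \<Otimes>\<^sub>M borel)" by measurable
      from measurable_compose[OF this F] show ?thesis by simp
    qed
    have "(\<integral>\<^sup>+w. indicator {p. F (fst p) (snd p t)} (w, ?Z \<omega>) \<partial>distr M path_space W_path)
      = (\<integral>\<^sup>+w. indicator {w. F w (G t \<omega>)} w \<partial>distr M path_space W_path)"
      using t_pos by (intro nn_integral_cong) (simp add: indicator_def)
    also have "\<dots> = (\<integral>\<^sup>+\<omega>'. indicator {w. F w (G t \<omega>)} (W_path \<omega>') \<partial>M)"
      by (rule nn_integral_distr[OF V]) (use m1 in measurable)
    also have "\<dots> = (\<integral>\<^sup>+\<omega>'. indicator {\<omega>' \<in> space M. E (G t \<omega>) \<omega>'} \<omega>' \<partial>M)"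
      by (intro nn_integral_cong) (use FE g in \<open>auto simp: indicator_def\<close>)
    also have "\<dots> = emeasure M {\<omega>' \<in> space M. E (G t \<omega>) \<omega>'}"
    proof (rule nn_integral_indicator)
      have "{\<omega>' \<in> space M. E (G t \<omega>) \<omega>'} = {\<omega>' \<in> space M. F (W_path \<omega>') (G t \<omega>)}" using FE g by auto
      moreover have "Measurable.pred M (\<lambda>\<omega>'. F (W_path \<omega>') (G t \<omega>))"
        using measurable_compose[OF V m1] by simp
      ultimately show "{\<omega>' \<in> space M. E (G t \<omega>) \<omega>'} \<in> sets M" by (simp add: pred_def)
    qed
    also have "\<dots> = k (G t \<omega>)" using k[OF g] .
    finally show "(\<integral>\<^sup>+w. indicator {p. F (fst p) (snd p t)} (w, ?Z \<omega>) \<partial>distr M path_space W_path) = k (G t \<omega>)" .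
  qed
  finally show "emeasure M {\<omega> \<in> space M. E (G t \<omega>) \<omega>} = (\<integral>\<^sup>+\<omega>. k (G t \<omega>) \<partial>M)" .
qed

end

section \<open>Densities and transforms of the time-changed process\<close>

text \<open>Used with \<open>c = x\<close>, the one point where the line integral may fail to
  converge.\<close>

lemma is_delta_density_cong:
  assumes "is_delta_density M A Y f" and "\<And>l. l \<noteq> c \<Longrightarrow> g l = f l"
  shows "is_delta_density M A Y g"
proof -
  have [measurable]: "f \<in> borel_measurable lborel" using assms(1) by (auto simp: is_delta_density_def)
  have g: "g = (\<lambda>l. if l = c then g c else f l)" using assms(2) by auto
  have [measurable]: "g \<in> borel_measurable lborel" by (subst g) measurable
  have ae: "AE l in lborel. g l = f l"
    using AE_lborel_singleton[of c] by eventually_elim (auto simp: assms(2))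
  have "integrable lborel g"
    using assms(1) ae by (subst integrable_cong_AE[of g lborel f]) (auto simp: is_delta_density_def)
  moreover have "(LINT l:B|lborel. g l) = (LINT l:B|lborel. f l)" if [measurable]: "B \<in> sets borel" for B
    unfolding set_lebesgue_integral_def
  proof (rule integral_cong_AE)
    show "AE l in lborel. indicator B l *\<^sub>R g l = indicator B l *\<^sub>R f l" using ae by eventually_elim simp
  qed measurable
  ultimately show ?thesis using assms(1) by (simp add: is_delta_density_def)
qed

text \<open>Yields the law on the hitting event as the unrestricted law minus that of the
  survivors.\<close>

lemma is_delta_density_compl:
  assumes M: "prob_space M" and T: "is_delta_density M (\<lambda>_. True) Y f" and A: "is_delta_density M A Y g"
  shows "is_delta_density M (\<lambda>\<omega>. \<not> A \<omega>) Y (\<lambda>l. f l - g l)"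
  unfolding is_delta_density_def
proof (intro conjI ballI)
  interpret prob_space M by fact
  have fi: "integrable lborel f" and gi: "integrable lborel g" using T A by (auto simp: is_delta_density_def)
  then show "integrable lborel (\<lambda>l. f l - g l)" by simp
  fix B :: "real set" assume B: "B \<in> sets borel"
  let ?T = "{\<omega> \<in> space M. True \<and> Y \<omega> \<in> B}" and ?A = "{\<omega> \<in> space M. A \<omega> \<and> Y \<omega> \<in> B}"
  have s: "?T \<in> sets M" "?A \<in> sets M" and
    m: "complex_of_real (measure M ?T) = (LINT l:B|lborel. f l)" "complex_of_real (measure M ?A) = (LINT l:B|lborel. g l)"
    using T A B by (auto simp: is_delta_density_def)
  have eq: "{\<omega> \<in> space M. \<not> A \<omega> \<and> Y \<omega> \<in> B} = ?T - ?A" by auto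
  then show "{\<omega> \<in> space M. \<not> A \<omega> \<and> Y \<omega> \<in> B} \<in> sets M" using s by auto
  have "measure M (?T - ?A) = measure M ?T - measure M ?A" using s by (intro finite_measure_Diff) auto
  moreover have "set_integrable lborel B f" "set_integrable lborel B g"
    unfolding set_integrable_def using fi gi B by (auto intro!: integrable_mult_indicator)
  ultimately show "complex_of_real (measure M {\<omega> \<in> space M. \<not> A \<omega> \<and> Y \<omega> \<in> B}) = (LINT l:B|lborel. f l - g l)"
    unfolding eq using m by (simp add: set_integral_diff)
qed

lemma drift_density_nonneg: "0 \<le> drift_density x \<beta> s l"
  by (simp add: drift_density_def)

lemma survival_density_nonneg:
  assumes "s > 0" "x > 0"
  shows "0 \<le> survival_density x \<beta> s l"
  using image_kernel_nonneg[OF assms, of l] by (simp add: survival_density_def indicator_def)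

lemma survival_density_le:
  assumes "s > 0"
  shows "survival_density x \<beta> s l \<le> drift_density x \<beta> s l"
  by (simp add: survival_density_def drift_density_def image_kernel_def indicator_def)

text \<open>For \<open>l > 0\<close> the image term is left; for \<open>l \<le> 0\<close> nothing
  was subtracted and \<open>l\<close> lies at distance \<open>x + \<bar>l\<bar>\<close> from
  \<open>x\<close>. This is where the absolute value in the hitting formula comes from.\<close>

lemma drift_density_diff_survival_density:
  "drift_density x \<beta> s l - survival_density x \<beta> s l = exp (\<beta> * (l - x) - \<beta>\<^sup>2 * s / 2) * heat s (x + \<bar>l\<bar>)"
proof -
  have "heat s (l - x) = heat s (x - l)"
    by (simp add: normal_density_def power2_commute)
  then show ?thesis
    by (simp add: survival_density_def drift_density_def image_kernel_def indicator_def algebra_simps)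
qed

text \<open>A bound free of \<open>s\<close>: with \<open>u = c\<^sup>2 / (2 * s)\<close> the factor
  \<open>exp (- u)\<close> beats the singularity \<open>1 / sqrt s\<close>. Mixtures at a nonzero
  point are therefore finite even when \<open>1 / sqrt s\<close> has no mean.\<close>

lemma normal_density_bound:
  assumes "c \<noteq> 0" "s > 0"
  shows "heat s c \<le> 1 / (2 * \<bar>c\<bar> * sqrt pi)"
proof -
  define u where "u = c\<^sup>2 / (2 * s)"
  have u: "u > 0" using assms by (simp add: u_def)
  have "2 * sqrt u \<le> 1 + u" using sum_squares_bound[of 1 "sqrt u"] u by simp
  also have "\<dots> \<le> exp u" by (rule exp_ge_add_one_self)
  finally have "1 / exp u \<le> 1 / (2 * sqrt u)" using u by (intro divide_left_mono) auto
  then have "exp (- u) / sqrt (2 * pi * s) \<le> 1 / (2 * sqrt u) / sqrt (2 * pi * s)"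
    using assms by (intro divide_right_mono) (auto simp: exp_minus inverse_eq_divide)
  also have "\<dots> = 1 / (2 * \<bar>c\<bar> * sqrt pi)"
    using assms by (simp add: u_def real_sqrt_divide real_sqrt_mult)
  finally show ?thesis using assms by (simp add: normal_density_def u_def)
qed

section \<open>Line integrals mixed over the law of the clock\<close>

context time_changed_brownian begin

definition N :: "real measure" where "N = distr M borel (\<lambda>\<omega>. \<sigma>\<^sup>2 * G t \<omega>)"

lemma sets_N [measurable_cong, simp]: "sets N = sets borel"
  by (simp add: N_def)

lemma prob_space_N: "prob_space N"
  unfolding N_def by (rule prob_space_distr) measurable

sublocale N: prob_space N by (rule prob_space_N)

sublocale NL: pair_sigma_finite N lborel ..

lemma AE_N_pos: "AE s in N. s > 0"
proof -
  have "AE \<omega> in M. \<sigma>\<^sup>2 * G t \<omega> > 0" using G_pos[OF _ t_pos] sigma_pos by (intro AE_I2) auto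
  then show ?thesis unfolding N_def by (subst AE_distr_iff) auto
qed

lemma nn_integral_N: "f \<in> borel_measurable borel \<Longrightarrow> (\<integral>\<^sup>+s. f s \<partial>N) = (\<integral>\<^sup>+\<omega>. f (\<sigma>\<^sup>2 * G t \<omega>) \<partial>M)"
  unfolding N_def by (subst nn_integral_distr) auto

abbreviation E\<psi> :: "complex \<Rightarrow> complex" where
  "E\<psi> z \<equiv> exp_minus_psi M G (complex_of_real (\<sigma>\<^sup>2) * (z\<^sup>2 + complex_of_real (\<beta>\<^sup>2)) / 2) t"

abbreviation survival_integrand :: "real \<Rightarrow> complex \<Rightarrow> complex" where
  "survival_integrand l \<equiv> \<lambda>z. (exp (\<i> * z * (complex_of_real l - complex_of_real x))
      - exp (\<i> * z * (complex_of_real l + complex_of_real x))) * E\<psi> z"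

abbreviation hit_integrand :: "real \<Rightarrow> complex \<Rightarrow> complex" where
  "hit_integrand l \<equiv> \<lambda>z. exp (\<i> * z * (complex_of_real x + complex_of_real \<bar>l\<bar>)) * E\<psi> z"

abbreviation sine_integrand :: "complex \<Rightarrow> complex" where
  "sine_integrand \<equiv> \<lambda>z. z * sin (z * complex_of_real x) / (z\<^sup>2 + complex_of_real (\<beta>\<^sup>2)) * E\<psi> z"

abbreviation resolvent_integrand :: "complex \<Rightarrow> complex \<Rightarrow> complex" where
  "resolvent_integrand k \<equiv> \<lambda>z. (\<i> / (k - z) - \<i> / (k + z)) * exp (\<i> * z * complex_of_real x) * E\<psi> z"

lemma E\<psi>_eq: "E\<psi> (Complex y \<epsilon>) = (\<integral>s. gauss_kernel \<beta> \<epsilon> y s \<partial>N)"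
proof -
  have "(\<integral>s. gauss_kernel \<beta> \<epsilon> y s \<partial>N) = (\<integral>\<omega>. gauss_kernel \<beta> \<epsilon> y (\<sigma>\<^sup>2 * G t \<omega>) \<partial>M)"
    unfolding N_def by (subst integral_distr) auto
  also have "\<dots> = E\<psi> (Complex y \<epsilon>)"
    unfolding exp_minus_psi_eq laplace_transform_def gauss_kernel_def
    by (intro Bochner_Integration.integral_cong arg_cong[of _ _ exp]) (simp_all add: field_simps)
  finally show ?thesis ..
qed

text \<open>The modulus on the line is largest at \<open>z = \<i> * \<epsilon>\<close>, and there it
  equals the weight in the conclusion.\<close>

lemma integrable_N_exp:
  assumes "\<forall>z. Im z = \<epsilon> \<longrightarrow> complex_of_real (\<sigma>\<^sup>2) * (z\<^sup>2 + complex_of_real (\<beta>\<^sup>2)) / 2 \<in> laplace_domain M G t"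
  shows "integrable N (\<lambda>s. exp ((\<epsilon>\<^sup>2 - \<beta>\<^sup>2) * s / 2))"
proof -
  let ?u = "complex_of_real (\<sigma>\<^sup>2) * ((Complex 0 \<epsilon>)\<^sup>2 + complex_of_real (\<beta>\<^sup>2)) / 2"
  have "integrable M (\<lambda>\<omega>. exp (- ?u * complex_of_real (G t \<omega>)))"
    using assms[rule_format, of "Complex 0 \<epsilon>"] by (simp add: laplace_domain_def)
  then have "integrable M (\<lambda>\<omega>. norm (exp (- ?u * complex_of_real (G t \<omega>))))" by (rule integrable_norm)
  also have "(\<lambda>\<omega>. norm (exp (- ?u * complex_of_real (G t \<omega>)))) = (\<lambda>\<omega>. exp ((\<epsilon>\<^sup>2 - \<beta>\<^sup>2) * (\<sigma>\<^sup>2 * G t \<omega>) / 2))"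
    by (simp add: norm_exp_eq_Re fun_eq_iff power2_eq_square algebra_simps add_divide_distrib diff_divide_distrib)
  finally show ?thesis unfolding N_def by (subst integrable_distr_eq) auto
qed

lemma integrable_N_exp0: "integrable N (\<lambda>s. exp ((0\<^sup>2 - \<beta>\<^sup>2) * s / 2))"
  using AE_N_pos by (intro N.integrable_const_bound[where B=1]) (auto elim!: eventually_mono)

lemma integrable_N_normal:
  assumes "c \<noteq> 0"
  shows "integrable N (\<lambda>s. gauss s \<beta> * heat s c)"
proof (rule N.integrable_const_bound[where B="1 / (2 * \<bar>c\<bar> * sqrt pi)"])
  show "AE s in N. norm (gauss s \<beta> * heat s c) \<le> 1 / (2 * \<bar>c\<bar> * sqrt pi)"
    using AE_N_pos
  proof eventually_elim
    case (elim s)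
    have "gauss s \<beta> * heat s c \<le> 1 * (1 / (2 * \<bar>c\<bar> * sqrt pi))"
      using elim by (intro mult_mono normal_density_bound assms) auto
    then show ?case by simp
  qed
qed measurable

text \<open>At \<open>c = 0\<close> and \<open>\<epsilon> = 0\<close> the value would be
  proportional to the mean of \<open>gauss s \<beta> / sqrt s\<close>, which can be infinite; this
  is why zero frequency is excluded.\<close>

lemma has_line_integral_wave:
  assumes dom: "integrable N (\<lambda>s. exp ((\<epsilon>\<^sup>2 - \<beta>\<^sup>2) * s / 2))" and c: "c \<noteq> 0"
  shows "has_line_integral \<epsilon> (\<lambda>z. exp (\<i> * z * complex_of_real c) * E\<psi> z)
    (complex_of_real (2 * pi * (\<integral>s. gauss s \<beta> * heat s c \<partial>N)))"
proof -
  have "has_line_integral \<epsilon> (\<lambda>z. exp (\<i> * z * complex_of_real c) * E\<psi> z)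
    (\<integral>s. (LBINT y. wave \<epsilon> c y * gauss_kernel \<beta> \<epsilon> y s) \<partial>N)"
  proof (rule has_line_integral_mixture[OF prob_space_N sets_N AE_N_pos dom wave_measurable])
    show "norm (wave \<epsilon> c y) \<le> exp (- \<epsilon> * c)" for y by (simp add: norm_wave)
    show "exp (\<i> * Complex y \<epsilon> * complex_of_real c) * E\<psi> (Complex y \<epsilon>) = wave \<epsilon> c y * (\<integral>s. gauss_kernel \<beta> \<epsilon> y s \<partial>N)" for y
      unfolding E\<psi>_eq wave_def ..
  qed (rule norm_integral_wave_kernel[OF c])
  also have "(\<integral>s. (LBINT y. wave \<epsilon> c y * gauss_kernel \<beta> \<epsilon> y s) \<partial>N)
    = (\<integral>s. complex_of_real (2 * pi * (gauss s \<beta> * heat s c)) \<partial>N)"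
  proof (rule integral_cong_AE)
    show "AE s in N. (LBINT y. wave \<epsilon> c y * gauss_kernel \<beta> \<epsilon> y s) = complex_of_real (2 * pi * (gauss s \<beta> * heat s c))"
      using AE_N_pos by eventually_elim (simp only: integral_wave_kernel mult.assoc)
  qed measurable
  also have "\<dots> = complex_of_real (2 * pi * (\<integral>s. gauss s \<beta> * heat s c \<partial>N))"
    using integrable_N_normal[OF c] by (subst integral_of_real) auto
  finally show ?thesis .
qed

lemma has_line_integral_resolvent:
  assumes k: "Im k > 0"
  shows "has_line_integral 0 (resolvent_integrand k)
    (\<integral>s. (LBINT y. resolvent k y * wave 0 x y * gauss_kernel \<beta> 0 y s) \<partial>N)"
proof (rule has_line_integral_mixture[OF prob_space_N sets_N AE_N_pos integrable_N_exp0])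
  show "norm (resolvent k y * wave 0 x y) \<le> 2 / Im k" for y
    using norm_resolvent_le[OF k] by (simp add: norm_mult norm_wave)
  show "(\<i> / (k - Complex y 0) - \<i> / (k + Complex y 0)) * exp (\<i> * Complex y 0 * complex_of_real x) * E\<psi> (Complex y 0) =
    resolvent k y * wave 0 x y * (\<integral>s. gauss_kernel \<beta> 0 y s \<partial>N)" for y
    unfolding E\<psi>_eq resolvent_def wave_def by (simp add: Complex_eq)
  show "norm (integral {a..b} (\<lambda>y. resolvent k y * wave 0 x y * gauss_kernel \<beta> 0 y s))
    \<le> 2 * ((4 + 2 * pi) / (Im k * x)) * exp ((0\<^sup>2 - \<beta>\<^sup>2) * s / 2)" if "s > 0" "a \<le> b" for s a b
    by (rule norm_integral_resolvent_kernel[OF k x_pos that(2,1)])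
qed measurable

lemma has_line_integral_sine_ratio:
  "has_line_integral 0 sine_integrand
    (\<integral>s. (LBINT y. complex_of_real (sine_ratio x \<beta> y) * gauss_kernel \<beta> 0 y s) \<partial>N)"
proof -
  obtain C where C: "\<And>s a b. s > 0 \<Longrightarrow> a \<le> b \<Longrightarrow>
    norm (integral {a..b} (\<lambda>y. complex_of_real (sine_ratio x \<beta> y) * gauss_kernel \<beta> 0 y s)) \<le> C * exp ((0\<^sup>2 - \<beta>\<^sup>2) * s / 2)"
    using norm_integral_sine_ratio_kernel[OF x_pos, of \<beta>] by blast
  show ?thesis
  proof (rule has_line_integral_mixture[OF prob_space_N sets_N AE_N_pos integrable_N_exp0 _ _ C])
    show "norm (complex_of_real (sine_ratio x \<beta> y)) \<le> x" for y
      using abs_sine_ratio_le[OF x_pos] by simp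
    show "Complex y 0 * sin (Complex y 0 * complex_of_real x) / ((Complex y 0)\<^sup>2 + complex_of_real (\<beta>\<^sup>2)) * E\<psi> (Complex y 0)
      = complex_of_real (sine_ratio x \<beta> y) * (\<integral>s. gauss_kernel \<beta> 0 y s \<partial>N)" for y
    proof -
      have "Complex y 0 = complex_of_real y" by (simp add: Complex_eq)
      moreover have "complex_of_real y * sin (complex_of_real y * complex_of_real x) / ((complex_of_real y)\<^sup>2 + complex_of_real (\<beta>\<^sup>2))
        = complex_of_real (sine_ratio x \<beta> y)"
        by (simp add: sine_ratio_def flip: sin_of_real)
      ultimately show ?thesis unfolding E\<psi>_eq by metis
    qed
  qed auto
qed

section \<open>Mixture densities of the time-changed process\<close>

abbreviation L :: "'a \<Rightarrow> real" where "L \<equiv> tcbm X G t"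

definition mixed :: "(real \<Rightarrow> real \<Rightarrow> real) \<Rightarrow> real \<Rightarrow> real" where
  "mixed p l = (\<integral>s. p s l \<partial>N)"

text \<open>Joint integrability allows Fubini in both orders. Nonnegativity is asked for almost all
  \<open>s\<close> only, since for the survival kernel it is established for
  \<open>s > 0\<close>.\<close>

definition mixture_density :: "('a \<Rightarrow> bool) \<Rightarrow> (real \<Rightarrow> real \<Rightarrow> real) \<Rightarrow> bool" where
  "mixture_density A p \<longleftrightarrow>
     integrable (N \<Otimes>\<^sub>M lborel) (case_prod p) \<and> (AE s in N. \<forall>l. 0 \<le> p s l) \<and>
     (\<forall>B\<in>sets borel. {\<omega> \<in> space M. A \<omega> \<and> L \<omega> \<in> B} \<in> sets M \<and>
       emeasure M {\<omega> \<in> space M. A \<omega> \<and> L \<omega> \<in> B} = (\<integral>\<^sup>+s. (\<integral>\<^sup>+l. ennreal (p s l) * indicator B l \<partial>lborel) \<partial>N))"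

lemma mixed_nonneg: "mixture_density A p \<Longrightarrow> 0 \<le> mixed p l"
  unfolding mixture_density_def mixed_def by (intro integral_nonneg_AE) (auto elim!: eventually_mono)

lemma integrable_mixed: "mixture_density A p \<Longrightarrow> integrable lborel (mixed p)"
  unfolding mixture_density_def mixed_def[abs_def] by (intro NL.integrable_snd) auto

lemma emeasure_mixed:
  assumes A: "mixture_density A p" and B [measurable]: "B \<in> sets borel"
  shows "emeasure M {\<omega> \<in> space M. A \<omega> \<and> L \<omega> \<in> B} = (\<integral>\<^sup>+l. ennreal (mixed p l) * indicator B l \<partial>lborel)"
proof -
  have p: "integrable (N \<Otimes>\<^sub>M lborel) (case_prod p)" and pos: "AE s in N. \<forall>l. 0 \<le> p s l"
    using A by (auto simp: mixture_density_def)
  have pm: "case_prod p \<in> borel_measurable (N \<Otimes>\<^sub>M lborel)" using p by auto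
  have [measurable]: "(\<lambda>x. p (fst x) (snd x)) \<in> borel_measurable (N \<Otimes>\<^sub>M lborel)"
    using pm by (simp add: case_prod_beta')
  have "emeasure M {\<omega> \<in> space M. A \<omega> \<and> L \<omega> \<in> B} = (\<integral>\<^sup>+s. (\<integral>\<^sup>+l. ennreal (p s l) * indicator B l \<partial>lborel) \<partial>N)"
    using A B by (auto simp: mixture_density_def)
  also have "\<dots> = (\<integral>\<^sup>+l. (\<integral>\<^sup>+s. ennreal (p s l) * indicator B l \<partial>N) \<partial>lborel)"
    by (rule NL.Fubini'[symmetric]) (simp add: case_prod_beta')
  also have "\<dots> = (\<integral>\<^sup>+l. ennreal (mixed p l) * indicator B l \<partial>lborel)"
  proof (rule nn_integral_cong_AE)
    \<comment> \<open>Where \<open>p\<close> is not integrable in \<open>s\<close>, the Bochner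
      integral \<open>mixed p l\<close> defaults to 0; Fubini confines such \<open>l\<close> to a
      null set.\<close>
    show "AE l in lborel. (\<integral>\<^sup>+s. ennreal (p s l) * indicator B l \<partial>N) = ennreal (mixed p l) * indicator B l"
      using NL.AE_integrable_snd[OF p]
    proof eventually_elim
      case (elim l)
      have "(\<integral>\<^sup>+s. ennreal (p s l) * indicator B l \<partial>N) = (\<integral>\<^sup>+s. ennreal (p s l) \<partial>N) * indicator B l"
        using elim by (intro nn_integral_multc) auto
      also have "(\<integral>\<^sup>+s. ennreal (p s l) \<partial>N) = ennreal (mixed p l)"
        unfolding mixed_def using elim pos by (intro nn_integral_eq_integral) (auto elim!: eventually_mono)
      finally show ?case .
    qed
  qed
  finally show ?thesis .
qed

lemma is_delta_density_mixed:
  assumes A: "mixture_density A p"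
  shows "is_delta_density M A L (\<lambda>l. complex_of_real (mixed p l))"
  unfolding is_delta_density_def
proof (intro conjI ballI)
  note int = integrable_mixed[OF A]
  then show "integrable lborel (\<lambda>l. complex_of_real (mixed p l))" by simp
  fix B :: "real set" assume B: "B \<in> sets borel"
  then show "{\<omega> \<in> space M. A \<omega> \<and> L \<omega> \<in> B} \<in> sets M" using A by (auto simp: mixture_density_def)
  have iB: "integrable lborel (\<lambda>l. indicator B l * mixed p l)"
    using integrable_mult_indicator[OF _ int, of B] B by simp
  have "emeasure M {\<omega> \<in> space M. A \<omega> \<and> L \<omega> \<in> B} = (\<integral>\<^sup>+l. ennreal (indicator B l * mixed p l) \<partial>lborel)"
    unfolding emeasure_mixed[OF A B] by (intro nn_integral_cong) (simp add: indicator_def)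
  also have "\<dots> = ennreal (LBINT l. indicator B l * mixed p l)"
    using iB mixed_nonneg[OF A] by (intro nn_integral_eq_integral) auto
  finally have "measure M {\<omega> \<in> space M. A \<omega> \<and> L \<omega> \<in> B} = (LBINT l. indicator B l * mixed p l)"
    using mixed_nonneg[OF A] by (intro measure_eq_emeasure_eq_ennreal integral_nonneg_AE) auto
  also have "complex_of_real \<dots> = (LINT l:B|lborel. complex_of_real (mixed p l))"
    unfolding set_lebesgue_integral_def by (simp add: scaleR_conv_of_real flip: integral_of_real[OF iB])
  finally show "complex_of_real (measure M {\<omega> \<in> space M. A \<omega> \<and> L \<omega> \<in> B}) = (LINT l:B|lborel. complex_of_real (mixed p l))" .
qed

text \<open>Joint integrability of \<open>p\<close> times \<open>h\<close> is a separate hypothesis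
  because \<open>h\<close> may be unbounded.\<close>

lemma expectation_mixed:
  fixes h :: "real \<Rightarrow> complex"
  assumes A: "mixture_density A p" and [measurable]: "L \<in> borel_measurable M" "h \<in> borel_measurable borel"
    and q: "integrable (N \<Otimes>\<^sub>M lborel) (\<lambda>(s, l). p s l *\<^sub>R h l)"
  shows "integrable M (\<lambda>\<omega>. indicator {\<omega>. A \<omega>} \<omega> * h (L \<omega>))"
    and "(\<integral>\<omega>. indicator {\<omega>. A \<omega>} \<omega> * h (L \<omega>) \<partial>M) = (\<integral>s. (LBINT l. p s l *\<^sub>R h l) \<partial>N)"
proof -
  have p: "integrable (N \<Otimes>\<^sub>M lborel) (case_prod p)" using A by (auto simp: mixture_density_def)
  have Am [measurable]: "Measurable.pred M A"
    using A unfolding mixture_density_def by (auto simp: pred_def dest: bspec[of _ _ UNIV])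
  have [measurable]: "mixed p \<in> borel_measurable lborel" using integrable_mixed[OF A] by auto
  have eq: "distr (density M (\<lambda>\<omega>. ennreal (indicator {\<omega>. A \<omega>} \<omega>))) borel L = density lborel (\<lambda>l. ennreal (mixed p l))"
  proof (rule measure_eqI)
    fix B assume "B \<in> sets (distr (density M (\<lambda>\<omega>. ennreal (indicator {\<omega>. A \<omega>} \<omega>))) borel L)"
    then have B [measurable]: "B \<in> sets borel" by simp
    have "emeasure (distr (density M (\<lambda>\<omega>. ennreal (indicator {\<omega>. A \<omega>} \<omega>))) borel L) B
      = (\<integral>\<^sup>+\<omega>. ennreal (indicator {\<omega>. A \<omega>} \<omega>) * indicator (L -` B \<inter> space M) \<omega> \<partial>M)"
      by (subst emeasure_distr) (auto intro!: emeasure_density)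
    also have "\<dots> = (\<integral>\<^sup>+\<omega>. indicator {\<omega> \<in> space M. A \<omega> \<and> L \<omega> \<in> B} \<omega> \<partial>M)"
      by (intro nn_integral_cong) (auto simp: indicator_def)
    also have "\<dots> = emeasure M {\<omega> \<in> space M. A \<omega> \<and> L \<omega> \<in> B}"
      using A B by (intro nn_integral_indicator) (auto simp: mixture_density_def)
    finally show "emeasure (distr (density M (\<lambda>\<omega>. ennreal (indicator {\<omega>. A \<omega>} \<omega>))) borel L) B = emeasure (density lborel (\<lambda>l. ennreal (mixed p l))) B"
      unfolding emeasure_mixed[OF A B] by (subst emeasure_density) auto
  qed simp
  have ae: "AE l in lborel. (\<integral>s. p s l *\<^sub>R h l \<partial>N) = mixed p l *\<^sub>R h l"
    using NL.AE_integrable_snd[OF p] by eventually_elim (simp add: mixed_def)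
  have q2: "integrable lborel (\<lambda>l. \<integral>s. p s l *\<^sub>R h l \<partial>N)" using NL.integrable_snd[OF q] .
  then have i: "integrable lborel (\<lambda>l. mixed p l *\<^sub>R h l)"
    using ae by (subst integrable_cong_AE[where g="\<lambda>l. \<integral>s. p s l *\<^sub>R h l \<partial>N"]) (auto elim!: eventually_mono)
  then have "integrable (density lborel (\<lambda>l. ennreal (mixed p l))) h"
    using mixed_nonneg[OF A] by (subst integrable_density) auto
  then have "integrable (density M (\<lambda>\<omega>. ennreal (indicator {\<omega>. A \<omega>} \<omega>))) (\<lambda>\<omega>. h (L \<omega>))"
    unfolding eq[symmetric] by (subst (asm) integrable_distr_eq) auto
  then have "integrable M (\<lambda>\<omega>. indicator {\<omega>. A \<omega>} \<omega> *\<^sub>R h (L \<omega>))"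
    by (subst (asm) integrable_density) auto
  moreover have sc: "indicator {\<omega>. A \<omega>} \<omega> *\<^sub>R h (L \<omega>) = indicator {\<omega>. A \<omega>} \<omega> * h (L \<omega>)" for \<omega>
    by (simp add: indicator_def)
  ultimately show "integrable M (\<lambda>\<omega>. indicator {\<omega>. A \<omega>} \<omega> * h (L \<omega>))" by simp
  have "(\<integral>\<omega>. indicator {\<omega>. A \<omega>} \<omega> * h (L \<omega>) \<partial>M) = (\<integral>\<omega>. h (L \<omega>) \<partial>density M (\<lambda>\<omega>. ennreal (indicator {\<omega>. A \<omega>} \<omega>)))"
    unfolding sc[symmetric] by (subst integral_density) auto
  also have "\<dots> = (\<integral>l. h l \<partial>distr (density M (\<lambda>\<omega>. ennreal (indicator {\<omega>. A \<omega>} \<omega>))) borel L)"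
    by (subst integral_distr) auto
  also have "\<dots> = (LBINT l. mixed p l *\<^sub>R h l)"
    unfolding eq using mixed_nonneg[OF A] by (subst integral_density) auto
  also have "\<dots> = (LBINT l. (\<integral>s. p s l *\<^sub>R h l \<partial>N))"
    using ae borel_measurable_integrable[OF i] borel_measurable_integrable[OF q2]
    by (intro integral_cong_AE) (auto elim!: eventually_mono)
  also have "\<dots> = (\<integral>s. (LBINT l. p s l *\<^sub>R h l) \<partial>N)"
    by (rule NL.Fubini_integral[OF q])
  finally show "(\<integral>\<omega>. indicator {\<omega>. A \<omega>} \<omega> * h (L \<omega>) \<partial>M) = (\<integral>s. (LBINT l. p s l *\<^sub>R h l) \<partial>N)" .
qed

text \<open>The drift \<open>b\<close> is free because the density with zero drift serves later as a
  majorant.\<close>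

lemma integrable_drift_density: "integrable (N \<Otimes>\<^sub>M lborel) (\<lambda>(s, l). drift_density x b s l)"
proof (rule NL.Fubini_integrable)
  have i: "integrable lborel (drift_density x b s)" "(LBINT l. drift_density x b s l) = 1" if "s > 0" for s
  proof -
    have "drift_density x b s = normal_density (x + b * s) (sqrt s)"
      using that by (intro ext drift_density_eq)
    then show "integrable lborel (drift_density x b s)" "(LBINT l. drift_density x b s l) = 1"
      using that by simp_all
  qed
  show "AE s in N. integrable lborel (\<lambda>l. case (s, l) of (s, l) \<Rightarrow> drift_density x b s l)"
    using AE_N_pos by eventually_elim (simp add: i)
  have "integrable N (\<lambda>s. 1 :: real)" by simp
  moreover have "AE s in N. (1 :: real) = (LBINT l. norm (case (s, l) of (s, l) \<Rightarrow> drift_density x b s l))"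
    using AE_N_pos by eventually_elim (simp add: i drift_density_nonneg)
  ultimately show "integrable N (\<lambda>s. \<integral>l. norm (case (s, l) of (s, l) \<Rightarrow> drift_density x b s l) \<partial>lborel)"
    by (subst integrable_cong_AE[where g="\<lambda>_. 1"]) (auto elim!: eventually_mono)
qed measurable

lemma AE_pair_pos: "AE z in N \<Otimes>\<^sub>M lborel. fst z > 0"
proof -
  have "AE s in N. AE l in lborel. fst (s, l) > (0::real)" using AE_N_pos by eventually_elim simp
  moreover have "{z \<in> space (N \<Otimes>\<^sub>M lborel). fst z > (0::real)} \<in> sets (N \<Otimes>\<^sub>M lborel)" by measurable
  ultimately show ?thesis by (intro NL.AE_pair_measure)
qed

lemma mixture_density_drift: "mixture_density (\<lambda>_. True) (drift_density x \<beta>)"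
  unfolding mixture_density_def
proof (intro conjI ballI)
  show "integrable (N \<Otimes>\<^sub>M lborel) (case_prod (drift_density x \<beta>))"
    using integrable_drift_density by simp
  show "AE s in N. \<forall>l. 0 \<le> drift_density x \<beta> s l" by (simp add: drift_density_nonneg)
  fix B :: "real set" assume [measurable]: "B \<in> sets borel"
  have F: "Measurable.pred (path_space \<Otimes>\<^sub>M borel) (\<lambda>p. x + \<sigma> * path_value (fst p) (snd p) + \<beta> * \<sigma>\<^sup>2 * snd p \<in> B)"
    by measurable
  have eq: "{\<omega> \<in> space M. True \<and> L \<omega> \<in> B} = {\<omega> \<in> space M. X (G t \<omega>) \<omega> \<in> B}" by (simp add: tcbm_def)
  have FE: "x + \<sigma> * path_value (W_path \<omega>) g + \<beta> * \<sigma>\<^sup>2 * g \<in> B \<longleftrightarrow> X g \<omega> \<in> B" if "\<omega> \<in> space M" "g > 0" for \<omega> g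
    using path_value_W[of \<omega> g] that by (simp add: drifted_bm_def)
  note mix = mixture_event[where E="\<lambda>g \<omega>. X g \<omega> \<in> B", OF F, OF FE law_of_X]
  show "{\<omega> \<in> space M. True \<and> L \<omega> \<in> B} \<in> sets M" unfolding eq by (rule mix(1)) auto
  show "emeasure M {\<omega> \<in> space M. True \<and> L \<omega> \<in> B} = (\<integral>\<^sup>+s. (\<integral>\<^sup>+l. ennreal (drift_density x \<beta> s l) * indicator B l \<partial>lborel) \<partial>N)"
    unfolding eq by (subst nn_integral_N) (auto intro!: mix(2))
qed

lemma L_measurable [measurable]: "L \<in> borel_measurable M"
  using mixture_density_drift by (intro measurableI) (auto simp: mixture_density_def vimage_def Int_def conj_commute)

lemma mixture_density_survival: "mixture_density (\<lambda>\<omega>. ereal t < hitting_time \<omega>) (survival_density x \<beta>)"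
  unfolding mixture_density_def
proof (intro conjI ballI)
  show "AE s in N. \<forall>l. 0 \<le> survival_density x \<beta> s l"
    using AE_N_pos by eventually_elim (simp add: survival_density_nonneg x_pos)
  show "integrable (N \<Otimes>\<^sub>M lborel) (case_prod (survival_density x \<beta>))"
  proof (rule Bochner_Integration.integrable_bound[OF integrable_drift_density])
    show "AE z in N \<Otimes>\<^sub>M lborel. norm (case_prod (survival_density x \<beta>) z) \<le> norm (case z of (s, l) \<Rightarrow> drift_density x \<beta> s l)"
      using AE_pair_pos
      by eventually_elim (auto simp: survival_density_nonneg x_pos drift_density_nonneg survival_density_le)
  qed measurable
  fix B :: "real set" assume [measurable]: "B \<in> sets borel"
  have F: "Measurable.pred (path_space \<Otimes>\<^sub>M borel)
    (\<lambda>p. path_survives (fst p) (snd p) \<and> x + \<sigma> * path_value (fst p) (snd p) + \<beta> * \<sigma>\<^sup>2 * snd p \<in> B)"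
    by measurable
  have eq: "{\<omega> \<in> space M. ereal t < hitting_time \<omega> \<and> L \<omega> \<in> B}
    = {\<omega> \<in> space M. \<not> hits (G t \<omega>) \<omega> \<and> X (G t \<omega>) \<omega> \<in> B}"
    using first_passage2_le_iff by (auto simp: tcbm_def not_le[symmetric])
  have FE: "path_survives (W_path \<omega>) g \<and> x + \<sigma> * path_value (W_path \<omega>) g + \<beta> * \<sigma>\<^sup>2 * g \<in> B \<longleftrightarrow> \<not> hits g \<omega> \<and> X g \<omega> \<in> B"
    if "\<omega> \<in> space M" "g > 0" for \<omega> g
    using path_value_W[of \<omega> g] path_survives_W that by (simp add: drifted_bm_def)
  note mix = mixture_event[where E="\<lambda>g \<omega>. \<not> hits g \<omega> \<and> X g \<omega> \<in> B", OF F, OF FE law_of_killed_X]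
  show "{\<omega> \<in> space M. ereal t < hitting_time \<omega> \<and> L \<omega> \<in> B} \<in> sets M" unfolding eq by (rule mix(1)) auto
  show "emeasure M {\<omega> \<in> space M. ereal t < hitting_time \<omega> \<and> L \<omega> \<in> B}
    = (\<integral>\<^sup>+s. (\<integral>\<^sup>+l. ennreal (survival_density x \<beta> s l) * indicator B l \<partial>lborel) \<partial>N)"
    unfolding eq by (subst nn_integral_N) (auto intro!: mix(2))
qed

lemma mixed_survival:
  "mixed (survival_density x \<beta>) l = indicator {0<..} l * (exp (\<beta> * (l - x)) *
    (\<integral>s. gauss s \<beta> * image_kernel s x l \<partial>N))"
proof -
  have "survival_density x \<beta> s l = indicator {0<..} l * exp (\<beta> * (l - x)) * (gauss s \<beta> * image_kernel s x l)" for s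
  proof -
    have "exp (\<beta> * (l - x) - \<beta>\<^sup>2 * s / 2) = exp (\<beta> * (l - x)) * gauss s \<beta>" by (simp flip: exp_add)
    then show ?thesis unfolding survival_density_def by (simp only: mult_ac)
  qed
  then show ?thesis unfolding mixed_def by simp
qed

text \<open>At \<open>l = x\<close> the two mixtures may both diverge, so the difference of Bochner
  integrals is taken elsewhere.\<close>

lemma mixed_drift_diff:
  assumes "l \<noteq> x"
  shows "mixed (drift_density x \<beta>) l - mixed (survival_density x \<beta>) l =
    exp (\<beta> * (l - x)) * (\<integral>s. gauss s \<beta> * heat s (x + \<bar>l\<bar>) \<partial>N)"
proof -
  have e: "exp (\<beta> * (l - x) - \<beta>\<^sup>2 * s / 2) = exp (\<beta> * (l - x)) * gauss s \<beta>" for s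
    by (simp flip: exp_add)
  have n: "integrable N (\<lambda>s. exp (\<beta> * (l - x) - \<beta>\<^sup>2 * s / 2) * heat s c)" if "c \<noteq> 0" for c
    using integrable_mult_right[OF integrable_N_normal[OF that], of "exp (\<beta> * (l - x))"] by (simp add: e mult.assoc)
  have d: "integrable N (\<lambda>s. drift_density x \<beta> s l)" unfolding drift_density_def by (rule n) (use assms in simp)
  have "integrable N (\<lambda>s. drift_density x \<beta> s l - survival_density x \<beta> s l)"
    unfolding drift_density_diff_survival_density by (rule n) (use x_pos in simp)
  \<comment> \<open>The survival part is the free part minus the reflected part, and both of these
    are integrable.\<close>
  from Bochner_Integration.integrable_diff[OF d this] have s: "integrable N (\<lambda>s. survival_density x \<beta> s l)" by simp
  have "mixed (drift_density x \<beta>) l - mixed (survival_density x \<beta>) l = (\<integral>s. drift_density x \<beta> s l - survival_density x \<beta> s l \<partial>N)"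
    unfolding mixed_def using d s by simp
  also have "\<dots> = exp (\<beta> * (l - x)) * (\<integral>s. gauss s \<beta> * heat s (x + \<bar>l\<bar>) \<partial>N)"
    unfolding drift_density_diff_survival_density e by (simp add: mult.assoc)
  finally show ?thesis .
qed

lemma has_line_integral_survival:
  assumes dom: "integrable N (\<lambda>s. exp ((\<epsilon>\<^sup>2 - \<beta>\<^sup>2) * s / 2))" and l: "l > 0" "l \<noteq> x"
  shows "has_line_integral \<epsilon> (survival_integrand l)
    (complex_of_real (2 * pi * (\<integral>s. gauss s \<beta> * image_kernel s x l \<partial>N)))"
proof -
  have c: "l - x \<noteq> 0" "l + x \<noteq> 0" using l x_pos by auto
  have "complex_of_real (2 * pi * (\<integral>s. gauss s \<beta> * image_kernel s x l \<partial>N))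
    = complex_of_real (2 * pi * (\<integral>s. gauss s \<beta> * heat s (l - x) \<partial>N))
    - complex_of_real (2 * pi * (\<integral>s. gauss s \<beta> * heat s (l + x) \<partial>N))"
    using integrable_N_normal[OF c(1)] integrable_N_normal[OF c(2)]
    by (simp add: image_kernel_def right_diff_distrib)
  then show ?thesis
    using has_line_integral_diff[OF has_line_integral_wave[OF dom c(1)] has_line_integral_wave[OF dom c(2)]]
    by (simp add: left_diff_distrib)
qed

lemma survival_delta_density:
  assumes dom: "integrable N (\<lambda>s. exp ((\<epsilon>\<^sup>2 - \<beta>\<^sup>2) * s / 2))"
  shows "is_delta_density M (\<lambda>\<omega>. ereal t < hitting_time \<omega>) L
    (\<lambda>l. indicator {0<..} l * (complex_of_real (exp (\<beta> * (l - x)) / (2 * pi)) *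
       line_integral \<epsilon> (survival_integrand l)))"
proof (rule is_delta_density_cong[OF is_delta_density_mixed[OF mixture_density_survival], of x])
  fix l assume "l \<noteq> x"
  then show "indicator {0<..} l * (complex_of_real (exp (\<beta> * (l - x)) / (2 * pi)) *
       line_integral \<epsilon> (survival_integrand l)) = complex_of_real (mixed (survival_density x \<beta>) l)"
    using line_integral_eq(2)[OF has_line_integral_survival[OF dom, of l]]
    by (cases "l > 0") (simp_all add: mixed_survival)
qed

lemma has_line_integral_hit:
  assumes dom: "integrable N (\<lambda>s. exp ((\<epsilon>\<^sup>2 - \<beta>\<^sup>2) * s / 2))"
  shows "has_line_integral \<epsilon> (hit_integrand l)
    (complex_of_real (2 * pi * (\<integral>s. gauss s \<beta> * heat s (x + \<bar>l\<bar>) \<partial>N)))"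
proof -
  have "x + \<bar>l\<bar> \<noteq> 0" using x_pos by linarith
  from has_line_integral_wave[OF dom this] show ?thesis by simp
qed

lemma hit_delta_density:
  assumes dom: "integrable N (\<lambda>s. exp ((\<epsilon>\<^sup>2 - \<beta>\<^sup>2) * s / 2))"
  shows "is_delta_density M (\<lambda>\<omega>. hitting_time \<omega> \<le> ereal t) L
    (\<lambda>l. complex_of_real (exp (\<beta> * (l - x)) / (2 * pi)) *
       line_integral \<epsilon> (hit_integrand l))"
proof -
  have "is_delta_density M (\<lambda>\<omega>. \<not> ereal t < hitting_time \<omega>) L
    (\<lambda>l. complex_of_real (mixed (drift_density x \<beta>) l) - complex_of_real (mixed (survival_density x \<beta>) l))"
    by (intro is_delta_density_compl prob_space_axioms is_delta_density_mixed mixture_density_drift mixture_density_survival)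
  then have "is_delta_density M (\<lambda>\<omega>. hitting_time \<omega> \<le> ereal t) L
    (\<lambda>l. complex_of_real (mixed (drift_density x \<beta>) l) - complex_of_real (mixed (survival_density x \<beta>) l))"
    by (simp add: not_less)
  then show ?thesis
  proof (rule is_delta_density_cong[where c=x])
    fix l assume "l \<noteq> x"
    from mixed_drift_diff[OF this]
    show "complex_of_real (exp (\<beta> * (l - x)) / (2 * pi)) *
       line_integral \<epsilon> (hit_integrand l)
      = complex_of_real (mixed (drift_density x \<beta>) l) - complex_of_real (mixed (survival_density x \<beta>) l)"
      unfolding line_integral_eq(2)[OF has_line_integral_hit[OF dom]]
      by (simp flip: of_real_diff)
  qed
qed

text \<open>\<open>\<epsilon> = 0\<close> is always admissible, and \<open>B = UNIV\<close> gives
  the event.\<close>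

lemma hit_measurable: "{\<omega> \<in> space M. hitting_time \<omega> \<le> ereal t} \<in> sets M"
  using hit_delta_density[OF integrable_N_exp0] by (auto simp: is_delta_density_def dest: bspec[of _ _ UNIV])

section \<open>Hitting probability and survival transform\<close>

lemma integral_survival_density:
  assumes "s > 0"
  shows "(LBINT l. survival_density x \<beta> s l) = exp (- \<beta> * x - \<beta>\<^sup>2 * s / 2) * image_mass \<beta> s x"
proof -
  have "survival_density x \<beta> s l = exp (- \<beta> * x - \<beta>\<^sup>2 * s / 2) * (indicator {0<..} l * (exp (\<beta> * l) * image_kernel s x l))" for l
  proof -
    have "exp (\<beta> * (l - x) - \<beta>\<^sup>2 * s / 2) = exp (- \<beta> * x - \<beta>\<^sup>2 * s / 2) * exp (\<beta> * l)"
      by (simp add: algebra_simps flip: exp_add)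
    then show ?thesis unfolding survival_density_def by (simp only: mult_ac)
  qed
  then show ?thesis by (simp add: image_mass_def)
qed

text \<open>Complement of the total mass of the survival density, averaged over the clock.\<close>

lemma hit_probability:
  "complex_of_real (\<integral>\<omega>. indicator {\<omega>. hitting_time \<omega> \<le> ereal t} \<omega> \<partial>M)
    = complex_of_real (exp (- 2 * \<beta> * x) * (if \<beta> > 0 then 1 else 0) + (if \<beta> \<le> 0 then 1 else 0))
      - complex_of_real (exp (- \<beta> * x) / pi) *
        line_integral 0 sine_integrand"
proof -
  let ?c = "exp (- 2 * \<beta> * x) * (if \<beta> > 0 then 1 else 0) + (if \<beta> \<le> 0 then 1 else 0) :: real"
  let ?J = "\<lambda>s. \<integral>y. sine_ratio x \<beta> y * gauss s \<beta> * gauss s y \<partial>lborel"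
  let ?S = "\<lambda>s. \<integral>l. survival_density x \<beta> s l \<partial>lborel"
  have surv: "integrable (N \<Otimes>\<^sub>M lborel) (case_prod (survival_density x \<beta>))"
    using mixture_density_survival by (simp add: mixture_density_def)
  have S: "AE s in N. ?S s = 1 - ?c + exp (- \<beta> * x) / pi * ?J s"
    using AE_N_pos
  proof eventually_elim
    case (elim s)
    show ?case unfolding integral_survival_density[OF elim] by (rule image_mass_eq[OF elim x_pos])
  qed
  have Si: "integrable N ?S" using NL.integrable_fst[OF surv] by simp
  have [measurable]: "?J \<in> borel_measurable N" by measurable
  \<comment> \<open>Integrability of \<open>?J\<close> is read off from the survival mass by solving
    the identity \<open>S\<close> for \<open>?J\<close>.\<close>
  have "integrable N (\<lambda>s. pi * exp (\<beta> * x) * (?S s - (1 - ?c)))"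
    by (intro integrable_mult_right Bochner_Integration.integrable_diff Si N.integrable_const)
  moreover have "AE s in N. pi * exp (\<beta> * x) * (?S s - (1 - ?c)) = ?J s"
    using S
  proof eventually_elim
    case (elim s)
    have "pi * exp (\<beta> * x) * (exp (- \<beta> * x) / pi * ?J s) = (exp (\<beta> * x) * exp (- \<beta> * x)) * ?J s" by simp
    also have "\<dots> = ?J s" by (simp flip: exp_add)
    finally show ?case unfolding elim by simp
  qed
  ultimately have Ji: "integrable N ?J"
    using Si by (subst integrable_cong_AE[where g="\<lambda>s. pi * exp (\<beta> * x) * (?S s - (1 - ?c))"]) (auto elim!: eventually_mono)
  have SJ: "(\<integral>s. ?S s \<partial>N) = 1 - ?c + exp (- \<beta> * x) / pi * (\<integral>s. ?J s \<partial>N)"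
  proof -
    have "(\<integral>s. ?S s \<partial>N) = (\<integral>s. 1 - ?c + exp (- \<beta> * x) / pi * ?J s \<partial>N)"
      using S Si by (intro integral_cong_AE) auto
    then show ?thesis using Ji by (simp add: N.prob_space)
  qed
  have "line_integral 0 sine_integrand
    = (\<integral>s. (LBINT y. complex_of_real (sine_ratio x \<beta> y) * gauss_kernel \<beta> 0 y s) \<partial>N)"
    by (rule line_integral_eq(2)[OF has_line_integral_sine_ratio])
  also have "\<dots> = (\<integral>s. complex_of_real (?J s) \<partial>N)"
  proof (intro Bochner_Integration.integral_cong refl)
    fix s
    have "(\<lambda>y. complex_of_real (sine_ratio x \<beta> y) * gauss_kernel \<beta> 0 y s) =
      (\<lambda>y. complex_of_real (sine_ratio x \<beta> y * gauss s \<beta> * gauss s y))"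
      by (simp only: gauss_kernel_real of_real_mult mult.assoc)
    then show "(LBINT y. complex_of_real (sine_ratio x \<beta> y) * gauss_kernel \<beta> 0 y s) = complex_of_real (?J s)"
      by (simp only: integral_complex_of_real)
  qed
  also have "\<dots> = complex_of_real (\<integral>s. ?J s \<partial>N)" by (rule integral_complex_of_real)
  finally have line: "line_integral 0 sine_integrand
    = complex_of_real (\<integral>s. ?J s \<partial>N)" .
  have scaled: "integrable (N \<Otimes>\<^sub>M lborel) (\<lambda>(s, l). survival_density x \<beta> s l *\<^sub>R (1 :: complex))"
    using surv by (simp add: scaleR_conv_of_real case_prod_beta')
  have "complex_of_real (\<integral>\<omega>. indicator {\<omega>. ereal t < hitting_time \<omega>} \<omega> \<partial>M)
    = (\<integral>\<omega>. indicator {\<omega>. ereal t < hitting_time \<omega>} \<omega> * 1 \<partial>M)"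
    unfolding integral_complex_of_real[symmetric]
    by (intro Bochner_Integration.integral_cong) (auto simp: indicator_def)
  also have "\<dots> = (\<integral>s. (LBINT l. survival_density x \<beta> s l *\<^sub>R (1 :: complex)) \<partial>N)"
    by (rule expectation_mixed(2)[OF mixture_density_survival L_measurable _ scaled]) simp
  also have "\<dots> = complex_of_real (\<integral>s. ?S s \<partial>N)"
    by (simp add: scaleR_conv_of_real integral_complex_of_real)
  finally have "(\<integral>\<omega>. indicator {\<omega>. ereal t < hitting_time \<omega>} \<omega> \<partial>M) = (\<integral>s. ?S s \<partial>N)"
    by (simp only: of_real_eq_iff)
  moreover have "(\<integral>\<omega>. indicator {\<omega>. hitting_time \<omega> \<le> ereal t} \<omega> \<partial>M)
    = 1 - (\<integral>\<omega>. (indicator {\<omega>. ereal t < hitting_time \<omega>} \<omega> :: real) \<partial>M)"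
  proof -
    let ?A = "{\<omega> \<in> space M. hitting_time \<omega> \<le> ereal t}"
    have "{\<omega>. hitting_time \<omega> \<le> ereal t} \<inter> space M = ?A"
      "{\<omega>. ereal t < hitting_time \<omega>} \<inter> space M = space M - ?A" by auto
    then show ?thesis using prob_compl[OF hit_measurable] by simp
  qed
  ultimately have "(\<integral>\<omega>. indicator {\<omega>. hitting_time \<omega> \<le> ereal t} \<omega> \<partial>M) = ?c - exp (- \<beta> * x) / pi * (\<integral>s. ?J s \<partial>N)"
    using SJ by simp
  then show ?thesis unfolding line by (simp only: of_real_diff of_real_mult)
qed

text \<open>The factor \<open>exp (- \<beta> * l)\<close> cancels the tilt of the survival density,
  so what remains is the transform of the driftless image kernel, available for every
  \<open>k\<close> in the upper half-plane.\<close>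

lemma survival_transform:
  assumes k: "Im k > 0"
  defines "h \<equiv> \<lambda>l. exp (- complex_of_real (\<beta> * l) + \<i> * k * complex_of_real l)"
  shows "integrable M (\<lambda>\<omega>. indicator {\<omega>. ereal t < hitting_time \<omega>} \<omega> * h (L \<omega>))"
    and "(\<integral>\<omega>. indicator {\<omega>. ereal t < hitting_time \<omega>} \<omega> * h (L \<omega>) \<partial>M)
      = complex_of_real (exp (- \<beta> * x) / (2 * pi)) *
        line_integral 0 (resolvent_integrand k)"
proof -
  have hm [measurable]: "h \<in> borel_measurable borel" unfolding h_def by measurable
  have h: "survival_density x \<beta> s l *\<^sub>R h l = complex_of_real (exp (- \<beta> * x - \<beta>\<^sup>2 * s / 2)) *
    (indicator {0<..} l *\<^sub>R (exp (\<i> * k * complex_of_real l) * complex_of_real (image_kernel s x l)))" for s l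
  proof -
    have "complex_of_real (exp (\<beta> * (l - x) - \<beta>\<^sup>2 * s / 2)) * h l
      = complex_of_real (exp (- \<beta> * x - \<beta>\<^sup>2 * s / 2)) * exp (\<i> * k * complex_of_real l)"
      unfolding h_def by (simp add: algebra_simps flip: exp_of_real exp_add)
    from arg_cong[OF this, of "\<lambda>u. u * (complex_of_real (indicator {0<..} l) * complex_of_real (image_kernel s x l))"]
    show ?thesis
      unfolding survival_density_def scaleR_conv_of_real of_real_mult by (simp only: mult_ac)
  qed
  have int: "integrable (N \<Otimes>\<^sub>M lborel) (\<lambda>(s, l). survival_density x \<beta> s l *\<^sub>R h l)"
  proof (rule Bochner_Integration.integrable_bound)
    \<comment> \<open>After the cancellation the driftless density is a majorant, since
      \<open>exp (- Im k * l)\<close> is at most 1 for \<open>l > 0\<close>.\<close>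
    show "integrable (N \<Otimes>\<^sub>M lborel) (\<lambda>z. exp (- \<beta> * x) * (case z of (s, l) \<Rightarrow> drift_density x 0 s l))"
      by (intro integrable_mult_right integrable_drift_density)
    show "AE z in N \<Otimes>\<^sub>M lborel. norm (case z of (s, l) \<Rightarrow> survival_density x \<beta> s l *\<^sub>R h l)
      \<le> norm (exp (- \<beta> * x) * (case z of (s, l) \<Rightarrow> drift_density x 0 s l))"
      using AE_pair_pos
    proof eventually_elim
      case (elim z)
      obtain s l where z: "z = (s, l)" by (cases z)
      have s: "s > 0" using elim z by simp
      have "norm (survival_density x \<beta> s l *\<^sub>R h l) \<le> exp (- \<beta> * x) * drift_density x 0 s l"
      proof (cases "l > 0")
        case True
        have "norm (survival_density x \<beta> s l *\<^sub>R h l) = exp (- \<beta> * x - \<beta>\<^sup>2 * s / 2) * (exp (- Im k * l) * image_kernel s x l)"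
          unfolding h using True image_kernel_nonneg[OF s x_pos, of l] by (simp add: norm_mult norm_exp_eq_Re)
        also have "\<dots> \<le> exp (- \<beta> * x) * (1 * heat s (l - x))"
          using True k s image_kernel_nonneg[OF s x_pos, of l]
          by (intro mult_mono) (auto simp: image_kernel_def)
        finally show ?thesis by (simp add: drift_density_def)
      qed (simp add: survival_density_def drift_density_nonneg)
      then show ?case by (simp add: z drift_density_nonneg)
    qed
  qed measurable
  note mix = expectation_mixed[OF mixture_density_survival L_measurable hm int]
  show "integrable M (\<lambda>\<omega>. indicator {\<omega>. ereal t < hitting_time \<omega>} \<omega> * h (L \<omega>))" by (rule mix(1))
  have "(\<integral>\<omega>. indicator {\<omega>. ereal t < hitting_time \<omega>} \<omega> * h (L \<omega>) \<partial>M)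
    = (\<integral>s. (LBINT l. survival_density x \<beta> s l *\<^sub>R h l) \<partial>N)" by (rule mix(2))
  also have "\<dots> = (\<integral>s. complex_of_real (exp (- \<beta> * x) / (2 * pi)) *
    (LBINT y. resolvent k y * wave 0 x y * gauss_kernel \<beta> 0 y s) \<partial>N)"
  proof (rule integral_cong_AE)
    show "AE s in N. (LBINT l. survival_density x \<beta> s l *\<^sub>R h l) = complex_of_real (exp (- \<beta> * x) / (2 * pi)) *
      (LBINT y. resolvent k y * wave 0 x y * gauss_kernel \<beta> 0 y s)"
      using AE_N_pos
    proof eventually_elim
      case (elim s)
      let ?I = "LBINT y. resolvent k y * wave 0 x y * complex_of_real (gauss s y)"
      have "(LBINT y. resolvent k y * wave 0 x y * gauss_kernel \<beta> 0 y s) = complex_of_real (gauss s \<beta>) * ?I"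
        unfolding gauss_kernel_real by (simp only: mult.left_commute[of _ "complex_of_real (gauss s \<beta>)"] integral_mult_right_zero)
      moreover have "exp (- \<beta> * x - \<beta>\<^sup>2 * s / 2) = exp (- \<beta> * x) * gauss s \<beta>" by (simp flip: exp_add)
      ultimately show ?case
        unfolding h integral_mult_right_zero image_kernel_transform[OF elim k] by simp
    qed
  qed measurable
  also have "\<dots> = complex_of_real (exp (- \<beta> * x) / (2 * pi)) *
    line_integral 0 (resolvent_integrand k)"
    unfolding line_integral_eq(2)[OF has_line_integral_resolvent[OF k]] by (rule integral_mult_right_zero)
  finally show "(\<integral>\<omega>. indicator {\<omega>. ereal t < hitting_time \<omega>} \<omega> * h (L \<omega>) \<partial>M)
      = complex_of_real (exp (- \<beta> * x) / (2 * pi)) *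
        line_integral 0 (resolvent_integrand k)" .
qed

end

theorem proposition1:
  fixes M :: "'a measure" and W G X L :: "real \<Rightarrow> 'a \<Rightarrow> real"
    and x \<sigma> \<beta> :: real and t2 :: "'a \<Rightarrow> ereal"
    and E\<psi> :: "complex \<Rightarrow> real \<Rightarrow> complex"
  assumes "prob_space M"
    and "standard_brownian_motion M W"
    and "time_change M G"
    and "independent_processes M W G"
    and "x > 0" and "\<sigma> > 0"
  defines "X \<equiv> drifted_bm x \<sigma> \<beta> W"
    and "L \<equiv> tcbm X G"
    and "t2 \<equiv> first_passage2 X G"
    and "E\<psi> \<equiv> (\<lambda>z t. exp_minus_psi M G
                (complex_of_real (\<sigma>\<^sup>2) * (z\<^sup>2 + complex_of_real (\<beta>\<^sup>2)) / 2) t)"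
  shows
    "(\<forall>t>0. \<forall>\<epsilon>::real.
        (\<forall>z. Im z = \<epsilon> \<longrightarrow>
           complex_of_real (\<sigma>\<^sup>2) * (z\<^sup>2 + complex_of_real (\<beta>\<^sup>2)) / 2 \<in> laplace_domain M G t) \<longrightarrow>
        (\<forall>l::real. l > 0 \<longrightarrow> l \<noteq> x \<longrightarrow>
           line_integrable \<epsilon> (\<lambda>z. (exp (\<i> * z * (complex_of_real l - complex_of_real x))
              - exp (\<i> * z * (complex_of_real l + complex_of_real x))) * E\<psi> z t)) \<and>
        is_delta_density M (\<lambda>\<omega>. ereal t < t2 \<omega>) (L t)
          (\<lambda>l. indicator {0<..} l * (complex_of_real (exp (\<beta> * (l - x)) / (2 * pi)) *
             line_integral \<epsilon> (\<lambda>z. (exp (\<i> * z * (complex_of_real l - complex_of_real x))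
              - exp (\<i> * z * (complex_of_real l + complex_of_real x))) * E\<psi> z t))) \<and>
        (\<forall>l::real.
           line_integrable \<epsilon> (\<lambda>z. exp (\<i> * z * (complex_of_real x + complex_of_real \<bar>l\<bar>)) * E\<psi> z t)) \<and>
        is_delta_density M (\<lambda>\<omega>. t2 \<omega> \<le> ereal t) (L t)
          (\<lambda>l. complex_of_real (exp (\<beta> * (l - x)) / (2 * pi)) *
             line_integral \<epsilon>
               (\<lambda>z. exp (\<i> * z * (complex_of_real x + complex_of_real \<bar>l\<bar>)) * E\<psi> z t)))
     \<and>
     (\<forall>t>0.
        line_integrable 0
          (\<lambda>z. z * sin (z * complex_of_real x) / (z\<^sup>2 + complex_of_real (\<beta>\<^sup>2)) * E\<psi> z t) \<and>
        {\<omega>\<in>space M. t2 \<omega> \<le> ereal t} \<in> sets M \<and>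
        complex_of_real (\<integral>\<omega>. indicator {\<omega>. t2 \<omega> \<le> ereal t} \<omega> \<partial>M)
          = complex_of_real (exp (- 2 * \<beta> * x) * (if \<beta> > 0 then 1 else 0)
              + (if \<beta> \<le> 0 then 1 else 0))
            - complex_of_real (exp (- \<beta> * x) / pi) *
              line_integral 0
                (\<lambda>z. z * sin (z * complex_of_real x) / (z\<^sup>2 + complex_of_real (\<beta>\<^sup>2)) * E\<psi> z t))
     \<and>
     (\<forall>t>0. \<forall>k::complex. Im k > 0 \<longrightarrow>
        line_integrable 0
          (\<lambda>z. (\<i> / (k - z) - \<i> / (k + z)) * exp (\<i> * z * complex_of_real x) * E\<psi> z t) \<and>
        integrable M (\<lambda>\<omega>. indicator {\<omega>. ereal t < t2 \<omega>} \<omega> *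
          exp (- complex_of_real (\<beta> * L t \<omega>) + \<i> * k * complex_of_real (L t \<omega>))) \<and>
        (\<integral>\<omega>. indicator {\<omega>. ereal t < t2 \<omega>} \<omega> *
          exp (- complex_of_real (\<beta> * L t \<omega>) + \<i> * k * complex_of_real (L t \<omega>)) \<partial>M)
          = complex_of_real (exp (- \<beta> * x) / (2 * pi)) *
            line_integral 0
              (\<lambda>z. (\<i> / (k - z) - \<i> / (k + z)) * exp (\<i> * z * complex_of_real x) * E\<psi> z t))"
proof -
  \<comment> \<open>The locale predicate does not take \<open>\<beta>\<close>, as no locale
    assumption mentions it; the interpretations below supply it.\<close>
  have loc: "time_changed_brownian M W x \<sigma> G t" if "t > 0" for t
    using assms(1-6) that
    by (simp add: time_changed_brownian_def drifted_brownian_def time_changed_brownian_axioms_def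
        drifted_brownian_axioms_def)
  show ?thesis
    unfolding X_def L_def t2_def E\<psi>_def
  proof (intro conjI allI impI, goal_cases)
    case (1 t \<epsilon> l)
    then interpret time_changed_brownian M W x \<sigma> \<beta> G t by (intro loc)
    show ?case
      using line_integral_eq(1)[OF has_line_integral_survival[OF integrable_N_exp[OF 1(2)] 1(3,4)]] .
  next
    case (2 t \<epsilon>)
    then interpret time_changed_brownian M W x \<sigma> \<beta> G t by (intro loc)
    show ?case using survival_delta_density[OF integrable_N_exp[OF 2(2)]] .
  next
    case (3 t \<epsilon> l)
    then interpret time_changed_brownian M W x \<sigma> \<beta> G t by (intro loc)
    show ?case using line_integral_eq(1)[OF has_line_integral_hit[OF integrable_N_exp[OF 3(2)]]] .
  next
    case (4 t \<epsilon>)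
    then interpret time_changed_brownian M W x \<sigma> \<beta> G t by (intro loc)
    show ?case using hit_delta_density[OF integrable_N_exp[OF 4(2)]] .
  next
    case (5 t)
    then interpret time_changed_brownian M W x \<sigma> \<beta> G t by (intro loc)
    show ?case using line_integral_eq(1)[OF has_line_integral_sine_ratio] .
  next
    case (6 t)
    then interpret time_changed_brownian M W x \<sigma> \<beta> G t by (intro loc)
    show ?case by (rule hit_measurable)
  next
    case (7 t)
    then interpret time_changed_brownian M W x \<sigma> \<beta> G t by (intro loc)
    show ?case by (rule hit_probability)
  next
    case (8 t k)
    then interpret time_changed_brownian M W x \<sigma> \<beta> G t by (intro loc)
    show ?case using line_integral_eq(1)[OF has_line_integral_resolvent[OF 8(2)]] .
  next
    case (9 t k)
    then interpret time_changed_brownian M W x \<sigma> \<beta> G t by (intro loc)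
    show ?case by (rule survival_transform(1)[OF 9(2)])
  next
    case (10 t k)
    then interpret time_changed_brownian M W x \<sigma> \<beta> G t by (intro loc)
    show ?case by (rule survival_transform(2)[OF 10(2)])
  qed
qed

end
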